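(* Let $(W,S)$ be an irreducible Coxeter system of arbitrary type. The canonical morphism of monoids $Br^+_{(W,S)}\longrightarrow Br_{(W,S)}$, which is the identity on the generators $S$, is injective.
   Context: For a Coxeter system $(W,S)$ with $m_{s,t}$ the order of $st$, $Br_{(W,S)}$ is the group, and $Br^+_{(W,S)}$ the monoid, presented by generators $S$ and the braid relations $sts\cdots=tst\cdots$ ($m_{s,t}$ factors on each side) for all $s\neq t\in S$ (no relation if $m_{s,t}=\infty$). *)

theory Defs
  imports "HOL-Algebra.Algebra"
begin

section \<open>Monoids and groups given by generators and relations\<close>

inductive pres_cong :: "'a set \<Rightarrow> ('a list \<times> 'a list) set \<Rightarrow> 'a list \<Rightarrow> 'a list \<Rightarrow> bool"
  for Z :: "'a set" and R :: "('a list \<times> 'a list) set" where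
  refl: "w \<in> lists Z \<Longrightarrow> pres_cong Z R w w"
| sym: "pres_cong Z R v w \<Longrightarrow> pres_cong Z R w v"
| trans: "pres_cong Z R u v \<Longrightarrow> pres_cong Z R v w \<Longrightarrow> pres_cong Z R u w"
| step: "(u, v) \<in> R \<Longrightarrow> u \<in> lists Z \<Longrightarrow> v \<in> lists Z \<Longrightarrow> x \<in> lists Z \<Longrightarrow> y \<in> lists Z
    \<Longrightarrow> pres_cong Z R (x @ u @ y) (x @ v @ y)"

definition pres_rel :: "'a set \<Rightarrow> ('a list \<times> 'a list) set \<Rightarrow> ('a list \<times> 'a list) set" where
  "pres_rel Z R = {(v, w). pres_cong Z R v w}"

definition presented_monoid :: "'a set \<Rightarrow> ('a list \<times> 'a list) set \<Rightarrow> 'a list set monoid" where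
  "presented_monoid Z R =
    \<lparr> carrier = lists Z // pres_rel Z R,
      monoid.mult = (\<lambda>A B. \<Union>a\<in>A. \<Union>b\<in>B. pres_rel Z R `` {a @ b}),
      monoid.one = pres_rel Z R `` {[]} \<rparr>"

text \<open>In words over \<open>Z \<times> UNIV\<close>, the letter \<open>(x, True)\<close> stands for the generator \<open>x\<close>
  and \<open>(x, False)\<close> for its formal inverse.\<close>

definition pos_word :: "'a list \<Rightarrow> ('a \<times> bool) list" where
  "pos_word w = map (\<lambda>x. (x, True)) w"

definition cancel_rels :: "'a set \<Rightarrow> (('a \<times> bool) list \<times> ('a \<times> bool) list) set" where
  "cancel_rels Z = {([(x, e), (x, \<not> e)], []) |x e. x \<in> Z}"

definition group_rel ::
  "'a set \<Rightarrow> (('a \<times> bool) list \<times> ('a \<times> bool) list) set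
    \<Rightarrow> (('a \<times> bool) list \<times> ('a \<times> bool) list) set" where
  "group_rel Z R = pres_rel (Z \<times> UNIV) (cancel_rels Z \<union> R)"

definition presented_group ::
  "'a set \<Rightarrow> (('a \<times> bool) list \<times> ('a \<times> bool) list) set \<Rightarrow> ('a \<times> bool) list set monoid" where
  "presented_group Z R = presented_monoid (Z \<times> UNIV) (cancel_rels Z \<union> R)"

lemma pres_cong_lists: "pres_cong Z R v w \<Longrightarrow> v \<in> lists Z \<and> w \<in> lists Z"
  by (induction rule: pres_cong.induct) auto

lemma equiv_pres_rel: "equiv (lists Z) (pres_rel Z R)"
proof (rule equivI)
  show "pres_rel Z R \<subseteq> lists Z \<times> lists Z"
    using pres_cong_lists unfolding pres_rel_def by blast
  show "refl_on (lists Z) (pres_rel Z R)"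
    by (rule refl_onI) (simp add: pres_rel_def pres_cong.refl del: in_lists_conv_set)
  show "sym (pres_rel Z R)"
    by (rule symI) (simp add: pres_rel_def pres_cong.sym)
  show "trans (pres_rel Z R)"
    by (rule transI) (simp add: pres_rel_def, rule pres_cong.trans)
qed

lemma pres_cong_append:
  assumes "pres_cong Z R v w" "x \<in> lists Z" "y \<in> lists Z"
  shows "pres_cong Z R (x @ v @ y) (x @ w @ y)"
  using assms
proof (induction rule: pres_cong.induct)
  case (refl w)
  then show ?case by (intro pres_cong.refl) auto
next
  case (sym v w)
  then show ?case by (simp add: pres_cong.sym)
next
  case (trans u v w)
  then show ?case by (simp, metis pres_cong.trans)
next
  case (step u v x' y')
  then have "pres_cong Z R ((x @ x') @ u @ (y' @ y)) ((x @ x') @ v @ (y' @ y))"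
    by (intro pres_cong.step) auto
  then show ?case by simp
qed

lemma pres_cong_append2:
  assumes "pres_cong Z R a a'" "pres_cong Z R b b'"
  shows "pres_cong Z R (a @ b) (a' @ b')"
proof -
  have "pres_cong Z R (a @ b) (a' @ b)"
    using pres_cong_append[OF assms(1), of "[]" b] pres_cong_lists[OF assms(2)] by simp
  moreover have "pres_cong Z R (a' @ b) (a' @ b')"
    using pres_cong_append[OF assms(2), of a' "[]"] pres_cong_lists[OF assms(1)] by simp
  ultimately show ?thesis by (rule pres_cong.trans)
qed

lemma presented_monoid_mult_class:
  assumes "v \<in> lists Z" "w \<in> lists Z"
  shows "pres_rel Z R `` {v} \<otimes>\<^bsub>presented_monoid Z R\<^esub> pres_rel Z R `` {w} = pres_rel Z R `` {v @ w}"
proof -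
  have "pres_rel Z R `` {a @ b} = pres_rel Z R `` {a' @ b'}"
    if "(a, a') \<in> pres_rel Z R" "(b, b') \<in> pres_rel Z R" for a a' b b'
    using that pres_cong_append2[of Z R a a' b b']
    by (intro equiv_class_eq[OF equiv_pres_rel]) (simp add: pres_rel_def)
  then have "congruent2 (pres_rel Z R) (pres_rel Z R) (\<lambda>a b. pres_rel Z R `` {a @ b})"
    unfolding congruent2_def by blast
  from UN_equiv_class2[OF equiv_pres_rel equiv_pres_rel this assms] show ?thesis
    by (simp add: presented_monoid_def)
qed

lemma monoid_presented_monoid: "monoid (presented_monoid Z R)"
proof -
  have c: "A \<in> carrier (presented_monoid Z R) \<longleftrightarrow> (\<exists>w\<in>lists Z. A = pres_rel Z R `` {w})" for A
    by (auto simp: presented_monoid_def quotient_def)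
  have one: "\<one>\<^bsub>presented_monoid Z R\<^esub> = pres_rel Z R `` {[]}"
    by (simp add: presented_monoid_def)
  show ?thesis
  proof (rule monoidI)
    show "\<one>\<^bsub>presented_monoid Z R\<^esub> \<in> carrier (presented_monoid Z R)"
      using c one by blast
  next
    fix A B
    assume "A \<in> carrier (presented_monoid Z R)" "B \<in> carrier (presented_monoid Z R)"
    then obtain a b where ab: "a \<in> lists Z" "b \<in> lists Z"
      "A = pres_rel Z R `` {a}" "B = pres_rel Z R `` {b}"
      using c by auto
    show "A \<otimes>\<^bsub>presented_monoid Z R\<^esub> B \<in> carrier (presented_monoid Z R)"
      unfolding c ab(3,4) presented_monoid_mult_class[OF ab(1,2)]
      using ab(1,2) by (intro bexI[of _ "a @ b"]) auto
  next
    fix A B C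
    assume "A \<in> carrier (presented_monoid Z R)" "B \<in> carrier (presented_monoid Z R)"
      "C \<in> carrier (presented_monoid Z R)"
    then obtain a b d where "a \<in> lists Z" "b \<in> lists Z" "d \<in> lists Z"
      "A = pres_rel Z R `` {a}" "B = pres_rel Z R `` {b}" "C = pres_rel Z R `` {d}"
      using c by auto
    then show "A \<otimes>\<^bsub>presented_monoid Z R\<^esub> B \<otimes>\<^bsub>presented_monoid Z R\<^esub> C =
        A \<otimes>\<^bsub>presented_monoid Z R\<^esub> (B \<otimes>\<^bsub>presented_monoid Z R\<^esub> C)"
      by (simp add: presented_monoid_mult_class del: in_lists_conv_set)
  next
    fix A
    assume "A \<in> carrier (presented_monoid Z R)"
    then obtain a where a: "a \<in> lists Z" "A = pres_rel Z R `` {a}"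
      using c by auto
    show "\<one>\<^bsub>presented_monoid Z R\<^esub> \<otimes>\<^bsub>presented_monoid Z R\<^esub> A = A"
      using a presented_monoid_mult_class[of "[]" Z a R] by (simp add: one)
    show "A \<otimes>\<^bsub>presented_monoid Z R\<^esub> \<one>\<^bsub>presented_monoid Z R\<^esub> = A"
      using a presented_monoid_mult_class[of a Z "[]" R] by (simp add: one)
  qed
qed

lemma group_presented_group: "group (presented_group Z R)"
proof -
  let ?Y = "Z \<times> (UNIV :: bool set)" and ?R = "cancel_rels Z \<union> R"
  let ?iv = "\<lambda>w :: ('a \<times> bool) list. rev (map (\<lambda>(x, e). (x, \<not> e)) w)"
  interpret monoid "presented_monoid ?Y ?R" by (rule monoid_presented_monoid)
  have iv: "?iv w \<in> lists ?Y" if "w \<in> lists ?Y" for w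
    using that by auto
  have canc: "pres_cong ?Y ?R (?iv w @ w) []" if "w \<in> lists ?Y" for w
    using that
  proof (induction w rule: lists.induct)
    case Nil
    show ?case by (simp add: pres_cong.refl)
  next
    case (Cons a w)
    obtain x e where a: "a = (x, e)" by (cases a)
    have w: "w \<in> lists ?Y" and x: "x \<in> Z" using Cons.hyps a by (auto simp del: in_lists_conv_set)
    have "([(x, \<not> e), (x, e)], []) \<in> ?R" using x unfolding cancel_rels_def by force
    then have "pres_cong ?Y ?R (?iv w @ [(x, \<not> e), (x, e)] @ w) (?iv w @ [] @ w)"
      using w x iv[OF w] by (intro pres_cong.step) auto
    then have "pres_cong ?Y ?R (?iv (a # w) @ (a # w)) (?iv w @ w)" using a by simp
    then show ?case using Cons.IH by (rule pres_cong.trans)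
  qed
  show ?thesis
    unfolding presented_group_def
  proof (rule groupI)
    fix A assume "A \<in> carrier (presented_monoid ?Y ?R)"
    then obtain w where w: "w \<in> lists ?Y" "A = pres_rel ?Y ?R `` {w}"
      by (auto simp: presented_monoid_def quotient_def)
    have "pres_rel ?Y ?R `` {?iv w} \<otimes>\<^bsub>presented_monoid ?Y ?R\<^esub> A = pres_rel ?Y ?R `` {?iv w @ w}"
      using presented_monoid_mult_class[OF iv[OF w(1)] w(1), of ?R] w(2) by simp
    also have "\<dots> = \<one>\<^bsub>presented_monoid ?Y ?R\<^esub>"
      using equiv_class_eq[OF equiv_pres_rel, of _ _ ?Y ?R] canc[OF w(1)]
      by (simp add: presented_monoid_def pres_rel_def)
    finally show "\<exists>B\<in>carrier (presented_monoid ?Y ?R).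
        B \<otimes>\<^bsub>presented_monoid ?Y ?R\<^esub> A = \<one>\<^bsub>presented_monoid ?Y ?R\<^esub>"
      using quotientI[OF iv[OF w(1)], of "pres_rel ?Y ?R"]
      by (intro bexI) (simp_all add: presented_monoid_def)
  qed (auto simp: m_assoc)
qed


section \<open>Coxeter systems\<close>

text \<open>As \<open>group.ord\<close> is \<open>0\<close> on elements of infinite order, the value \<open>0\<close> encodes
  \<open>m\<^bsub>s,t\<^esub> = \<infinity>\<close>.\<close>

definition cox_m :: "('a, 'b) monoid_scheme \<Rightarrow> 'a \<Rightarrow> 'a \<Rightarrow> nat" where
  "cox_m W s t = group.ord W (s \<otimes>\<^bsub>W\<^esub> t)"

text \<open>The relations \<open>(s t)^m = 1\<close> with \<open>m = m\<^bsub>s,t\<^esub>\<close> finite; the case \<open>s = t\<close> gives \<open>s\<^sup>2 = 1\<close>.\<close>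

definition coxeter_rels ::
  "('a, 'b) monoid_scheme \<Rightarrow> 'a set \<Rightarrow> (('a \<times> bool) list \<times> ('a \<times> bool) list) set" where
  "coxeter_rels W S =
    {(pos_word (concat (replicate (cox_m W s t) [s, t])), []) |s t.
      s \<in> S \<and> t \<in> S \<and> cox_m W s t \<noteq> 0}"

text \<open>The last condition says that \<open>W\<close> is presented by the generators \<open>S\<close> and the above relations;
  in particular \<open>S\<close> generates \<open>W\<close>.  The set \<open>S\<close> is allowed to be infinite.\<close>

definition coxeter_system :: "('a, 'b) monoid_scheme \<Rightarrow> 'a set \<Rightarrow> bool" where
  "coxeter_system W S \<longleftrightarrow>
    group W \<and> S \<subseteq> carrier W \<and> (\<forall>s\<in>S. group.ord W s = 2) \<and>
    (\<exists>h \<in> iso (presented_group S (coxeter_rels W S)) W.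
      \<forall>s\<in>S. h (group_rel S (coxeter_rels W S) `` {pos_word [s]}) = s)"

definition coxeter_edges :: "('a, 'b) monoid_scheme \<Rightarrow> 'a set \<Rightarrow> ('a \<times> 'a) set" where
  "coxeter_edges W S =
    {(s, t). s \<in> S \<and> t \<in> S \<and> s \<noteq> t \<and> (cox_m W s t \<ge> 3 \<or> cox_m W s t = 0)}"

text \<open>Irreducibility: the Coxeter graph is nonempty and connected.\<close>

definition irreducible_coxeter_system :: "('a, 'b) monoid_scheme \<Rightarrow> 'a set \<Rightarrow> bool" where
  "irreducible_coxeter_system W S \<longleftrightarrow>
    coxeter_system W S \<and> S \<noteq> {} \<and> (\<forall>s\<in>S. \<forall>t\<in>S. (s, t) \<in> (coxeter_edges W S)\<^sup>*)"


section \<open>Braid monoids and braid groups\<close>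

text \<open>\<open>alt_word n s t\<close> is the word \<open>s t s \<dots>\<close> with \<open>n\<close> letters.\<close>

fun alt_word :: "nat \<Rightarrow> 'a \<Rightarrow> 'a \<Rightarrow> 'a list" where
  "alt_word 0 s t = []"
| "alt_word (Suc n) s t = s # alt_word n t s"

definition braid_rels :: "('a, 'b) monoid_scheme \<Rightarrow> 'a set \<Rightarrow> ('a list \<times> 'a list) set" where
  "braid_rels W S =
    {(alt_word (cox_m W s t) s t, alt_word (cox_m W s t) t s) |s t.
      s \<in> S \<and> t \<in> S \<and> s \<noteq> t \<and> cox_m W s t \<noteq> 0}"

definition braid_group_rels ::
  "('a, 'b) monoid_scheme \<Rightarrow> 'a set \<Rightarrow> (('a \<times> bool) list \<times> ('a \<times> bool) list) set" where
  "braid_group_rels W S = {(pos_word u, pos_word v) |u v. (u, v) \<in> braid_rels W S}"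

definition braid_monoid :: "('a, 'b) monoid_scheme \<Rightarrow> 'a set \<Rightarrow> 'a list set monoid" where
  "braid_monoid W S = presented_monoid S (braid_rels W S)"

definition braid_group :: "('a, 'b) monoid_scheme \<Rightarrow> 'a set \<Rightarrow> ('a \<times> bool) list set monoid" where
  "braid_group W S = presented_group S (braid_group_rels W S)"

definition braid_monoid_gen :: "('a, 'b) monoid_scheme \<Rightarrow> 'a set \<Rightarrow> 'a \<Rightarrow> 'a list set" where
  "braid_monoid_gen W S s = pres_rel S (braid_rels W S) `` {[s]}"

definition braid_group_gen ::
  "('a, 'b) monoid_scheme \<Rightarrow> 'a set \<Rightarrow> 'a \<Rightarrow> ('a \<times> bool) list set" where
  "braid_group_gen W S s = group_rel S (braid_group_rels W S) `` {pos_word [s]}"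

text \<open>The class of a word is sent to the class of the same word; all members of the union
  coincide.\<close>

definition braid_canonical_map ::
  "('a, 'b) monoid_scheme \<Rightarrow> 'a set \<Rightarrow> 'a list set \<Rightarrow> ('a \<times> bool) list set" where
  "braid_canonical_map W S A = (\<Union>w\<in>A. group_rel S (braid_group_rels W S) `` {pos_word w})"

end

theory Submission
  imports Defs
begin

text \<open>The proof follows Paris and Hee: equality in the braid group is tested on a linear representation of
Lawrence--Krammer type, and the representation is faithful on positive words because it remembers,
for every positive word, which generators divide it on the left.

Consider first a simply laced graph, where \<open>m\<^bsub>s,t\<^esub>\<close> is \<open>2\<close> or \<open>3\<close>, and let \<open>\<Phi>\<^sup>+\<close> be its positive roots.
The Hecke algebra at parameter \<open>1/2\<close> acts on \<open>\<Phi>\<^sup>+\<close> by nonnegative matrices (\<open>hecke\<close>); killing the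
root \<open>\<alpha>\<^sub>s\<close> under the generator \<open>s\<close> keeps the braid relations but makes the operators singular.  They
are repaired by a rank one perturbation, \<open>hecke s + x f\<^sub>s \<otimes> \<alpha>\<^sub>s\<close>, with a scalar \<open>x\<close> and linear forms
\<open>f\<^sub>s\<close>.  The perturbed operators are invertible for \<open>x \<noteq> 0\<close>, and they satisfy the braid relations as
soon as the forms do a linear system of relations (\<open>hecke_form_nadj\<close>, \<open>hecke_form_adj\<close>).  Solving this
system is the delicate point.  The values of \<open>f\<^sub>s = 1/2 - h\<^sub>s\<close> are defined by recursion on the depth of
a root, and independence of the chosen descent is a confluence argument in root subsystems of rank
three (\<open>h_ok_all\<close>).

If two positive words are equal in the group, they act equally for all \<open>x \<noteq> 0\<close>, hence also in the
limit \<open>x = 0\<close>, where all entries are nonnegative and only the supports matter.  There the generator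
\<open>s\<close> divides the word \<open>w\<close> on the left exactly when \<open>w\<close> annihilates \<open>\<alpha>\<^sub>s\<close>
(\<open>sdiv_acts_empty\<close>, \<open>acts_nonempty_if_not_sdiv\<close>).  So two words with the same action have a common first
letter, which can be cancelled because the operators with \<open>x \<noteq> 0\<close> are invertible.

Arbitrary finite labels are reduced to the simply laced case by folding.  Every generator \<open>s\<close> is replaced
by a product of \<open>N\<close> commuting copies, in such a way that the copies of \<open>s\<close> and \<open>t\<close> together form disjoint
paths with \<open>m\<^bsub>s,t\<^esub> - 1\<close> vertices.  The positive roots of a path are its intervals, and the two
commuting products move the ends of an interval in a simple way.  Following the ends shows that an
alternating word with fewer than \<open>m\<^bsub>s,t\<^esub>\<close> factors reaches the simple roots of all copies of the next
letter (\<open>transit_copies\<close>) and that one with \<open>m\<^bsub>s,t\<^esub>\<close> factors annihilates every simple root of the path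
(\<open>death_copies\<close>).  Together with the divisibility criterion this gives both the braid relation of
length \<open>m\<^bsub>s,t\<^esub>\<close> for the folded generators and the divisibility criterion for the folded monoid.

Finally, an equality in the group involves finitely many generators only, and since braid relations
preserve the length of positive words, a label \<open>\<infinity>\<close> may be replaced by any label exceeding that length.\<close>

section \<open>Roots of a simply laced graph\<close>

text \<open>Vertices are the generators; adjacent ones satisfy a braid relation of length three, the other ones
commute.  Without triangles, the rank three subgraphs met in the confluence argument below are all
of finite type.  Local finiteness makes the pairing with a simple root a finite sum.\<close>

locale small_graph =
  fixes adj :: "'v \<Rightarrow> 'v \<Rightarrow> bool"
  assumes adj_sym: "adj s t \<Longrightarrow> adj t s"
    and adj_irrefl: "\<not> adj s s"
    and no_triangle: "adj s t \<Longrightarrow> adj t u \<Longrightarrow> \<not> adj s u"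
    and locally_finite: "finite {t. adj s t}"
begin

definition alpha :: "'v \<Rightarrow> 'v \<Rightarrow> int" where
  "alpha s = (\<lambda>t. if t = s then 1 else 0)"

text \<open>Twice the standard bilinear form of the graph, evaluated at the simple root of \<open>s\<close> and at \<open>b\<close>; vectors
are written in the basis of simple roots.\<close>

definition pairing :: "'v \<Rightarrow> ('v \<Rightarrow> int) \<Rightarrow> int" where
  "pairing s b = 2 * b s - (\<Sum>t | adj s t. b t)"

definition reflect :: "'v \<Rightarrow> ('v \<Rightarrow> int) \<Rightarrow> 'v \<Rightarrow> int" where
  "reflect s b = b(s := b s - pairing s b)"

lemma adj_neq: "adj s t \<Longrightarrow> s \<noteq> t"
  using adj_irrefl by blast

lemma alpha_eq [simp]: "alpha s = alpha t \<longleftrightarrow> s = t"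
  by (metis alpha_def zero_neq_one)

lemma pairing_upd:
  "pairing t (b(s := b s + c)) = pairing t b + (if t = s then 2 * c else if adj t s then - c else 0)"
proof (cases "adj t s")
  case True
  have "(\<Sum>u | adj t u. (b(s := b s + c)) u) = (\<Sum>u | adj t u. b u) + c"
    using sum.remove[OF locally_finite, of s t "b(s := b s + c)"]
      sum.remove[OF locally_finite, of s t b] True by simp
  then show ?thesis using True adj_neq unfolding pairing_def by force
next
  case False
  have "(\<Sum>u | adj t u. (b(s := b s + c)) u) = (\<Sum>u | adj t u. b u)"
    using False by (intro sum.cong) auto
  then show ?thesis using False unfolding pairing_def by auto
qed

lemma pairing_alpha: "pairing t (alpha s) = (if t = s then 2 else if adj t s then - 1 else 0)"
proof -
  have "alpha s = (\<lambda>_. 0)(s := (\<lambda>_. 0) s + 1)" by (auto simp: alpha_def)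
  moreover have "pairing t (\<lambda>_. 0) = 0" by (simp add: pairing_def)
  ultimately show ?thesis using pairing_upd[of t "\<lambda>_. 0" s 1] by simp
qed

lemma pairing_reflect:
  "pairing t (reflect s b) = (if t
      = s then - pairing s b else if adj t s then pairing t b + pairing s b else pairing t b)"
  using pairing_upd[of t b s "- pairing s b"] by (auto simp: reflect_def)

lemma pairing_reflect_same [simp]: "pairing s (reflect s b) = - pairing s b"
  by (simp add: pairing_reflect)

lemma pairing_reflect_adj: "adj s t \<Longrightarrow> pairing t (reflect s b) = pairing t b + pairing s b"
  using adj_neq adj_sym by (auto simp: pairing_reflect)

lemma pairing_reflect_nadj: "\<not> adj s t \<Longrightarrow> s \<noteq> t \<Longrightarrow> pairing t (reflect s b) = pairing t b"
  using adj_sym by (auto simp: pairing_reflect)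

lemma reflect_apply: "reflect s b u = (if u = s then b s - pairing s b else b u)"
  by (simp add: reflect_def)

lemma reflect_reflect [simp]: "reflect s (reflect s b) = b"
  by (auto simp: reflect_apply fun_eq_iff)

lemma reflect_fixed: "pairing s b = 0 \<Longrightarrow> reflect s b = b"
  by (auto simp: reflect_apply)

lemma reflect_commute: "\<not> adj s t \<Longrightarrow> s \<noteq> t \<Longrightarrow> reflect s (reflect t b) = reflect t (reflect s b)"
  using adj_sym by (auto simp: reflect_apply pairing_reflect fun_eq_iff)

lemma reflect_braid: "adj s t
    \<Longrightarrow> reflect s (reflect t (reflect s b)) = reflect t (reflect s (reflect t b))"
  using adj_neq[of s t] adj_sym[of s t] by (auto simp: reflect_apply pairing_reflect fun_eq_iff)

lemma reflect_alpha_adj: "adj s t \<Longrightarrow> reflect s (alpha t) = reflect t (alpha s)"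
  using adj_neq[of s t] adj_sym[of s t]
      by (auto simp: reflect_apply pairing_alpha fun_eq_iff) (auto simp: alpha_def)

lemma reflect_alpha_nadj: "\<not> adj s t \<Longrightarrow> s \<noteq> t \<Longrightarrow> reflect s (alpha t) = alpha t"
  by (rule reflect_fixed) (simp add: pairing_alpha)

text \<open>Positive roots are generated from the simple ones by reflections that raise them.  The number counts
the raising steps.  This avoids the Coxeter group and the theorem that every root is positive or
negative: all that is needed is that lowering reflections stay inside the set.\<close>

inductive pos_root :: "nat \<Rightarrow> ('v \<Rightarrow> int) \<Rightarrow> bool" where
  simple: "pos_root 0 (alpha s)"
| up: "pos_root n b \<Longrightarrow> pairing s b < 0 \<Longrightarrow> pos_root (Suc n) (reflect s b)"

lemma pos_nonneg: "pos_root n b \<Longrightarrow> 0 \<le> b u"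
  by (induction rule: pos_root.induct) (auto simp: alpha_def reflect_def)

lemma pos_0D: "pos_root 0 b \<Longrightarrow> \<exists>s. b = alpha s"
  by (cases rule: pos_root.cases) auto

lemma pos_not_neg_simple: "\<not> pos_root n (reflect s (alpha s))"
  using pos_nonneg[of n "reflect s (alpha s)" s]
      by (auto simp: reflect_apply pairing_alpha) (simp add: alpha_def)

text \<open>Induction on the depth.  If \<open>b\<close> was obtained from \<open>c\<close> by raising with \<open>t \<noteq> s\<close>, then \<open>s\<close> also lowers
\<open>c\<close>, and the braid relation between the two reflections gives another ascent to \<open>b\<close> that ends with \<open>s\<close>.\<close>

lemma pos_down_ex: "pos_root n b \<Longrightarrow> pairing s b > 0 \<Longrightarrow> b \<noteq> alpha s
    \<Longrightarrow> \<exists>k. n = Suc k \<and> pos_root k (reflect s b)"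
proof (induction n arbitrary: b s rule: less_induct)
  case (less n)
  from less.prems(1) show ?case
  proof (cases rule: pos_root.cases)
    case (simple t)
    then show ?thesis using less.prems by (auto simp: pairing_alpha split: if_splits)
  next
    case (up k c t)
    show ?thesis
    proof (cases "s = t")
      case True
      then show ?thesis using up by auto
    next
      case st: False
      show ?thesis
      proof (cases "adj t s")
        case False
        have 1: "pairing s c > 0" using less.prems(2) up st False by (simp add: pairing_reflect_nadj)
        have "c \<noteq> alpha s" using up(4) False st adj_sym by (auto simp: pairing_alpha)
        then obtain j where j: "k = Suc j" "pos_root j (reflect s c)" using less.IH[of k c s] up 1
            by auto
        have "pairing t (reflect s c) < 0" using up(4) False st adj_sym by (auto simp: pairing_reflect)
        from pos_root.up[OF j(2) this] have "pos_root k (reflect s b)"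
          using reflect_commute[OF False] st up(2) j(1) by simp
        then show ?thesis using up by auto
      next
        case adj: True
        have ns: "adj s t" using adj by (rule adj_sym)
        have 1: "pairing s c + pairing t c > 0" using less.prems(2) up adj
            by (simp add: pairing_reflect_adj)
        then have 2: "pairing s c > 0" using up(4) by simp
        show ?thesis
        proof (cases "c = alpha s")
          case True
          then have "reflect s b = alpha t" using up(2) reflect_alpha_adj[OF ns]
              by (metis reflect_reflect)
          moreover have "k = 0"
          proof (rule ccontr)
            assume "k \<noteq> 0"
            then obtain j where "k = Suc j" using not0_implies_Suc by blast
            with up(3) True have "pos_root (Suc j) (alpha s)" by simp
            then obtain d u where d: "alpha s = reflect u d" "pos_root j d" "pairing u d < 0"
              by (cases rule: pos_root.cases) auto
            have "pairing u (alpha s) > 0" using d by simp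
            then have "u = s" by (auto simp: pairing_alpha split: if_splits)
            then have "d = reflect s (alpha s)" using d(1) by simp
            then show False using d(2) pos_not_neg_simple by metis
          qed
          ultimately show ?thesis using up pos_root.simple by auto
        next
          case False
          obtain j where j: "k = Suc j" "pos_root j (reflect s c)" using less.IH[of k c s] up 2 False
              by auto
          have p3: "pairing t (reflect s c) > 0" using 1 ns by (simp add: pairing_reflect_adj)
          have "reflect s c \<noteq> alpha t"
          proof
            assume "reflect s c = alpha t"
            then have "c = reflect t (alpha s)" using reflect_alpha_adj[OF ns] by (metis reflect_reflect)
            then show False using up(4) adj adj_neq[OF adj] by (simp add: pairing_alpha)
          qed
          then obtain i where i: "j = Suc i" "pos_root i (reflect t (reflect s c))"
            using less.IH[of j "reflect s c" t] up j p3 by auto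
          have p4: "pairing s (reflect t (reflect s c)) = pairing t c"
            using adj ns by (simp add: pairing_reflect_adj)
          have i2: "pos_root (Suc i) (reflect s (reflect t (reflect s c)))"
            using pos_root.up[OF i(2), of s] p4 up(4) by simp
          have p5: "pairing t (reflect s (reflect t (reflect s c))) = - pairing s c"
            using adj ns by (simp add: pairing_reflect_adj)
          have "pos_root (Suc (Suc i)) (reflect t (reflect s (reflect t (reflect s c))))"
            using pos_root.up[OF i2, of t] p5 2 by simp
          then have "pos_root k (reflect s (reflect t c))"
            using reflect_braid[OF ns, of c] i(1) j(1) by simp
          then show ?thesis using up by auto
        qed
      qed
    qed
  qed
qed

text \<open>By \<open>pos_down_ex\<close> the last step of one ascent to \<open>b\<close> can be undone in every other ascent.\<close>

lemma pos_unique: "pos_root n b \<Longrightarrow> pos_root k b \<Longrightarrow> n = k"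
proof (induction n arbitrary: b k)
  case 0
  then obtain s where s: "b = alpha s" using pos_0D by blast
  show ?case
  proof (rule ccontr)
    assume "0 \<noteq> k"
    then obtain j where "k = Suc j" using not0_implies_Suc by metis
    with 0 s have "pos_root (Suc j) (alpha s)" by simp
    then obtain d u where d: "alpha s = reflect u d" "pos_root j d" "pairing u d < 0"
      by (cases rule: pos_root.cases) auto
    have "pairing u (alpha s) > 0" using d by simp
    then have "u = s" by (auto simp: pairing_alpha split: if_splits)
    then have "d = reflect s (alpha s)" using d(1) by simp
    then show False using d(2) pos_not_neg_simple by metis
  qed
next
  case (Suc n)
  from Suc.prems(1) obtain c t where c: "b = reflect t c" "pos_root n c" "pairing t c < 0"
    by (cases rule: pos_root.cases) auto
  have 1: "pairing t b > 0" using c by simp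
  have "b \<noteq> alpha t" using c pos_not_neg_simple by (metis reflect_reflect)
  then obtain j where "k = Suc j" "pos_root j (reflect t b)" using pos_down_ex[OF Suc.prems(2) 1] by auto
  then show ?case using Suc.IH[of c j] c by simp
qed

lemma pos_alpha: "pos_root n (alpha s) \<longleftrightarrow> n = 0"
  using pos_unique pos_root.simple by blast

lemma pos_down: "pos_root (Suc n) b \<Longrightarrow> pairing s b > 0 \<Longrightarrow> pos_root n (reflect s b)"
  using pos_down_ex[of "Suc n" b s] pos_alpha by auto

lemma pos_Suc_ex_down: "pos_root (Suc n) b \<Longrightarrow> \<exists>t. pairing t b > 0"
  by (erule pos_root.cases) (auto, metis neg_0_less_iff_less pairing_reflect_same)

text \<open>The forms \<open>f\<^sub>s\<close> have to satisfy \<open>f\<^sub>s \<circ> t = f\<^sub>s\<close> if \<open>s\<close> and \<open>t\<close> commute and \<open>f\<^sub>s \<circ> t = f\<^sub>t \<circ> s\<close> if they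
are adjacent, where a generator stands for its Hecke operator (\<open>hecke\<close> below).  Since constant
functions are invariant away from the simple roots, it is convenient to write \<open>f\<^sub>s = 1/2 - h\<^sub>s\<close> and to let \<open>h\<^sub>s\<close>
vanish on the roots lowered by \<open>s\<close>, other than \<open>\<alpha>\<^sub>s\<close>.  For a root \<open>c\<close> raised by \<open>t\<close>, the relation evaluated
at \<open>c\<close> then forces \<open>h\<^sub>s\<close> at the higher root, unless both \<open>s\<close> and \<open>t\<close> raise \<open>c\<close>.  In that case it reads
\<open>h\<^sub>s(c) + h\<^sub>s(tc)
    = h\<^sub>t(c) + h\<^sub>t(sc)\<close>, and the symmetric solution in the last line is the one compatible with
the other relations.\<close>

section \<open>The linear forms\<close>

definition h_step :: "('v \<Rightarrow> ('v \<Rightarrow> int) \<Rightarrow> real) \<Rightarrow> 'v \<Rightarrow> 'v \<Rightarrow> ('v \<Rightarrow> int) \<Rightarrow> real" where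
  "h_step h s t c =
    (if \<not> adj s t then h s c
     else if pairing s c > 0 then 2 * h t (reflect s c)
     else if pairing s c = 0 then 2 * h t c - h s c
     else h s c + 2 * h t c)"

text \<open>Values of \<open>h\<close> on the roots of depth at most \<open>n\<close>; at a new root the descent \<open>t\<close> is chosen arbitrarily.\<close>

primrec h_upto :: "nat \<Rightarrow> 'v \<Rightarrow> ('v \<Rightarrow> int) \<Rightarrow> real" where
  "h_upto 0 = (\<lambda>s b. if b = alpha s then 1 else 1 / 2)"
| "h_upto (Suc n) = (\<lambda>s b.
     if pos_root (Suc n) b
     then if pairing s b > 0 then 0
       else let t = SOME t. pairing t b > 0 in h_step (h_upto n) s t (reflect t b)
     else h_upto n s b)"

definition depth :: "('v \<Rightarrow> int) \<Rightarrow> nat" where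
  "depth b = (THE n. pos_root n b)"

definition h :: "'v \<Rightarrow> ('v \<Rightarrow> int) \<Rightarrow> real" where
  "h s b = h_upto (depth b) s b"

lemma depth_eq: "pos_root n b \<Longrightarrow> depth b = n"
  unfolding depth_def using pos_unique by blast

lemma h_upto_h: "pos_root k b \<Longrightarrow> k \<le> n \<Longrightarrow> h_upto n s b = h s b"
proof (induction n)
  case 0
  then show ?case by (simp add: h_def depth_eq)
next
  case (Suc n)
  show ?case
  proof (cases "k = Suc n")
    case True
    then show ?thesis using Suc.prems by (simp add: h_def depth_eq del: h_upto.simps)
  next
    case False
    then have "\<not> pos_root (Suc n) b" using Suc.prems pos_unique by blast
    then show ?thesis using Suc False by simp
  qed
qed

lemma h_simple: "h s (alpha t) = (if s = t then 1 else 1 / 2)"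
  using pos_root.simple depth_eq[OF pos_root.simple] by (auto simp: h_def)

lemma h_step_h_upto:
  assumes "pos_root n c" "\<not> (adj s t \<and> c = alpha s)"
  shows "h_step (h_upto n) s t c = h_step h s t c"
proof -
  have "h_upto n t (reflect s c) = h t (reflect s c)" if a: "adj s t" "pairing s c > 0"
  proof -
    have "c \<noteq> alpha s" using assms a by auto
    then obtain k where "n = Suc k" "pos_root k (reflect s c)" using pos_down_ex[OF assms(1) a(2)]
        by auto
    then show ?thesis by (intro h_upto_h) auto
  qed
  then show ?thesis using assms(1) by (simp add: h_step_def h_upto_h)
qed

lemma h_down: "pos_root (Suc n) b \<Longrightarrow> pairing s b > 0 \<Longrightarrow> h s b = 0"
  by (simp add: h_def depth_eq)

lemma h_some:
  assumes "pos_root (Suc n) b" "pairing s b \<le> 0"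
  shows "\<exists>t. pairing t b > 0 \<and> h s b = h_step h s t (reflect t b)"
proof -
  let ?t = "SOME t. pairing t b > 0"
  have t: "pairing ?t b > 0" using someI_ex[OF pos_Suc_ex_down[OF assms(1)]] .
  have "h s b = h_step (h_upto n) s ?t (reflect ?t b)"
    using assms by (simp add: h_def depth_eq Let_def)
  also have "\<dots> = h_step h s ?t (reflect ?t b)"
  proof (rule h_step_h_upto)
    show "pos_root n (reflect ?t b)" using pos_down assms(1) t by blast
    show "\<not> (adj s ?t \<and> reflect ?t b = alpha s)"
    proof
      assume a: "adj s ?t \<and> reflect ?t b = alpha s"
      have "b = reflect ?t (alpha s)" using a reflect_reflect by metis
      then have "b = reflect s (alpha ?t)" using a reflect_alpha_adj by metis
      then have "pairing s b = - pairing s (alpha ?t)" by (metis pairing_reflect_same)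
      also have "\<dots> = 1" using a adj_neq by (simp add: pairing_alpha del: alpha_eq)
      finally have "pairing s b = 1" .
      then show False using assms(2) by simp
    qed
  qed
  finally show ?thesis using t by blast
qed

text \<open>Up to depth \<open>n\<close>, every descent gives the same value.  The second part is the relation for adjacent
generators at a root fixed by both of them, where neither of them provides a descent.\<close>

definition h_ok :: "nat \<Rightarrow> bool" where
  "h_ok n \<longleftrightarrow>
    (\<forall>k c s t. pos_root k c \<longrightarrow> k < n \<longrightarrow> pairing t c < 0 \<longrightarrow> s \<noteq> t \<longrightarrow> \<not> (adj s t \<and> c = alpha s)
        \<longrightarrow> h s (reflect t c) = h_step h s t c)
    \<and> (\<forall>k b s t. pos_root k b \<longrightarrow> k \<le> n \<longrightarrow> adj s t \<longrightarrow> pairing s b = 0 \<longrightarrow> pairing t b = 0 \<longrightarrow> h s b = h t b)"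

lemma h_ok_stepD:
  "h_ok n \<Longrightarrow> pos_root k c \<Longrightarrow> k < n \<Longrightarrow> pairing t c < 0 \<Longrightarrow> s \<noteq> t \<Longrightarrow> \<not> (adj s t \<and> c = alpha s)
    \<Longrightarrow> h s (reflect t c) = h_step h s t c"
  unfolding h_ok_def by blast

lemma h_okD:
  assumes "h_ok n" "pos_root k c" "k < n" "pairing t c < 0"
  shows "\<not> adj s t \<Longrightarrow> s \<noteq> t \<Longrightarrow> h s (reflect t c) = h s c"
    and "adj s t \<Longrightarrow> c \<noteq> alpha s \<Longrightarrow> pairing s c > 0 \<Longrightarrow> h s (reflect t c) = 2 * h t (reflect s c)"
    and "adj s t \<Longrightarrow> pairing s c = 0 \<Longrightarrow> h s (reflect t c) = 2 * h t c - h s c"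
    and "adj s t \<Longrightarrow> pairing s c < 0 \<Longrightarrow> h s (reflect t c) = h s c + 2 * h t c"
proof -
  have *: "h s (reflect t c) = h_step h s t c" if "s \<noteq> t" "\<not> (adj s t \<and> c = alpha s)"
    using h_ok_stepD[OF assms that] .
  have ns: "c \<noteq> alpha s" if "pairing s c \<le> 0" using that by (auto simp: pairing_alpha)
  show "\<not> adj s t \<Longrightarrow> s \<noteq> t \<Longrightarrow> h s (reflect t c) = h s c"
    using * by (simp add: h_step_def)
  show "adj s t \<Longrightarrow> c \<noteq> alpha s \<Longrightarrow> pairing s c > 0 \<Longrightarrow> h s (reflect t c) = 2 * h t (reflect s c)"
    using * adj_neq by (simp add: h_step_def)
  show "adj s t \<Longrightarrow> pairing s c = 0 \<Longrightarrow> h s (reflect t c) = 2 * h t c - h s c"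
    using * adj_neq[of s t] ns by (simp add: h_step_def)
  show "adj s t \<Longrightarrow> pairing s c < 0 \<Longrightarrow> h s (reflect t c) = h s c + 2 * h t c"
    using * adj_neq[of s t] ns by (simp add: h_step_def)
qed

lemma h_ok_fixD:
  "h_ok n \<Longrightarrow> pos_root k b \<Longrightarrow> k \<le> n \<Longrightarrow> adj s t \<Longrightarrow> pairing s b = 0 \<Longrightarrow> pairing t b = 0 \<Longrightarrow> h s b = h t b"
  unfolding h_ok_def by blast

text \<open>The rules of \<open>h_okD\<close>, seen from the higher root instead of the lower one.\<close>

lemma h_hi:
  assumes "h_ok n" "pos_root k b" "k \<le> n" "pairing t b > 0" "b \<noteq> alpha t"
  shows "\<not> adj s t \<Longrightarrow> s \<noteq> t \<Longrightarrow> h s b = h s (reflect t b)"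
    and "adj s t \<Longrightarrow> b \<noteq> reflect s (alpha t) \<Longrightarrow> pairing s b + pairing t b > 0
        \<Longrightarrow> h s b = 2 * h t (reflect s (reflect t b))"
    and "adj s t \<Longrightarrow> pairing s b + pairing t b = 0 \<Longrightarrow> h s b = 2 * h t (reflect t b) - h s (reflect t b)"
    and "adj s t \<Longrightarrow> pairing s b + pairing t b < 0 \<Longrightarrow> h s b = h s (reflect t b) + 2 * h t (reflect t b)"
proof -
  obtain j where j: "k = Suc j" "pos_root j (reflect t b)" using pos_down_ex assms by blast
  have jn: "j < n" using j assms by simp
  have lo: "pairing t (reflect t b) < 0" using assms by simp
  note R = h_okD[OF assms(1) j(2) jn lo, of s, unfolded reflect_reflect]
  show "\<not> adj s t \<Longrightarrow> s \<noteq> t \<Longrightarrow> h s b = h s (reflect t b)" using R(1) .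
  have p: "pairing s (reflect t b) = pairing s b + pairing t b" if "adj s t"
      using that adj_sym pairing_reflect_adj by blast
  show "adj s t \<Longrightarrow> b \<noteq> reflect s (alpha t) \<Longrightarrow> pairing s b + pairing t b > 0
      \<Longrightarrow> h s b = 2 * h t (reflect s (reflect t b))"
    using R(2) p reflect_alpha_adj reflect_reflect by metis
  show "adj s t \<Longrightarrow> pairing s b + pairing t b = 0 \<Longrightarrow> h s b = 2 * h t (reflect t b) - h s (reflect t b)"
    using R(3) p by simp
  show "adj s t \<Longrightarrow> pairing s b + pairing t b < 0 \<Longrightarrow> h s b = h s (reflect t b) + 2 * h t (reflect t b)"
    using R(4) p by simp
qed

lemma h_inv:
  assumes "h_ok n" "pos_root k b" "k \<le> n" "pairing t b \<ge> 0" "b \<noteq> alpha t" "\<not> adj s t" "s \<noteq> t"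
  shows "h s (reflect t b) = h s b"
  using h_hi(1)[OF assms(1-3), of t s] assms reflect_fixed[of t b] by fastforce

text \<open>Computation in a subsystem of type \<open>A\<^sub>3\<close> with middle vertex \<open>s\<close>, for a root whose image under \<open>t'\<close> is
lowered by \<open>s\<close> and then by \<open>t\<close>: the value of \<open>h t'\<close> is transported down to the root \<open>mu\<close>, where the sign of
the pairing with \<open>t'\<close> decides which rule applies.\<close>

lemma mid_top:
  assumes ok: "h_ok n" and b: "pos_root (Suc n) b"
    and adj: "adj s t" "adj s t'" "\<not> adj t t'" "t \<noteq> t'"
    and pos_root: "pairing t b > 0" "pairing t' b > 0" "pairing s b \<le> 0" "pairing s b + pairing t' b > 0"
    and ns: "reflect t (reflect t' b) \<noteq> alpha s"
  defines "mu \<equiv> reflect t (reflect s (reflect t (reflect t' b)))"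
  shows "pairing t' mu = pairing t b + pairing s b"
    and "pairing t' mu < 0 \<Longrightarrow> h t' (reflect s (reflect t' b)) = h t' mu + 2 * h s mu"
    and "pairing t' mu = 0 \<Longrightarrow> h t' (reflect s (reflect t' b)) = 2 * h s mu - h t' mu"
    and "pairing t' mu > 0 \<Longrightarrow> h t' (reflect s (reflect t' b)) = 2 * h s (reflect t' mu)"
proof -
  note adj' = adj_sym[OF adj(1)] adj_sym[OF adj(2)]
  have neq: "s \<noteq> t" "s \<noteq> t'" "t' \<noteq> t" using adj adj_neq by auto
  have nadj: "\<not> adj t' t" using adj adj_sym by blast
  note P = pairing_reflect_same pairing_reflect_adj[OF adj(1)] pairing_reflect_adj[OF adj(2)]
      pairing_reflect_adj[OF adj'(1)]
    pairing_reflect_adj[OF adj'(2)] pairing_reflect_nadj[OF adj(3,4)]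
        pairing_reflect_nadj[OF nadj neq(3)]
  define g u z where g: "g = reflect t' b" and u: "u = reflect s g" and z: "z = reflect t u"
  have mu: "mu = reflect s z" using reflect_braid[OF adj(1), of g] by (simp add: mu_def z u g)
  have pg: "pairing s g = pairing s b + pairing t' b" "pairing t g = pairing t b"
      "pairing t' g = - pairing t' b"
    by (simp_all add: g P)
  have pu: "pairing s u = - (pairing s b + pairing t' b)"
      "pairing t u = pairing s b + pairing t' b + pairing t b" "pairing t' u = pairing s b"
    using pg by (simp_all add: u P)
  have pz: "pairing s z = pairing t b" "pairing t z = - (pairing s b + pairing t' b + pairing t b)"
      "pairing t' z = pairing s b"
    using pu by (simp_all add: z P)
  show pm: "pairing t' mu = pairing t b + pairing s b" using pz by (simp add: mu P)
  have posg: "pos_root n g" using pos_down[OF b] pos_root g by auto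
  have "g \<noteq> alpha s" using pg(2) pos_root adj' neq by (auto simp: pairing_alpha)
  then obtain m where m: "n = Suc m" "pos_root m u"
    using pos_down_ex[OF posg, of s] pg pos_root u by auto
  have nu: "u \<noteq> alpha t"
  proof
    assume "u = alpha t"
    then have "g = reflect t (alpha s)" using u reflect_alpha_adj[OF adj(1)] by (metis reflect_reflect)
    then show False using ns g by simp
  qed
  then obtain l where l: "m = Suc l" "pos_root l z"
    using pos_down_ex[OF m(2), of t] pu pos_root z by auto
  have hz: "h t' u = h t' z"
    using h_hi(1)[OF ok m(2) _ _ nu, of t'] pu pos_root z nadj neq m by auto
  have nz: "z \<noteq> alpha s" using pz(1,2) pos_root adj' neq by (auto simp: pairing_alpha)
  have nz2: "z \<noteq> reflect t' (alpha s)"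
  proof
    assume a: "z = reflect t' (alpha s)"
    have "pairing s z = 1" "pairing t z = - 1"
      unfolding a using neq adj' nadj adj by (simp_all add: P pairing_alpha)
    then show False using pz pos_root by linarith
  qed
  have ln: "l \<le> n" using l m by simp
  have ps: "pairing s z > 0" using pz pos_root by simp
  note H = h_hi[OF ok l(2) ln ps nz, of t']
  have su: "pairing t' z + pairing s z = pairing t' mu" using pz pm by simp
  have fin: "h t' (reflect s (reflect t' b)) = h t' z" using hz u g by simp
  show "pairing t' mu < 0 \<Longrightarrow> h t' (reflect s (reflect t' b)) = h t' mu + 2 * h s mu"
    using H(4)[OF adj'(2)] su fin mu by simp
  show "pairing t' mu = 0 \<Longrightarrow> h t' (reflect s (reflect t' b)) = 2 * h s mu - h t' mu"
    using H(3)[OF adj'(2)] su fin mu by simp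
  show "pairing t' mu > 0 \<Longrightarrow> h t' (reflect s (reflect t' b)) = 2 * h s (reflect t' mu)"
    using H(2)[OF adj'(2)] su fin mu nz2 by simp
qed

text \<open>Type \<open>A\<^sub>3\<close>, the two descents \<open>t\<close> and \<open>t'\<close> being the end vertices.  With \<open>p \<le> p'\<close> their pairings and \<open>-k\<close>
the pairing of \<open>s\<close>, the position of \<open>k\<close> relative to \<open>p\<close>, \<open>p'\<close> and \<open>p + p'\<close> determines how the orbit of
\<open>b\<close> descends.  In each case both sides are expanded until they only involve common lower roots.\<close>

lemma confluence_mid_le:
  assumes ok: "h_ok n" and b: "pos_root (Suc n) b"
    and adj: "adj s t" "adj s t'" "\<not> adj t t'" "t \<noteq> t'"
    and pos_root: "pairing t b > 0" "pairing t b \<le> pairing t' b" "pairing s b \<le> 0"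
  shows "h_step h s t (reflect t b) = h_step h s t' (reflect t' b)"
proof -
  note adj' = adj_sym[OF adj(1)] adj_sym[OF adj(2)]
  have neq: "s \<noteq> t" "s \<noteq> t'" "t' \<noteq> t" using adj adj_neq by auto
  have nadj: "\<not> adj t' t" using adj adj_sym by blast
  note P = pairing_reflect_same pairing_reflect_adj[OF adj(1)] pairing_reflect_adj[OF adj(2)]
      pairing_reflect_adj[OF adj'(1)]
    pairing_reflect_adj[OF adj'(2)] pairing_reflect_nadj[OF adj(3,4)]
        pairing_reflect_nadj[OF nadj neq(3)]
  define p p' k where pk: "p = pairing t b" "p' = pairing t' b" "k = - pairing s b"
  have pk0: "0 < p" "p \<le> p'" "0 \<le> k" using pos_root pk by auto
  define g g' where g: "g = reflect t b" "g' = reflect t' b"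
  have gpr: "pairing t g = - p" "pairing t' g = p'" "pairing s g = p - k"
    "pairing t' g' = - p'" "pairing t g' = p" "pairing s g' = p' - k"
    using pk by (simp_all add: g P)
  have posg: "pos_root n g" "pos_root n g'" using pos_down[OF b] pos_root g by auto
  define d where d: "d = reflect t' g"
  have d': "d = reflect t g'" using reflect_commute[OF adj(3,4)] by (simp add: d g)
  have dpr: "pairing t d = - p" "pairing t' d = - p'" "pairing s d = p + p' - k"
    using gpr by (simp_all add: d P)
  have ng: "g \<noteq> alpha t'" "g' \<noteq> alpha t"
    using gpr(1,4) pk0 adj(3,4) nadj neq by (auto simp: pairing_alpha)
  obtain m where m: "n = Suc m" "pos_root m d"
    using pos_down_ex[OF posg(1), of t'] gpr ng pk0 d by auto
  have htg: "h t g = h t d" using h_hi(1)[OF ok posg(1), of t' t] gpr ng pk0 adj d by simp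
  have ht'g': "h t' g' = h t' d" using h_hi(1)[OF ok posg(2), of t t'] gpr ng pk0 neq nadj d' by simp
  show ?thesis
  \<comment> \<open>Here \<open>b\<close> is the highest root \<open>\<alpha>\<^sub>t + \<alpha>\<^sub>s + \<alpha>\<^bsub>t'\<^esub>\<close>, and \<open>s\<close> maps \<open>d\<close> to a negative root.\<close>
  proof (cases "d = alpha s")
    case True
    have e: "g = reflect s (alpha t')" "g' = reflect s (alpha t)"
      using d d' True reflect_alpha_adj[OF adj(1)] reflect_alpha_adj[OF adj(2)]
          by (metis reflect_reflect)+
    have "p = 1" "p' = 1" "p + p' - k = 2" using dpr True adj' neq by (simp_all add: pairing_alpha)
    then have "h_step h s t g = 2 * h t (alpha t')" "h_step h s t' g' = 2 * h t' (alpha t)"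
      using gpr adj by (simp_all add: h_step_def e)
    then show ?thesis using neq by (simp add: h_simple g)
  next
    case nd: False
    have ng2: "g \<noteq> reflect s (alpha t')" "g' \<noteq> reflect s (alpha t)"
      using d d' nd reflect_alpha_adj[OF adj(1)] reflect_alpha_adj[OF adj(2)] by (metis reflect_reflect)+
    have nn: "n \<le> n" "m \<le> n" using m by auto
    have gd: "reflect t' g = d" "reflect t g' = d" using d d' by auto
    have q: "pairing s g + pairing t' g = p + p' - k" "pairing s g' + pairing t g' = p + p' - k"
        using gpr by auto
    have g0: "pairing t' g > 0" "pairing t g' > 0" using gpr pk0 by auto
    note Hg = h_hi(2-4)[OF ok posg(1) nn(1) g0(1) ng(1) adj(2), unfolded q gd]
    note Hg' = h_hi(2-4)[OF ok posg(2) nn(1) g0(2) ng(2) adj(1), unfolded q gd]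
    define e where e: "e = reflect s d"
    have epr: "pairing t e = p' - k" "pairing t' e = p - k" using dpr by (simp_all add: e P)
    have de: "d = reflect s e" using e by simp
    have pe: "\<exists>l. m = Suc l \<and> pos_root l e" if "p + p' - k > 0"
      using pos_down_ex[OF m(2), of s] that dpr nd e by auto
    have dk: "pairing s d > 0" if "p + p' - k > 0" using that dpr by simp
    have ht4: "h t d = h t e + 2 * h s e" if "p + p' - k > 0" "p' < k"
      using h_hi(4)[OF ok m(2) nn(2) dk[OF that(1)] nd adj'(1)] that dpr e by simp
    have ht'4: "h t' d = h t' e + 2 * h s e" if "p + p' - k > 0" "p < k"
      using h_hi(4)[OF ok m(2) nn(2) dk[OF that(1)] nd adj'(2)] that dpr e by simp
    have ht3: "h t d = 2 * h s e - h t e" if "p + p' - k > 0" "p' = k"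
      using h_hi(3)[OF ok m(2) nn(2) dk[OF that(1)] nd adj'(1)] that dpr e by simp
    have ht'3: "h t' d = 2 * h s e - h t' e" if "p + p' - k > 0" "p = k"
      using h_hi(3)[OF ok m(2) nn(2) dk[OF that(1)] nd adj'(2)] that dpr e by simp
    define mu where mu: "mu = reflect t e"
    have ht2: "h t d = 2 * h s mu \<and> h t' e = h t' mu" if kp: "k < p'"
    proof
      have 0: "p + p' - k > 0" using that pk0 by simp
      have "d \<noteq> reflect t (alpha s)" using dpr(1) pk0 neq adj adj' by (auto simp: pairing_alpha)
      then show "h t d = 2 * h s mu"
        using h_hi(2)[OF ok m(2) nn(2) dk[OF 0] nd adj'(1)] kp dpr e mu by simp
      obtain l where l: "m = Suc l" "pos_root l e" using pe[OF 0] by blast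
      have "e \<noteq> alpha t"
      proof
        assume "e = alpha t"
        then have "d = reflect t (alpha s)" using de reflect_alpha_adj[OF adj(1)] by simp
        then show False using \<open>d \<noteq> reflect t (alpha s)\<close> by simp
      qed
      then show "h t' e = h t' mu"
        using h_hi(1)[OF ok l(2) _ _ _ nadj neq(3)] kp epr mu l m by simp
    qed
    have bpr: "pairing t b = p" "pairing t' b = p'" "pairing s b = - k" using pk by auto
    note hs = h_step_def[of h s t g] h_step_def[of h s t' g']
    have goal: "h_step h s t g = h_step h s t' g'"
    proof (cases "k < p'")
      case kp: True
      have nd2: "reflect t (reflect t' b) \<noteq> alpha s" using nd d' g by simp
      have mu2: "reflect t (reflect s (reflect t (reflect t' b))) = mu" using mu e d' g by simp
      have c1: "pairing s b \<le> 0" "pairing s b + pairing t' b > 0" "pairing t' b > 0" using bpr pk0 kp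
          by auto
      note M = mid_top[OF ok b adj pos_root(1) c1(3,1,2) nd2, unfolded mu2, unfolded g(2)[symmetric]]
      have hs': "h_step h s t' g' = 2 * h t' (reflect s g')" using gpr kp adj by (simp add: hs)
      have pm: "pairing t' mu = p - k" using M(1) bpr by simp
      consider "p < k" | "p = k" | "k < p" by linarith
      then show ?thesis
      proof cases
        case 1
        have "h_step h s t g = h s g + 2 * h t g" using 1 gpr adj by (simp add: hs)
        also have "h s g = 2 * h t' e" using Hg(1) ng2 1 kp pk0 e by simp
        finally show ?thesis using hs' M(2) pm 1 htg ht2[OF kp] by simp
      next
        case 2
        have "h_step h s t g = 2 * h t g - h s g" using 2 gpr adj by (simp add: hs)
        also have "h s g = 2 * h t' e" using Hg(1) ng2 2 kp pk0 e by simp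
        finally show ?thesis using hs' M(3) pm 2 htg ht2[OF kp] by simp
      next
        case 3
        have nd3: "reflect t' (reflect t b) \<noteq> alpha s" using nd d g by simp
        have mu3: "reflect t' (reflect s (reflect t' (reflect t b))) = reflect t' e" using e d g by simp
        have c2: "pairing s b + pairing t b > 0" using bpr 3 by simp
        note N = mid_top[OF ok b adj(2,1) nadj neq(3) c1(3) pos_root(1) c1(1) c2 nd3,
            unfolded mu3, unfolded g(1)[symmetric]]
        have "h_step h s t g = 2 * h t (reflect s g)" using 3 gpr adj by (simp add: hs)
        moreover have "reflect t (reflect t' e) = reflect t' mu" using reflect_commute[OF adj(3,4)] mu
            by simp
        ultimately show ?thesis using hs' M(4) N(4) N(1) pm 3 kp bpr by simp
      qed
    next
      case False
      then consider "p < k" "p' < k" | "p < k" "p' = k" | "p = k" "p' = k" using pk0 by linarith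
      then show ?thesis
      proof cases
        case 1
        have hs': "h_step h s t g = h s g + 2 * h t g" "h_step h s t' g' = h s g' + 2 * h t' g'"
          using 1 gpr adj by (simp_all add: hs)
        consider "p + p' - k > 0" | "p + p' - k = 0" | "p + p' - k < 0" by linarith
        then show ?thesis
          using hs' htg ht'g' Hg Hg' ng2 ht4 ht'4 1 e by cases simp_all
      next
        case 2
        have hs': "h_step h s t g = h s g + 2 * h t g" "h_step h s t' g' = 2 * h t' g' - h s g'"
          using 2 gpr adj by (simp_all add: hs)
        have "p + p' - k > 0" using 2 pk0 by simp
        then show ?thesis using hs' htg ht'g' Hg(1) Hg'(1) ng2 ht3 ht'4 2 e by simp
      next
        case 3
        have hs': "h_step h s t g = 2 * h t g - h s g" "h_step h s t' g' = 2 * h t' g' - h s g'"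
          using 3 gpr adj by (simp_all add: hs)
        have "p + p' - k > 0" using 3 pk0 by simp
        then show ?thesis using hs' htg ht'g' Hg(1) Hg'(1) ng2 ht3 ht'3 3 e by simp
      qed
    qed
    then show ?thesis using g by simp
  qed
qed

lemma confluence_mid:
  assumes ok: "h_ok n" and b: "pos_root (Suc n) b"
    and adj: "adj s t" "adj s t'" "\<not> adj t t'" "t \<noteq> t'"
    and pos_root: "pairing t b > 0" "pairing t' b > 0" "pairing s b \<le> 0"
  shows "h_step h s t (reflect t b) = h_step h s t' (reflect t' b)"
proof (cases "pairing t b \<le> pairing t' b")
  case True
  then show ?thesis using confluence_mid_le[OF ok b adj pos_root(1) _ pos_root(3)] by simp
next
  case False
  then show ?thesis
    using confluence_mid_le[OF ok b adj(2,1) _ _ pos_root(2) _ pos_root(3)] adj adj_sym by fastforce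
qed

text \<open>Type \<open>A\<^sub>3\<close> with middle vertex \<open>t'\<close>: the descents \<open>t\<close> and \<open>t'\<close> are adjacent, and \<open>s\<close> is adjacent to \<open>t'\<close> only.
Both sides are carried to the bottom \<open>c\<close> of the orbit of \<open>b\<close> under \<open>t\<close> and \<open>t'\<close>, or below it.\<close>

lemma confluence_end:
  assumes ok: "h_ok n" and b: "pos_root (Suc n) b"
    and adj: "adj t t'" "adj s t'" "\<not> adj s t" "s \<noteq> t"
    and pos_root: "pairing t b > 0" "pairing t' b > 0" "pairing s b \<le> 0"
  shows "h_step h s t (reflect t b) = h_step h s t' (reflect t' b)"
proof -
  note adj' = adj_sym[OF adj(1)] adj_sym[OF adj(2)]
  have neq: "t \<noteq> t'" "s \<noteq> t'" "t \<noteq> s" using adj adj_neq by auto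
  have nadj: "\<not> adj t s" using adj adj_sym by blast
  note P = pairing_reflect_same pairing_reflect_adj[OF adj(1)] pairing_reflect_adj[OF adj(2)]
      pairing_reflect_adj[OF adj'(1)]
    pairing_reflect_adj[OF adj'(2)] pairing_reflect_nadj[OF adj(3,4)]
        pairing_reflect_nadj[OF nadj neq(3)]
  have A: "pairing s (alpha t) = 0" "pairing t (alpha s) = 0" "pairing s (alpha t') = - 1"
      "pairing t' (alpha s) = - 1"
    "pairing t (alpha t') = - 1" "pairing t' (alpha t) = - 1" "pairing t (alpha t) = 2"
        "pairing t' (alpha t') = 2" "pairing s (alpha s) = 2"
    using adj adj' neq nadj by (simp_all add: pairing_alpha)
  define p p' k where pk: "p = pairing t b" "p' = pairing t' b" "k = - pairing s b"
  have pk0: "0 < p" "0 < p'" "0 \<le> k" using pos_root pk by auto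
  define q where q: "q = p + p' - k"
  define g g' where g: "g = reflect t b" "g' = reflect t' b"
  have gpr: "pairing t g = - p" "pairing t' g = p + p'" "pairing s g = - k"
    "pairing t' g' = - p'" "pairing t g' = p + p'" "pairing s g' = p' - k"
    using pk by (simp_all add: g P)
  have posg: "pos_root n g" "pos_root n g'" using pos_down[OF b] pos_root g by auto
  have L: "h_step h s t g = h s g" using adj by (simp add: h_step_def)
  have goal: "h_step h s t g = h_step h s t' g'"
  \<comment> \<open>Here \<open>b\<close> is \<open>\<alpha>\<^sub>t + \<alpha>\<^bsub>t'\<^esub>\<close>, whose orbit contains negative roots.\<close>
  proof (cases "g = alpha t'")
    case True
    have "b = reflect t (alpha t')" using True g by (metis reflect_reflect)
    then have "b = reflect t' (alpha t)" using reflect_alpha_adj[OF adj(1)] by simp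
    then have "g' = alpha t" using g by simp
    then show ?thesis using L True neq adj A by (simp add: h_step_def h_simple)
  next
    case ng: False
    have ng': "g' \<noteq> alpha t"
    proof
      assume "g' = alpha t"
      then have "b = reflect t' (alpha t)" using g by (metis reflect_reflect)
      then have "g = alpha t'" using reflect_alpha_adj[OF adj(1)] g by (metis reflect_reflect)
      then show False using ng by simp
    qed
    define w w' where w: "w = reflect t' g" "w' = reflect t g'"
    have wpr: "pairing t w = p'" "pairing t' w = - (p + p')" "pairing s w = q"
      "pairing t w' = - (p + p')" "pairing t' w' = p" "pairing s w' = p' - k"
      using gpr by (simp_all add: w P q)
    have ng2: "g \<noteq> reflect t' (alpha t)" "g' \<noteq> reflect t' (alpha t)" "g \<noteq> reflect s (alpha t')"
        "g' \<noteq> reflect t (alpha t')"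
      using gpr pk0 A adj by (auto simp: P)
    have nw: "w \<noteq> alpha t" "w' \<noteq> alpha t'"
      using ng2 w by (metis reflect_reflect)+
    define c where c: "c = reflect t w"
    have c': "c = reflect t' w'" using reflect_braid[OF adj(1), of b] by (simp add: c w g)
    have cpr: "pairing t c = - p'" "pairing t' c = - p" "pairing s c = q"
      using wpr by (simp_all add: c P)
    obtain m where m: "n = Suc m" "pos_root m w" "pos_root m w'"
      using pos_down_ex[OF posg(1), of t'] pos_down_ex[OF posg(2), of t] gpr pk0 ng ng' w by auto
    obtain l where l: "m = Suc l" "pos_root l c"
      using pos_down_ex[OF m(2), of t] wpr pk0 nw c by auto
    have nn: "n \<le> n" "m \<le> n" "l \<le> n" using m l by auto
    have g0: "pairing t' g > 0" "pairing t g' > 0" "pairing t w > 0" "pairing t' w' > 0"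
        using gpr wpr pk0 by auto
    have nw2: "w' \<noteq> reflect s (alpha t')" using wpr pk0 A by (auto simp: P)
    have S: "pairing s g + pairing t' g = q" "pairing s w' + pairing t' w' = q" using gpr wpr q by auto
    have W: "reflect t' g = w" "reflect t g' = w'" "reflect t' w' = c" using w c' by auto
    note H1 = h_hi(2-4)[OF ok posg(1) nn(1) g0(1) ng adj(2), unfolded S W]
    note H2 = h_hi(2-4)[OF ok m(3) nn(2) g0(4) nw(2) adj(2), unfolded S W]
    have h1: "h s w = h s c" using h_hi(1)[OF ok m(2) nn(2) g0(3) nw(1) adj(3,4)] c by simp
    have h2: "h t' w = h t' c + 2 * h t c"
      using h_hi(4)[OF ok m(2) nn(2) g0(3) nw(1) adj'(1)] wpr pk0 c by simp
    have h3: "h t' g' = 2 * h t c"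
      using h_hi(2)[OF ok posg(2) nn(1) g0(2) ng' adj'(1) ng2(2)] gpr pk0 W by simp
    have h4: "h s g' = h s w'" using h_hi(1)[OF ok posg(2) nn(1) g0(2) ng' adj(3,4)] W by simp
    have R: "h_step h s t' g' = (if p' - k > 0 then 2 * h t' (reflect s g')
        else if p' - k = 0 then 2 * h t' g' - h s g' else h s g' + 2 * h t' g')"
      using adj gpr by (simp add: h_step_def)
    show ?thesis
    proof (cases "q > 0")
      case False
      then have "p' < k" using q pk0 by simp
      then show ?thesis using False L R H1(2,3) H2(2,3) h1 h2 h3 h4 by (cases "q = 0") simp_all
    next
      case q0: True
      define xi where xi: "xi = reflect s w"
      have xpr: "pairing t xi = p'" "pairing t' xi = - k" "pairing s xi = - q"
        using wpr by (simp_all add: xi P q)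
      have sc: "reflect t xi = reflect s c" using reflect_commute[OF adj(3,4)] by (simp add: xi c)
      have "w \<noteq> alpha s" using wpr pk0 A by auto
      then obtain l2 where l2: "m = Suc l2" "pos_root l2 xi"
        using pos_down_ex[OF m(2), of s] wpr q0 xi by auto
      have l2n: "l2 \<le> n" using l2 m by simp
      have L': "h_step h s t g = 2 * h t' xi" using L H1(1) q0 ng2 xi by simp
      have nx: "xi \<noteq> alpha t"
      proof
        assume "xi = alpha t"
        then have "w = reflect s (alpha t)" using xi by (metis reflect_reflect)
        then show False using nw reflect_alpha_nadj[OF adj(3,4)] by simp
      qed
      have x0: "pairing t xi > 0" using xpr pk0 by simp
      have "c \<noteq> alpha s" using cpr pk0 A by auto
      then have htc: "h t (reflect s c) = h t c" using h_inv[OF ok l(2) nn(3)] cpr q0 nadj neq by simp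
      note H3 = h_hi(2-4)[OF ok l2(2) l2n x0 nx adj'(1), unfolded sc]
      consider "p' < k" | "p' = k" | "k < p'" by linarith
      then show ?thesis
      proof cases
        case 1
        have "h_step h s t' g' = h s w' + 4 * h t c" using R 1 h3 h4 by simp
        also have "h s w' = 2 * h t' (reflect s c)" using H2(1) nw2 q0 by simp
        finally show ?thesis using L' H3(3) xpr 1 htc by simp
      next
        case 2
        have "h_step h s t' g' = 4 * h t c - h s w'" using R 2 h3 h4 by simp
        also have "h s w' = 2 * h t' (reflect s c)" using H2(1) nw2 q0 by simp
        finally show ?thesis using L' H3(2) xpr 2 htc by simp
      next
        case 3
        have q2: "q \<ge> 2" using 3 pk0 q by simp
        have "xi \<noteq> reflect t' (alpha t)"
        proof
          assume "xi = reflect t' (alpha t)"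
          then have "pairing s xi = - 1" using A by (simp add: P)
          then show False using xpr q2 by simp
        qed
        then have hx: "h t' xi = 2 * h t (reflect t' (reflect s c))" using H3(1) xpr 3 by simp
        define u where u: "u = reflect s g'"
        have upr: "pairing t u = p + p'" "pairing t' u = - k" "pairing s u = k - p'"
          using gpr by (simp_all add: u P)
        have "g' \<noteq> alpha s" using gpr pk0 A by auto
        then have pu: "pos_root m u"
          using pos_down_ex[OF posg(2), of s] gpr 3 m u by auto
        have nu: "u \<noteq> alpha t"
        proof
          assume "u = alpha t"
          then have "g' = reflect s (alpha t)" using u by (metis reflect_reflect)
          then show False using ng' reflect_alpha_nadj[OF adj(3,4)] by simp
        qed
        have nu2: "u \<noteq> reflect t' (alpha t)" using upr pk0 A by (auto simp: P)
        have u0: "pairing t u > 0" using upr pk0 by simp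
        define v where v: "v = reflect t u"
        have v': "v = reflect s w'" using reflect_commute[OF adj(3,4)] by (simp add: v u w)
        have vpr: "pairing t v = - (p + p')" "pairing t' v = q" "pairing s v = k - p'"
          using upr by (simp_all add: v P q)
        have hu: "h t' u = 2 * h t (reflect t' v)"
          using h_hi(2)[OF ok pu nn(2) u0 nu adj'(1) nu2] upr 3 pk0 v by simp
        obtain l3 where l3: "m = Suc l3" "pos_root l3 v"
          using pos_down_ex[OF pu u0 nu] v by auto
        have nv: "v \<noteq> alpha t'" using vpr pk0 A by auto
        define y where y: "y = reflect t' v"
        have ypr: "pairing s y = p" "pairing t' y = - q" using vpr by (simp_all add: y P q)
        obtain l4 where l4: "l3 = Suc l4" "pos_root l4 y"
          using pos_down_ex[OF l3(2), of t'] nv vpr q0 y by auto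
        have "y \<noteq> alpha s" using ypr q2 A by auto
        then have "h t (reflect s y) = h t y"
          using h_inv[OF ok l4(2), of s t] l4 l3 m ypr pk0 nadj neq by simp
        moreover have "reflect s y = reflect t' (reflect s c)"
          using reflect_braid[OF adj(2), of w'] by (simp add: y v' c')
        ultimately show ?thesis using L' R 3 hx hu u y by simp
      qed
    qed
  qed
  then show ?thesis using g by simp
qed

text \<open>Type \<open>A\<^sub>1 \<times> A\<^sub>2\<close>: as \<open>t\<close> commutes with \<open>s\<close> and \<open>t'\<close>, all values of \<open>h s\<close> and \<open>h t'\<close> are invariant under \<open>t\<close>.\<close>

lemma confluence_side:
  assumes ok: "h_ok n" and b: "pos_root (Suc n) b"
    and adj: "\<not> adj t t'" "t \<noteq> t'" "adj s t'" "\<not> adj s t" "s \<noteq> t"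
    and pos_root: "pairing t b > 0" "pairing t' b > 0" "pairing s b \<le> 0"
  shows "h_step h s t (reflect t b) = h_step h s t' (reflect t' b)"
proof -
  note adj' = adj_sym[OF adj(3)]
  have neq: "t' \<noteq> t" "s \<noteq> t'" "t \<noteq> s" using adj adj_neq by auto
  have nadj: "\<not> adj t' t" "\<not> adj t s" using adj adj_sym by blast+
  note P = pairing_reflect_same pairing_reflect_adj[OF adj(3)] pairing_reflect_adj[OF adj']
      pairing_reflect_nadj[OF adj(1,2)]
    pairing_reflect_nadj[OF adj(4,5)] pairing_reflect_nadj[OF nadj(1) neq(1)]
        pairing_reflect_nadj[OF nadj(2) neq(3)]
  have A: "pairing s (alpha t') = - 1" "pairing t (alpha t') = 0" "pairing t (alpha s) = 0"
      "pairing t' (alpha t) = 0"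
    using adj adj' neq nadj by (simp_all add: pairing_alpha)
  define p p' k where pk: "p = pairing t b" "p' = pairing t' b" "k = - pairing s b"
  have pk0: "0 < p" "0 < p'" "0 \<le> k" using pos_root pk by auto
  define g g' where g: "g = reflect t b" "g' = reflect t' b"
  have gpr: "pairing t g = - p" "pairing t' g = p'" "pairing s g = - k"
    "pairing t' g' = - p'" "pairing t g' = p" "pairing s g' = p' - k"
    using pk by (simp_all add: g P)
  have posg: "pos_root n g" "pos_root n g'" using pos_down[OF b] pos_root g by auto
  define d where d: "d = reflect t' g"
  have d': "d = reflect t g'" using reflect_commute[OF adj(1,2)] by (simp add: d g)
  have ng: "g \<noteq> alpha t'" "g' \<noteq> alpha t" "g \<noteq> reflect s (alpha t')" "g' \<noteq> alpha s"
    using gpr pk0 A by (auto simp: P)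
  have g0: "pairing t' g > 0" "pairing t g' \<ge> 0" using gpr pk0 by auto
  note H = h_hi(2-4)[OF ok posg(1) order_refl g0(1) ng(1) adj(3), folded d]
  have L: "h_step h s t g = h s g" using adj by (simp add: h_step_def)
  have i1: "h s d = h s g'" "h t' d = h t' g'"
    using h_inv[OF ok posg(2) order_refl g0(2) ng(2)] adj nadj neq d' by auto
  consider "p' - k > 0" | "p' - k = 0" | "p' - k < 0" by linarith
  then have "h_step h s t g = h_step h s t' g'"
  proof cases
    case 1
    define u where u: "u = reflect s g'"
    have "pairing t u = p" using gpr by (simp add: u P)
    moreover have "u \<noteq> alpha t"
    proof
      assume "u = alpha t"
      then have "g' = reflect s (alpha t)" using u by (metis reflect_reflect)
      then show False using ng reflect_alpha_nadj[OF adj(4,5)] by simp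
    qed
    moreover obtain m where m: "n = Suc m" "pos_root m u"
      using pos_down_ex[OF posg(2), of s] gpr 1 ng u by auto
    ultimately have "h t' (reflect t u) = h t' u"
      using h_inv[OF ok m(2), of t t'] pk0 nadj neq by simp
    moreover have "reflect t u = reflect s d" using reflect_commute[OF adj(4,5)] by (simp add: u d')
    ultimately show ?thesis using L H(1) gpr 1 ng adj u by (simp add: h_step_def)
  next
    case 2
    then show ?thesis using L H(2) gpr adj i1 by (simp add: h_step_def)
  next
    case 3
    then show ?thesis using L H(3) gpr adj i1 by (simp add: h_step_def)
  qed
  then show ?thesis using g by simp
qed

text \<open>Both descents commute with \<open>s\<close>, so \<open>h s\<close> is constant along the whole descent.\<close>

lemma confluence_out:
  assumes ok: "h_ok n" and b: "pos_root (Suc n) b"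
    and adj: "\<not> adj s t" "\<not> adj s t'" "s \<noteq> t" "s \<noteq> t'" "t \<noteq> t'"
    and pos_root: "pairing t b > 0" "pairing t' b > 0"
  shows "h s (reflect t b) = h s (reflect t' b)"
proof -
  have posg: "pos_root n (reflect t b)" "pos_root n (reflect t' b)" using pos_down[OF b] pos_root by auto
  show ?thesis
  proof (cases "adj t t'")
    case False
    have False': "\<not> adj t' t" using False adj_sym by blast
    have "reflect t b \<noteq> alpha t'" "reflect t' b \<noteq> alpha t"
      using pos_root adj(5) False False' pairing_reflect_same[of t b] pairing_reflect_same[of t' b]
      by (auto simp: pairing_alpha simp del: pairing_reflect_same)
    then have "h s (reflect t' (reflect t b)) = h s (reflect t b)"
        "h s (reflect t (reflect t' b)) = h s (reflect t' b)"
      using h_inv[OF ok posg(1), of t' s] h_inv[OF ok posg(2), of t s] adj pos_root False False'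
      by (auto simp: pairing_reflect_nadj)
    then show ?thesis using reflect_commute[OF False adj(5)] by simp
  next
    case True
    note True' = adj_sym[OF True]
    show ?thesis
    proof (cases "reflect t b = alpha t'")
      case t: True
      then have "b = reflect t' (alpha t)" using reflect_alpha_adj[OF True] by (metis reflect_reflect)
      then show ?thesis using t adj by (simp add: h_simple)
    next
      case n1: False
      have n2: "reflect t' b \<noteq> alpha t"
      proof
        assume "reflect t' b = alpha t"
        then have "b = reflect t (alpha t')" using reflect_alpha_adj[OF True] by (metis reflect_reflect)
        then show False using n1 by simp
      qed
      have n3: "reflect t b \<noteq> reflect t' (alpha t)" "reflect t' b \<noteq> reflect t (alpha t')"
        using pos_root True True' adj(5) pairing_reflect_same[of t b] pairing_reflect_same[of t' b]
        by (auto simp: pairing_reflect_adj[OF True']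
            pairing_reflect_adj[OF True] pairing_alpha simp del: pairing_reflect_same)
      then have n4: "reflect t' (reflect t b) \<noteq> alpha t" "reflect t (reflect t' b) \<noteq> alpha t'"
        by (metis reflect_reflect)+
      obtain m where m: "n = Suc m" "pos_root m (reflect t' (reflect t b))"
          "pos_root m (reflect t (reflect t' b))"
        using pos_down_ex[OF posg(1), of t'] pos_down_ex[OF posg(2), of t] n1 n2 pos_root
        by (auto simp: pairing_reflect_adj[OF True] pairing_reflect_adj[OF True'])
      have "h s (reflect t' (reflect t b)) = h s (reflect t b)"
          "h s (reflect t (reflect t' b)) = h s (reflect t' b)"
        using h_inv[OF ok posg(1), of t' s] h_inv[OF ok posg(2), of t s] adj pos_root n1 n2
        by (auto simp: pairing_reflect_adj[OF True] pairing_reflect_adj[OF True'])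
      moreover have "h s (reflect t (reflect t' (reflect t b))) = h s (reflect t' (reflect t b))"
        "h s (reflect t' (reflect t (reflect t' b))) = h s (reflect t (reflect t' b))"
        using h_inv[OF ok m(2), of t s] h_inv[OF ok m(3), of t' s] adj pos_root n4 m(1)
        by (auto simp: pairing_reflect_adj[OF True] pairing_reflect_adj[OF True'])
      ultimately show ?thesis using reflect_braid[OF True, of b] by simp
    qed
  qed
qed

lemma h_zero:
  assumes "pos_root k c" "pairing s c > 0" "c \<noteq> alpha s"
  shows "h s c = 0"
proof (cases k)
  case 0
  then obtain u where "c = alpha u" using assms pos_0D by blast
  then show ?thesis using assms by (auto simp: pairing_alpha split: if_splits)
next
  case (Suc n)
  then show ?thesis using assms h_down by blast
qed

text \<open>The step at depth \<open>n\<close>: the chosen descent is compared with \<open>t\<close> by one of the confluence lemmas, according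
to the adjacencies among the three vertices.  Three mutually adjacent vertices cannot occur.\<close>

lemma h_ok_Suc_rule:
  assumes ok: "h_ok n" and c: "pos_root n c" "pairing t c < 0" "s \<noteq> t" "\<not> (adj s t \<and> c = alpha s)"
  shows "h s (reflect t c) = h_step h s t c"
proof -
  define b where b: "b = reflect t c"
  have posb: "pos_root (Suc n) b" using pos_root.up c b by blast
  have cb: "c = reflect t b" and tb: "pairing t b > 0" using b c by auto
  show ?thesis
  proof (cases "pairing s b > 0")
    case sb: True
    have "h_step h s t c = 0"
    proof (cases "adj s t")
      case False
      have "pairing s c > 0" using sb b c False adj_sym by (simp add: pairing_reflect)
      moreover have "c \<noteq> alpha s" using c False adj_sym by (auto simp: pairing_alpha split: if_splits)
      ultimately show ?thesis using False h_zero[OF c(1)] by (simp add: h_step_def)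
    next
      case True
      note True' = adj_sym[OF True]
      have 1: "pairing s c + pairing t c > 0" using sb b by (simp add: pairing_reflect_adj[OF True'])
      then have 2: "pairing s c > 0" using c by simp
      have 3: "c \<noteq> alpha s" using True c by blast
      obtain j where j: "pos_root j (reflect s c)" using pos_down_ex[OF c(1) 2 3] by blast
      have 4: "reflect s c \<noteq> alpha t"
      proof
        assume "reflect s c = alpha t"
        then have "c = reflect t (alpha s)" using reflect_alpha_adj[OF True] by (metis reflect_reflect)
        then show False using c True' adj_neq[OF True'] by (simp add: pairing_alpha)
      qed
      have "h t (reflect s c) = 0"
        using h_zero[OF j _ 4] 1 by (simp add: pairing_reflect_adj[OF True])
      then show ?thesis using True 2 by (simp add: h_step_def)
    qed
    then show ?thesis using h_down[OF posb sb] b by simp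
  next
    case False
    then have sb: "pairing s b \<le> 0" by simp
    obtain u where u: "pairing u b > 0" "h s b = h_step h s u (reflect u b)" using h_some[OF posb sb]
        by blast
    have su: "s \<noteq> u" using u sb by auto
    have "h_step h s t (reflect t b) = h_step h s u (reflect u b)"
    proof (cases "t = u")
      case False
      have ut: "u \<noteq> t" using False by simp
      show ?thesis
      proof (cases "adj s t")
        case st: True
        show ?thesis
        proof (cases "adj s u")
          case True
          then have "\<not> adj t u" using no_triangle st by blast
          then show ?thesis using confluence_mid[OF ok posb st True _ False tb u(1) sb] by simp
        next
          case su': False
          show ?thesis
          proof (cases "adj u t")
            case True
            then show ?thesis using confluence_end[OF ok posb True st su' su u(1) tb sb] by simp
          next
            case False
            then show ?thesis using confluence_side[OF ok posb False ut st su' su u(1) tb sb] by simp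
          qed
        qed
      next
        case st: False
        show ?thesis
        proof (cases "adj s u")
          case su': True
          show ?thesis
          proof (cases "adj t u")
            case True
            then show ?thesis using confluence_end[OF ok posb True su' st c(3) tb u(1) sb] by simp
          next
            case F: False
            then show ?thesis using confluence_side[OF ok posb F False su' st c(3) tb u(1) sb] by simp
          qed
        next
          case su': False
          then show ?thesis using confluence_out[OF ok posb st su' c(3) su False tb u(1)] st
            by (simp add: h_step_def)
        qed
      qed
    qed simp
    then show ?thesis using u b by simp
  qed
qed

text \<open>A root fixed by the adjacent generators \<open>s\<close> and \<open>t\<close> and lowered by \<open>u\<close>, a neighbour of \<open>s\<close>.  Going down
along \<open>u\<close>, \<open>s\<close>, \<open>t\<close> leads to a root fixed by \<open>u\<close> and \<open>s\<close>, to which the induction hypothesis applies.\<close>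

lemma h_ok_Suc_fix:
  assumes ok: "h_ok n" and b: "pos_root (Suc n) b" "adj s t" "pairing s b = 0" "pairing t b = 0"
      "pairing u b > 0"
    and us: "adj u s"
  shows "h s b = h t b"
proof -
  have neq: "u \<noteq> s" "u \<noteq> t" "s \<noteq> t" using b adj_neq by auto
  have ut: "\<not> adj u t" using no_triangle[OF us b(2)] .
  have tu: "\<not> adj t u" using ut adj_sym by blast
  note adj' = adj_sym[OF b(2)] adj_sym[OF us]
  note P = pairing_reflect_same pairing_reflect_adj[OF b(2)] pairing_reflect_adj[OF adj'(1)]
      pairing_reflect_adj[OF us] pairing_reflect_adj[OF adj'(2)]
    pairing_reflect_nadj[OF ut neq(2)] pairing_reflect_nadj[OF tu neq(2)[symmetric]]
  define c where c: "c = reflect u b"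
  define p where p: "p = pairing u b"
  have p0: "p > 0" using p b by simp
  have posc: "pos_root n c" using pos_down[OF b(1,5)] c by simp
  have cpr: "pairing s c = p" "pairing t c = 0" "pairing u c = - p" using b p by (simp_all add: c P)
  have nc: "c \<noteq> alpha s" "c \<noteq> reflect t (alpha s)" "c \<noteq> alpha t"
    using cpr adj' neq by (auto simp: pairing_alpha P)
  have lo: "pairing u c < 0" using cpr p0 by simp
  have bc: "b = reflect u c" using c by simp
  have "h s b = 2 * h u (reflect s c)"
    using h_ok_Suc_rule[OF ok posc lo neq(1)[symmetric]] nc adj'(2) cpr p0 bc by (simp add: h_step_def)
  moreover have "h t b = h t c"
    using h_ok_Suc_rule[OF ok posc lo neq(2)[symmetric]] tu bc by (simp add: h_step_def)
  moreover have "h t c = 2 * h s (reflect t (reflect s c))"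
    using h_hi(2)[OF ok posc order_refl _ nc(1) adj'(1) nc(2)] cpr p0 by simp
  moreover have "h u (reflect s c) = h s (reflect t (reflect s c))"
  proof -
    obtain m where m: "n = Suc m" "pos_root m (reflect s c)" using pos_down_ex[OF posc _ nc(1)] cpr p0
        by auto
    have ne: "reflect s c \<noteq> alpha t" using nc(2) reflect_alpha_adj[OF b(2)] by (metis reflect_reflect)
    have t0: "pairing t (reflect s c) > 0" using cpr p0 by (simp add: P)
    obtain l where l: "m = Suc l" "pos_root l (reflect t (reflect s c))" using pos_down_ex[OF m(2) t0 ne]
        by auto
    have "h u (reflect t (reflect s c)) = h u (reflect s c)"
      using h_inv[OF ok m(2) _ _ ne ut neq(2)] t0 m by simp
    moreover have "h u (reflect t (reflect s c)) = h s (reflect t (reflect s c))"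
      using h_ok_fixD[OF ok l(2) _ us] l m cpr by (simp add: P)
    ultimately show ?thesis by simp
  qed
  ultimately show ?thesis by simp
qed

lemma h_ok_all: "h_ok n"
proof (induction n)
  case 0
  have fix0: "h s b = h t b"
      if "pos_root k b" "k \<le> 0" "adj s t" "pairing s b = 0" "pairing t b = 0" for k b s t
  proof -
    have "pos_root 0 b" using that(1,2) by simp
    then obtain u where u: "b = alpha u" using pos_0D by blast
    have "s \<noteq> u" "t \<noteq> u" using that(4,5) u by (auto simp: pairing_alpha)
    then show ?thesis by (simp add: h_simple u)
  qed
  show ?case
    unfolding h_ok_def
  proof (intro conjI allI impI)
    fix k c s t
    assume "k < (0 :: nat)"
    then show "h s (reflect t c) = h_step h s t c" by simp
  next
    fix k b s t
    assume "pos_root k b" "k \<le> 0" "adj s t" "pairing s b = 0" "pairing t b = 0"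
    then show "h s b = h t b" by (rule fix0)
  qed
next
  case (Suc n)
  have 1: "h s (reflect t c) = h_step h s t c"
    if "pos_root k c" "k < Suc n" "pairing t c < 0" "s \<noteq> t" "\<not> (adj s t \<and> c = alpha s)" for k c s t
  proof (cases "k = n")
    case True
    then show ?thesis using h_ok_Suc_rule[OF Suc] that by blast
  next
    case False
    then have "k < n" using that(2) by simp
    then show ?thesis using h_ok_stepD[OF Suc that(1) _ that(3-5)] by simp
  qed
  have 2: "h s b = h t b"
    if "pos_root k b" "k \<le> Suc n" "adj s t" "pairing s b = 0" "pairing t b = 0" for k b s t
  proof (cases "k = Suc n")
    case True
    have b: "pos_root (Suc n) b" using that True by simp
    obtain u where u: "pairing u b > 0" using pos_Suc_ex_down[OF b] by blast
    show ?thesis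
    proof (cases "adj u s \<or> adj u t")
      case True
      then show ?thesis
      proof
        assume "adj u s"
        then show ?thesis using h_ok_Suc_fix[OF Suc b that(3-5) u] by simp
      next
        assume "adj u t"
        then show ?thesis
          using h_ok_Suc_fix[OF Suc b adj_sym[OF that(3)] that(5,4) u] by simp
      qed
    next
      case False
      have us: "s \<noteq> u" "t \<noteq> u" using u that by auto
      have posc: "pos_root n (reflect u b)" using pos_down[OF b u] .
      have lo: "pairing u (reflect u b) < 0" using u by simp
      have na: "\<not> adj s u" "\<not> adj t u" using False adj_sym by blast+
      have "h s b = h s (reflect u b)" "h t b = h t (reflect u b)"
        using h_ok_Suc_rule[OF Suc posc lo us(1)] h_ok_Suc_rule[OF Suc posc lo us(2)] na
        by (simp_all add: h_step_def)
      moreover have "h s (reflect u b) = h t (reflect u b)"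
        using h_ok_fixD[OF Suc posc order_refl that(3)] that na us by (simp add: pairing_reflect)
      ultimately show ?thesis by simp
    qed
  next
    case False
    then have "k \<le> n" using that(2) by simp
    then show ?thesis using h_ok_fixD[OF Suc that(1) _ that(3-5)] by blast
  qed
  show ?case
    unfolding h_ok_def by (intro conjI allI impI) (rule 1 2; assumption)+
qed

section \<open>Hecke operators on positive roots\<close>

definition Pos :: "('v \<Rightarrow> int) set" where
  "Pos = {b. \<exists>n. pos_root n b}"

lemma alpha_Pos [simp]: "alpha s \<in> Pos"
  using pos_root.simple by (auto simp: Pos_def)

lemma reflect_Pos:
  assumes "b \<in> Pos" "b \<noteq> alpha s"
  shows "reflect s b \<in> Pos"
proof -
  obtain n where n: "pos_root n b" using assms by (auto simp: Pos_def)
  consider "pairing s b < 0" | "pairing s b = 0" | "pairing s b > 0" by linarith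
  then show ?thesis
  proof cases
    case 1
    then show ?thesis using pos_root.up[OF n] by (auto simp: Pos_def)
  next
    case 2
    then show ?thesis using assms by (simp add: reflect_fixed)
  next
    case 3
    then obtain k where "pos_root k (reflect s b)" using pos_down_ex[OF n 3 assms(2)] by blast
    then show ?thesis by (auto simp: Pos_def)
  qed
qed

lemma h_up:
  assumes "b \<in> Pos" "pairing t b < 0"
  shows "\<not> adj s t \<Longrightarrow> s \<noteq> t \<Longrightarrow> h s (reflect t b) = h s b"
    and "adj s t \<Longrightarrow> b \<noteq> alpha s \<Longrightarrow> pairing s b > 0 \<Longrightarrow> h s (reflect t b) = 2 * h t (reflect s b)"
    and "adj s t \<Longrightarrow> pairing s b = 0 \<Longrightarrow> h s (reflect t b) = 2 * h t b - h s b"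
    and "adj s t \<Longrightarrow> pairing s b < 0 \<Longrightarrow> h s (reflect t b) = h s b + 2 * h t b"
proof -
  obtain n where n: "pos_root n b" using assms by (auto simp: Pos_def)
  note R = h_okD[OF h_ok_all n lessI assms(2), of s]
  show "\<not> adj s t \<Longrightarrow> s \<noteq> t \<Longrightarrow> h s (reflect t b) = h s b"
    and "adj s t \<Longrightarrow> b \<noteq> alpha s \<Longrightarrow> pairing s b > 0 \<Longrightarrow> h s (reflect t b) = 2 * h t (reflect s b)"
    and "adj s t \<Longrightarrow> pairing s b = 0 \<Longrightarrow> h s (reflect t b) = 2 * h t b - h s b"
    and "adj s t \<Longrightarrow> pairing s b < 0 \<Longrightarrow> h s (reflect t b) = h s b + 2 * h t b"
    using R by blast+
qed

lemma h_invariant: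
  assumes "b \<in> Pos" "b \<noteq> alpha t" "\<not> adj s t" "s \<noteq> t"
  shows "h s (reflect t b) = h s b"
proof (cases "pairing t b < 0")
  case True
  then show ?thesis using h_up(1) assms by simp
next
  case False
  then show ?thesis using h_up(1)[OF reflect_Pos[OF assms(1,2)], of t s] assms
    by (cases "pairing t b = 0") (simp_all add: reflect_fixed)
qed

lemma h_fixed: "b \<in> Pos \<Longrightarrow> adj s t \<Longrightarrow> pairing s b = 0 \<Longrightarrow> pairing t b = 0 \<Longrightarrow> h s b = h t b"
  using h_ok_fixD[OF h_ok_all _ order_refl] unfolding Pos_def by blast

lemma h_lowered: "b \<in> Pos \<Longrightarrow> pairing s b > 0 \<Longrightarrow> b \<noteq> alpha s \<Longrightarrow> h s b = 0"
  using h_zero unfolding Pos_def by blast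

text \<open>The operator acts on functions on positive roots, from the right: \<open>F\<close> is precomposed with the matrix of
\<open>s\<close>.  A root lowered or fixed by \<open>s\<close> moves to its image, a root raised by \<open>s\<close> moves or stays with
probability \<open>1/2\<close>, and the simple root of \<open>s\<close> is killed.  Apart from the killing, this is the permutation
module on the roots, deformed to the Hecke algebra at parameter \<open>1/2\<close>.\<close>

definition hecke :: "'v \<Rightarrow> (('v \<Rightarrow> int) \<Rightarrow> real) \<Rightarrow> ('v \<Rightarrow> int) \<Rightarrow> real" where
  "hecke s F b =
    (if b = alpha s then 0 else if pairing s b \<ge> 0 then F (reflect s b) else (F b + F (reflect s b)) / 2)"

definition lk_form :: "'v \<Rightarrow> ('v \<Rightarrow> int) \<Rightarrow> real" where
  "lk_form s b = 1 / 2 - h s b"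

lemma hecke_simple [simp]: "hecke s F (alpha s) = 0"
  by (simp add: hecke_def)

text \<open>At a root fixed by \<open>s\<close> both this formula and the one of \<open>hecke_le\<close> hold.  Having the two with weak
inequalities keeps the case distinctions below small.\<close>

lemma hecke_ge: "b \<noteq> alpha s \<Longrightarrow> pairing s b \<ge> 0 \<Longrightarrow> hecke s F b = F (reflect s b)"
  by (simp add: hecke_def)

lemma hecke_le: "b \<noteq> alpha s \<Longrightarrow> pairing s b \<le> 0 \<Longrightarrow> hecke s F b = (F b + F (reflect s b)) / 2"
  by (cases "pairing s b = 0") (simp_all add: hecke_def reflect_fixed)

lemma hecke_add: "hecke s (\<lambda>b. F b + c * G b) b = hecke s F b + c * hecke s G b"
  by (simp add: hecke_def field_simps)

lemma hecke_cong: "b \<in> Pos \<Longrightarrow> (\<And>b. b \<in> Pos \<Longrightarrow> F b = G b) \<Longrightarrow> hecke s F b = hecke s G b"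
  using reflect_Pos by (auto simp: hecke_def)

lemma form_simple: "lk_form s (alpha t) = (if s = t then - 1 / 2 else 0)"
  by (simp add: lk_form_def h_simple)

lemma hecke_form_nadj:
  assumes "b \<in> Pos" "\<not> adj s t" "s \<noteq> t"
  shows "hecke t (lk_form s) b = lk_form s b"
  using h_invariant[OF assms(1) _ assms(2,3)] assms(3)
  by (auto simp: hecke_def lk_form_def h_simple)

lemma hecke_form_adj_aux:
  assumes "adj s t"
  shows "hecke t (lk_form s) (alpha s) = 0"
proof -
  note a' = adj_sym[OF assms]
  have 1: "pairing t (alpha s) = - 1" "s \<noteq> t" using a' adj_neq[OF a'] by (auto simp: pairing_alpha)
  have "reflect t (alpha s) \<noteq> alpha s"
  proof
    assume "reflect t (alpha s) = alpha s"
    then show False using pairing_reflect_same[of t "alpha s"] 1 by simp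
  qed
  moreover have "pairing s (reflect t (alpha s)) = 1" using 1 a'
      by (simp add: pairing_reflect_adj[OF a'] pairing_alpha)
  ultimately have "h s (reflect t (alpha s)) = 0" using h_lowered reflect_Pos[of "alpha s" t] 1 by simp
  then show ?thesis using 1 by (simp add: hecke_def lk_form_def h_simple)
qed

text \<open>Off the simple roots this is the content of the rules for \<open>h\<close>, case by case in the signs of the two
pairings.  If both generators lower \<open>b\<close>, then the two values of \<open>h\<close> vanish, except at \<open>\<alpha>\<^sub>s + \<alpha>\<^sub>t\<close>,
where they are \<open>1\<close>.\<close>

lemma hecke_form_adj:
  assumes b: "b \<in> Pos" and adj: "adj s t"
  shows "hecke t (lk_form s) b = hecke s (lk_form t) b"
proof -
  note a' = adj_sym[OF adj]
  consider "b = alpha s" | "b = alpha t" | "b \<noteq> alpha s" "b \<noteq> alpha t" by blast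
  then show ?thesis
  proof cases
    case 1
    then show ?thesis using hecke_form_adj_aux[OF adj] by simp
  next
    case 2
    then show ?thesis using hecke_form_adj_aux[OF a'] by simp
  next
    case 3
    have *: "hecke t (lk_form s) b = hecke s (lk_form t) b"
      if "b \<noteq> alpha s" "b \<noteq> alpha t" "pairing s b < 0" "adj s t" for s t
    proof -
      note up = h_up[OF b that(3), of t]
      note up' = h_up[OF b, of t s]
      note that4' = adj_sym[OF that(4)]
      consider "pairing t b > 0" | "pairing t b = 0" | "pairing t b < 0" by linarith
      then show ?thesis
      proof cases
        case 1
        then show ?thesis using that up(2)[OF that4'] h_lowered[OF b 1 that(2)]
          by (simp add: hecke_def lk_form_def)
      next
        case 2
        then show ?thesis using that up(3)[OF that4']
          by (simp add: hecke_def lk_form_def reflect_fixed)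
      next
        case 3
        then show ?thesis using that up(4)[OF that4'] up'(4)[OF 3 that(4)]
          by (simp add: hecke_def lk_form_def)
      qed
    qed
    show ?thesis
    proof (cases "pairing s b < 0 \<or> pairing t b < 0")
      case True
      then show ?thesis using *[OF 3 _ adj] *[OF 3(2,1) _ a'] by auto
    next
      case False
      have "h s (reflect t b) = h t (reflect s b)"
      proof (cases "pairing s b = 0 \<and> pairing t b = 0")
        case True
        then show ?thesis using h_fixed[OF b adj] by (simp add: reflect_fixed)
      next
        case F: False
        then have p: "pairing s b + pairing t b > 0" using False by linarith
        have P: "reflect t b \<in> Pos" "reflect s b \<in> Pos" using reflect_Pos[OF b] 3 by auto
        have q: "pairing s (reflect t b) > 0" "pairing t (reflect s b) > 0"
          using p by (simp_all add: pairing_reflect_adj[OF adj] pairing_reflect_adj[OF a'])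
        have "reflect t b = alpha s \<longleftrightarrow> reflect s b = alpha t"
          using reflect_alpha_adj[OF adj] by (metis reflect_reflect)
        then show ?thesis
          using h_lowered[OF P(1) q(1)] h_lowered[OF P(2) q(2)] h_simple
              by (cases "reflect t b = alpha s") simp_all
      qed
      then show ?thesis using 3 False by (simp add: hecke_def lk_form_def)
    qed
  qed
qed

text \<open>The Hecke relation \<open>(X - 1)(X + 1/2) = 0\<close>; it holds off the simple root of \<open>s\<close> only.\<close>

lemma hecke_quadratic: "b \<noteq> alpha s \<Longrightarrow> b \<in> Pos \<Longrightarrow> hecke s (hecke s F) b = (hecke s F b + F b) / 2"
proof -
  assume b: "b \<noteq> alpha s" "b \<in> Pos"
  have n: "reflect s b \<noteq> alpha s"
  proof
    assume "reflect s b = alpha s"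
    then have "b = reflect s (alpha s)" by (metis reflect_reflect)
    then show False using b pos_not_neg_simple by (auto simp: Pos_def)
  qed
  consider "pairing s b < 0" | "pairing s b = 0" | "pairing s b > 0" by linarith
  then show ?thesis using b n by cases (simp_all add: hecke_def reflect_fixed field_simps)
qed

lemma hecke_commute:
  assumes "\<not> adj s t" "s \<noteq> t"
  shows "hecke s (hecke t F) b = hecke t (hecke s F) b"
proof -
  have st: "\<not> adj t s" "t \<noteq> s" using assms adj_sym by blast+
  have n: "reflect s b = alpha t \<longleftrightarrow> b = alpha t" "reflect t b = alpha s \<longleftrightarrow> b = alpha s"
    using reflect_alpha_nadj[OF assms] reflect_alpha_nadj[OF st] by (metis reflect_reflect)+
  note P = pairing_reflect_nadj[OF assms] pairing_reflect_nadj[OF st] reflect_commute[OF assms]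
      reflect_alpha_nadj[OF st] reflect_alpha_nadj[OF assms]
  show ?thesis
    using assms n by (simp add: hecke_def[of s "hecke t F" b] hecke_def[of t "hecke s F" b]
      hecke_def[of t F] hecke_def[of s F] P pairing_alpha st field_simps)
qed

text \<open>Away from the plane of \<open>s\<close> and \<open>t\<close>, the two sides are compared in each of the six chambers of the
signs of \<open>p\<close>, \<open>q\<close> and \<open>p + q\<close>.\<close>

lemma hecke_braid:
  assumes b: "b \<in> Pos" and adj: "adj s t"
  shows "hecke s (hecke t (hecke s F)) b = hecke t (hecke s (hecke t F)) b"
proof -
  note a' = adj_sym[OF adj]
  have st: "s \<noteq> t" "t \<noteq> s" using adj_neq[OF adj] by auto
  note P = pairing_reflect_adj[OF adj] pairing_reflect_adj[OF a'] reflect_braid[OF adj]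
  have A: "pairing s (alpha t) = - 1" "pairing t (alpha s) = - 1" using adj a' st
      by (simp_all add: pairing_alpha)
  define c where c: "c = reflect s (alpha t)"
  have c': "c = reflect t (alpha s)" using c reflect_alpha_adj[OF adj] by simp
  have C: "reflect s (alpha t) = c" "reflect t (alpha s) = c" using c c' by auto
  then have C2: "reflect s c = alpha t" "reflect t c = alpha s" by (metis reflect_reflect)+
  have C3: "pairing s c = 1" unfolding c using A by simp
  have C4: "pairing t c = 1" unfolding c' using A by simp
  note C = C C2 C3 C4
  have cn: "c \<noteq> alpha s" "c \<noteq> alpha t" using C3 C4 A by (metis one_neq_neg_one)+
  consider "b = alpha s" | "b = alpha t" | "b = c" | "b \<noteq> alpha s" "b \<noteq> alpha t" "b \<noteq> c" by blast
  then show ?thesis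
  proof cases
    case 1
    then show ?thesis using cn st by (simp add: hecke_ge hecke_le C A)
  next
    case 2
    then show ?thesis using cn st by (simp add: hecke_ge hecke_le C A)
  next
    case 3
    then show ?thesis using cn st by (simp add: hecke_ge hecke_le C A)
  next
    case 4
    have neg: "b' \<noteq> reflect u (alpha u)" if "b' \<in> Pos" for b' u
      using that pos_not_neg_simple by (auto simp: Pos_def)
    have B1: "reflect s b \<in> Pos" "reflect t b \<in> Pos" using 4 b reflect_Pos by auto
    have n1: "reflect s b \<noteq> alpha s" "reflect t b \<noteq> alpha t" using neg[OF b] by (metis reflect_reflect)+
    have n2: "reflect s b \<noteq> alpha t" "reflect t b \<noteq> alpha s" using 4(3) c c' by (metis reflect_reflect)+
    have B2: "reflect t (reflect s b) \<in> Pos" "reflect s (reflect t b) \<in> Pos" using n2 B1 reflect_Pos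
        by auto
    have n3: "reflect t (reflect s b) \<noteq> alpha s"  "reflect s (reflect t b) \<noteq> alpha t" using 4 C
        by (metis reflect_reflect)+
    have n4: "reflect t (reflect s b) \<noteq> alpha t" "reflect s (reflect t b) \<noteq> alpha s" using neg B1
        by (metis reflect_reflect)+
    define p q where pq: "p = pairing s b" "q = pairing t b"
    have P1: "pairing s b = p" "pairing t b = q" "pairing t (reflect s b) = p + q"
        "pairing s (reflect t b) = p + q"
      "pairing s (reflect t (reflect s b)) = q" "pairing t (reflect s (reflect t b)) = p"
          "pairing s (reflect s b) = - p" "pairing t (reflect t b) = - q"
      "pairing t (reflect t (reflect s b)) = - p - q" "pairing s (reflect s (reflect t b)) = - p - q"
      by (simp_all add: P pq)
    have R: "reflect t (reflect s (reflect t b)) = reflect s (reflect t (reflect s b))"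
        using reflect_braid[OF adj] by simp
    note S = 4 n1 n2 n3 n4 P1 R
    consider "p \<ge> 0" "q \<ge> 0" | "p \<ge> 0" "q < 0" "p + q \<ge> 0" | "p \<ge> 0" "q < 0" "p + q < 0"
      | "p < 0" "q \<ge> 0" "p + q \<ge> 0" | "p < 0" "q \<ge> 0" "p + q < 0" | "p < 0" "q < 0" by linarith
    then show ?thesis
      by cases (simp_all add: hecke_ge hecke_le S field_simps)
  qed
qed

text \<open>The rank one perturbation of \<open>hecke s\<close> by \<open>x f\<^sub>s \<otimes> \<alpha>\<^sub>s\<close>.  Off the positive roots the
operator is the identity, so that for \<open>x \<noteq> 0\<close> it is a bijection on all functions.
As the action is from the right, a word acts by \<open>fold\<close>, its first letter being applied first.\<close>

section \<open>The deformed operators\<close>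

definition lk :: "real \<Rightarrow> 'v \<Rightarrow> (('v \<Rightarrow> int) \<Rightarrow> real) \<Rightarrow> ('v \<Rightarrow> int) \<Rightarrow> real" where
  "lk x s F b = (if b \<in> Pos then hecke s F b + x * F (alpha s) * lk_form s b else F b)"

definition srels :: "('v list \<times> 'v list) set" where
  "srels = {([s, t], [t, s]) |s t. \<not> adj s t \<and> s \<noteq> t} \<union> {([s, t, s], [t, s, t]) |s t. adj s t}"

abbreviation scong :: "'v list \<Rightarrow> 'v list \<Rightarrow> bool" where
  "scong \<equiv> pres_cong UNIV srels"

lemma lk_simple: "lk x s F (alpha s) = - x * F (alpha s) / 2"
  by (simp add: lk_def form_simple)

lemma lk_Pos: "b \<in> Pos \<Longrightarrow> lk x s F b = hecke s F b + x * F (alpha s) * lk_form s b"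
  by (simp add: lk_def)

lemma hecke_lk: "b \<in> Pos
    \<Longrightarrow> hecke t (lk x s F) b = hecke t (hecke s F) b + x * F (alpha s) * hecke t (lk_form s) b"
  using hecke_cong[of b "lk x s F" "\<lambda>b. hecke s F b + x * F (alpha s) * lk_form s b" t]
    hecke_add[of t "hecke s F" "x * F (alpha s)" "lk_form s" b] by (simp add: lk_Pos)

lemma lk_commute:
  assumes "\<not> adj s t" "s \<noteq> t"
  shows "lk x s (lk x t F) = lk x t (lk x s F)"
proof
  fix b
  have st: "\<not> adj t s" "t \<noteq> s" using assms adj_sym by blast+
  have v: "lk x t F (alpha s) = F (alpha s)" "lk x s F (alpha t) = F (alpha t)"
    using assms st by (simp_all add: lk_Pos form_simple hecke_def pairing_alpha reflect_alpha_nadj)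
  show "lk x s (lk x t F) b = lk x t (lk x s F) b"
  proof (cases "b \<in> Pos")
    case True
    then show ?thesis
      using hecke_commute[OF assms] hecke_form_nadj[OF True assms] hecke_form_nadj[OF True st]
      by (simp add: lk_Pos hecke_lk v)
  qed (simp add: lk_def)
qed

text \<open>Expansion of the left hand side of the braid relation.  The terms quadratic in \<open>x\<close> cancel because the
form \<open>f\<^sub>s\<close> takes opposite values at \<open>\<alpha>\<^sub>s\<close> and \<open>\<alpha>\<^sub>s + \<alpha>\<^sub>t\<close>.\<close>

lemma lk_braid_aux:
  assumes adj: "adj s t" and b: "b \<in> Pos"
  defines "c \<equiv> reflect s (alpha t)"
  shows "lk x s (lk x t (lk x s F)) b = hecke s (hecke t (hecke s F)) b
    + x * F (alpha s) * hecke s (hecke t (lk_form s)) b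
    + x * ((F (alpha t) + F c) / 2) * hecke s (lk_form t) b + x * (F (alpha t) / 2) * lk_form s b"
proof -
  note a' = adj_sym[OF adj]
  have st: "s \<noteq> t" using adj_neq[OF adj] .
  have A: "pairing s (alpha t) = - 1" "pairing t (alpha s) = - 1" using adj a' st
      by (simp_all add: pairing_alpha)
  have c': "c = reflect t (alpha s)" using reflect_alpha_adj[OF adj] by (simp add: c_def)
  have cs: "pairing s c = 1" using A by (simp add: c_def)
  have rc: "reflect s c = alpha t" by (simp add: c_def)
  have cP: "c \<in> Pos" unfolding c_def using reflect_Pos st by simp
  have cn: "c \<noteq> alpha s" using cs by (auto simp: pairing_alpha)
  have 1: "lk x s F (alpha t) = (F (alpha t) + F c) / 2"
    using st A by (simp add: lk_Pos form_simple hecke_def c_def)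
  have 2: "lk x s F c = F (alpha t) + x * F (alpha s) / 2"
    using h_lowered[OF cP _ cn] cs rc cn by (simp add: lk_Pos[OF cP] hecke_def lk_form_def)
  have 3: "lk x t (lk x s F) (alpha s) = F (alpha t) / 2"
    using st A by (simp add: lk_Pos[of "alpha s" x t] form_simple hecke_def c'[symmetric] lk_simple 2)
  have "hecke s (lk x t (lk x s F)) b = hecke s (hecke t (lk x s F)) b
      + x * ((F (alpha t) + F c) / 2) * hecke s (lk_form t) b"
    using hecke_lk[OF b] 1 by simp
  also have "hecke s (hecke t (lk x s F)) b
      = hecke s (\<lambda>b. hecke t (hecke s F) b + x * F (alpha s) * hecke t (lk_form s) b) b"
    by (rule hecke_cong[OF b]) (rule hecke_lk)
  also have "\<dots> = hecke s (hecke t (hecke s F)) b + x * F (alpha s) * hecke s (hecke t (lk_form s)) b"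
    by (rule hecke_add)
  finally show ?thesis using b 3 by (simp add: lk_Pos)
qed

text \<open>The two expansions agree: the coefficient of \<open>F \<alpha>\<^sub>s\<close> is rewritten by the relation
\<open>f\<^sub>s \<circ> t = f\<^sub>t \<circ> s\<close> and the quadratic relation.\<close>

lemma lk_braid:
  assumes adj: "adj s t"
  shows "lk x s (lk x t (lk x s F)) = lk x t (lk x s (lk x t F))"
proof
  fix b
  note a' = adj_sym[OF adj]
  have st: "s \<noteq> t" using adj_neq[OF adj] .
  show "lk x s (lk x t (lk x s F)) b = lk x t (lk x s (lk x t F)) b"
  proof (cases "b \<in> Pos")
    case True
    have 1: "hecke s (hecke t (lk_form s)) b = (hecke s (lk_form t) b + lk_form t b) / 2"
        if "adj s t" for s t
    proof -
      have st: "s \<noteq> t" using adj_neq[OF that] .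
      have "hecke s (hecke t (lk_form s)) b = hecke s (hecke s (lk_form t)) b"
        by (rule hecke_cong[OF True]) (rule hecke_form_adj[OF _ that])
      also have "\<dots> = (hecke s (lk_form t) b + lk_form t b) / 2"
        using hecke_quadratic[OF _ True, of s] st by (cases "b = alpha s") (simp_all add: form_simple)
      finally show ?thesis .
    qed
    have c: "reflect s (alpha t) = reflect t (alpha s)" by (rule reflect_alpha_adj[OF adj])
    have g: "hecke t (lk_form s) b = hecke s (lk_form t) b" by (rule hecke_form_adj[OF True adj])
    show ?thesis
      using lk_braid_aux[OF adj True, of x F] lk_braid_aux[OF a' True, of x F]
          hecke_braid[OF True adj, of F]
        1[OF adj] 1[OF a'] c g by (simp add: field_simps)
  qed (simp add: lk_def)
qed

lemma lk_scong:
  assumes "scong v w"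
  shows "fold (lk x) v = fold (lk x) w"
  using assms
proof (induction rule: pres_cong.induct)
  case (step u v y z)
  have "fold (lk x) u = fold (lk x) v"
  proof
    fix F
    from step.hyps(1) consider
      (comm) s t where "u = [s, t]" "v = [t, s]" "\<not> adj s t" "s \<noteq> t" |
      (braid) s t where "u = [s, t, s]" "v = [t, s, t]" "adj s t"
      unfolding srels_def by blast
    then show "fold (lk x) u F = fold (lk x) v F"
    proof cases
      case comm
      then show ?thesis using lk_commute[of s t x F] by simp
    next
      case braid
      then show ?thesis using lk_braid[of s t x F] by simp
    qed
  qed
  then show ?case by simp
next
  case (trans u v w)
  from trans.IH show ?case by (rule HOL.trans)
next
  case (sym v w)
  from sym.IH show ?case by (rule HOL.sym)
qed simp

text \<open>\<open>a\<close> is the value of the preimage at \<open>\<alpha>\<^sub>s\<close>, because \<open>f\<^sub>s(\<alpha>\<^sub>s) = -1/2\<close>.  Subtracting the perturbation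
leaves the Hecke operator, which is inverted on each pair of roots exchanged by \<open>s\<close>.\<close>

definition lk_inv :: "real \<Rightarrow> 'v \<Rightarrow> (('v \<Rightarrow> int) \<Rightarrow> real) \<Rightarrow> ('v \<Rightarrow> int) \<Rightarrow> real" where
  "lk_inv x s G b = (
    let a = - 2 * G (alpha s) / x; G' = (\<lambda>b. G b - x * a * lk_form s b) in
    if b \<notin> Pos then G b
    else if b = alpha s then a
    else if pairing s b \<ge> 0 then 2 * G' (reflect s b) - G' b
    else G' (reflect s b))"

lemma reflect_ne_simple:
  assumes "b \<in> Pos"
  shows "reflect s b \<noteq> alpha s"
proof
  assume "reflect s b = alpha s"
  then have "b = reflect s (alpha s)" by (metis reflect_reflect)
  then show False using assms pos_not_neg_simple by (auto simp: Pos_def)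
qed

lemma lk_lk_inv:
  assumes x: "x \<noteq> 0"
  shows "lk x s (lk_inv x s G) = G"
proof
  fix b
  define a where a: "a = - 2 * G (alpha s) / x"
  define G' where G': "G' = (\<lambda>b. G b - x * a * lk_form s b)"
  have inv: "lk_inv x s G b = (if b \<notin> Pos then G b
    else if b = alpha s then a
    else if pairing s b \<ge> 0 then 2 * G' (reflect s b) - G' b
    else G' (reflect s b))" for b
    unfolding lk_inv_def Let_def G' a by simp
  have l: "lk_inv x s G (alpha s) = a" by (simp add: inv)
  show "lk x s (lk_inv x s G) b = G b"
  proof (cases "b \<in> Pos")
    case True
    have "hecke s (lk_inv x s G) b = G' b"
    proof (cases "b = alpha s")
      case b: True
      show ?thesis using x by (simp add: b G' a form_simple)
    next
      case False
      have P: "reflect s b \<in> Pos" "reflect s b \<noteq> alpha s" using reflect_Pos reflect_ne_simple True False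
          by auto
      consider "pairing s b > 0" | "pairing s b = 0" | "pairing s b < 0" by linarith
      then show ?thesis
        using P True False by cases (simp_all add: hecke_ge hecke_le inv reflect_fixed field_simps)
    qed
    then show ?thesis using True l by (simp add: lk_Pos G')
  qed (simp add: lk_def inv)
qed

lemma lk_inv_lk:
  assumes x: "x \<noteq> 0"
  shows "lk_inv x s (lk x s F) = F"
proof
  fix b
  define G where G: "G = lk x s F"
  have a: "- 2 * G (alpha s) / x = F (alpha s)" using x by (simp add: G lk_simple)
  have G': "G b - x * F (alpha s) * lk_form s b = hecke s F b" if "b \<in> Pos" for b
    using that by (simp add: G lk_Pos)
  show "lk_inv x s (lk x s F) b = F b"
  proof (cases "b \<in> Pos \<and> b \<noteq> alpha s")
    case False
    then show ?thesis using a x by (auto simp: lk_inv_def Let_def lk_simple) (simp add: lk_def)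
  next
    case True
    have P: "reflect s b \<in> Pos" "reflect s b \<noteq> alpha s" using reflect_Pos reflect_ne_simple True by auto
    have "lk_inv x s G b
        = (if pairing s b \<ge> 0 then 2 * hecke s F (reflect s b) - hecke s F b else hecke s F (reflect s b))"
      unfolding lk_inv_def Let_def a using True P G' by simp
    moreover consider "pairing s b > 0" | "pairing s b = 0" | "pairing s b < 0" by linarith
    ultimately show ?thesis
      using P True unfolding G[symmetric]
          by cases (simp_all add: hecke_ge hecke_le reflect_fixed field_simps)
  qed
qed

lemma lk_isCont:
  assumes "\<And>b. isCont (\<lambda>x. F x b) 0"
  shows "isCont (\<lambda>x. lk x s (F x) b) 0"
  unfolding lk_def hecke_def
  by (cases "b \<in> Pos"; cases "b = alpha s"; cases
      "0 \<le> pairing s b") (auto intro!: continuous_intros assms)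

lemma lk_fold_isCont:
  assumes "\<And>b. isCont (\<lambda>x. F x b) 0"
  shows "isCont (\<lambda>x. fold (lk x) w (F x) b) 0"
  using assms
proof (induction w arbitrary: F b)
  case (Cons s w)
  show ?case using Cons.IH[of "\<lambda>x. lk x s (F x)"] lk_isCont[of F s] Cons.prems by simp
qed simp

text \<open>The matrix entries of a positive word are polynomials in \<open>x\<close>, hence continuous at \<open>0\<close>.\<close>

lemma lk_fold_limit:
  assumes "\<And>x. x \<noteq> 0 \<Longrightarrow> fold (lk x) v = fold (lk x) w"
  shows "fold (lk 0) v = fold (lk 0) w"
proof (intro ext)
  fix F b
  have "(\<lambda>x. fold (lk x) v F b) \<midarrow>0\<rightarrow> fold (lk 0) v F b"
    using lk_fold_isCont[of "\<lambda>_. F" v b] by (simp add: isCont_def)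
  moreover have "(\<lambda>x. fold (lk x) w F b) \<midarrow>0\<rightarrow> fold (lk 0) w F b"
    using lk_fold_isCont[of "\<lambda>_. F" w b] by (simp add: isCont_def)
  then have "(\<lambda>x. fold (lk x) v F b) \<midarrow>0\<rightarrow> fold (lk 0) w F b"
    using LIM_cong[OF HOL.refl, of 0 "\<lambda>x. fold (lk x) v F b" "\<lambda>x. fold (lk x) w F b"] assms by simp
  ultimately show "fold (lk 0) v F b = fold (lk 0) w F b" by (rule LIM_unique)
qed

text \<open>The effect of \<open>hecke s\<close> on the support of a nonnegative function.  The order of words is that of \<open>lk\<close>: a set
\<open>E\<close> of roots is moved by the first letter first.\<close>

section \<open>The limit: an action on sets of roots\<close>

definition act :: "'v \<Rightarrow> ('v \<Rightarrow> int) set \<Rightarrow> ('v \<Rightarrow> int) set" where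
  "act s E = {b \<in> Pos. b \<noteq> alpha s \<and> (reflect s b \<in> E \<or> pairing s b < 0 \<and> b \<in> E)}"

definition supp :: "(('v \<Rightarrow> int) \<Rightarrow> real) \<Rightarrow> ('v \<Rightarrow> int) set" where
  "supp F = {b \<in> Pos. F b > 0}"

lemma supp_fold:
  assumes "\<And>b. b \<in> Pos \<Longrightarrow> F b \<ge> 0"
  shows "supp (fold (lk 0) w F) = fold act w (supp F)"
  using assms
proof (induction w arbitrary: F)
  case (Cons s w)
  have nn: "F b \<ge> 0 \<and> (b \<noteq> alpha s \<longrightarrow> F (reflect s b) \<ge> 0)" if "b \<in> Pos" for b
    using that Cons.prems reflect_Pos by blast
  have 1: "lk 0 s F b \<ge> 0" if "b \<in> Pos" for b
    using nn[OF that] that by (auto simp: lk_Pos hecke_def)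
  have 2: "supp (lk 0 s F) = act s (supp F)"
  proof (rule Set.set_eqI)
    fix b
    show "b \<in> supp (lk 0 s F) \<longleftrightarrow> b \<in> act s (supp F)"
      using nn[of b] reflect_Pos[of b s]
      by (cases "b \<in> Pos"; cases "b = alpha s"; cases "pairing s b < 0")
        (auto simp: lk_Pos hecke_def act_def supp_def)
  qed
  show ?case using Cons.IH[of "lk 0 s F"] 1 2 by simp
qed simp

lemma supp_indicator: "E \<subseteq> Pos \<Longrightarrow> supp (\<lambda>b. if b \<in> E then 1 else 0) = E"
  by (auto simp: supp_def)

lemma acts_eq_if_lk_eq:
  assumes "fold (lk 0) v = fold (lk 0) w" "E \<subseteq> Pos"
  shows "fold act v E = fold act w E"
  using supp_fold[of "\<lambda>b. if b \<in> E then 1 else 0" v] supp_fold[of "\<lambda>b. if b \<in> E then 1 else 0" w]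
    assms by (simp add: supp_indicator)

lemma acts_scong: "scong v w \<Longrightarrow> E \<subseteq> Pos \<Longrightarrow> fold act v E = fold act w E"
  using acts_eq_if_lk_eq lk_scong by blast

lemma act_mono: "E \<subseteq> E2 \<Longrightarrow> act s E \<subseteq> act s E2"
  by (auto simp: act_def)

lemma acts_mono: "E \<subseteq> E2 \<Longrightarrow> fold act w E \<subseteq> fold act w E2"
  by (induction w arbitrary: E E2) (simp_all add: act_mono)

lemma act_self: "act s {alpha s} = {}"
  using reflect_ne_simple by (auto simp: act_def)

lemma act_other: "s \<noteq> t \<Longrightarrow> alpha s \<in> act t {alpha s}"
proof (cases "adj t s")
  case True
  assume "s \<noteq> t"
  then show ?thesis using True by (auto simp: act_def pairing_alpha)
next
  case False
  assume "s \<noteq> t"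
  then show ?thesis using False reflect_alpha_nadj[of t s] by (auto simp: act_def)
qed

lemma scong_append_left: "scong v w \<Longrightarrow> scong (u @ v) (u @ w)"
  using pres_cong_append2[of UNIV srels u u v w] pres_cong.refl[of u UNIV srels] by simp

lemma scong_append_right: "scong v w \<Longrightarrow> scong (v @ u) (w @ u)"
  using pres_cong_append2[of UNIV srels v w u u] pres_cong.refl[of u UNIV srels] by simp

lemma scong_rel: "(u, v) \<in> srels \<Longrightarrow> scong (u @ z) (v @ z)"
  using pres_cong.step[of u v srels UNIV "[]" z] by simp

definition sdiv :: "'v \<Rightarrow> 'v list \<Rightarrow> bool" where
  "sdiv s w \<longleftrightarrow> (\<exists>v. scong w (s # v))"

lemma scong_length: "scong v w \<Longrightarrow> length v = length w"
  by (induction rule: pres_cong.induct) (auto simp: srels_def)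

text \<open>The divisibility criterion, by induction on the length of \<open>w = t v\<close>.  As \<open>t\<close> keeps \<open>\<alpha>\<^sub>s\<close>, the claim
follows from that for \<open>v\<close> unless \<open>v = s u\<close>.  Then \<open>s\<close> and \<open>t\<close> are adjacent and \<open>t\<close> does not divide \<open>u\<close>,
since otherwise a relation would bring \<open>s\<close> to the front of \<open>w\<close>.  So \<open>u\<close> does not annihilate \<open>\<alpha>\<^sub>t\<close>, which is
reached from \<open>\<alpha>\<^sub>s\<close> through \<open>\<alpha>\<^sub>s + \<alpha>\<^sub>t\<close>.\<close>

lemma acts_nonempty_if_not_sdiv: "\<not> sdiv s w \<Longrightarrow> fold act w {alpha s} \<noteq> {}"
proof (induction "length w" arbitrary: s w rule: less_induct)
  case less
  show ?case
  proof (cases w)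
    case (Cons t v)
    have st: "s \<noteq> t"
      using less.prems Cons pres_cong.refl[of w UNIV srels] unfolding sdiv_def by auto
    have keep: "fold act v {alpha s} \<subseteq> fold act w {alpha s}"
      using acts_mono[of "{alpha s}" "act t {alpha s}" v] act_other[OF st] Cons by simp
    show ?thesis
    proof (cases "sdiv s v")
      case False
      then show ?thesis using less.hyps[of v s] Cons keep by auto
    next
      case True
      then obtain u where u: "scong v (s # u)" unfolding sdiv_def by blast
      have w: "scong w (t # s # u)" using scong_append_left[OF u, of "[t]"] Cons by simp
      have lu: "length u < length w" using scong_length[OF w] by simp
      have adj: "adj t s"
      proof (rule ccontr)
        assume "\<not> adj t s"
        then have "([t, s], [s, t]) \<in> srels" using st by (auto simp: srels_def)
        from scong_rel[OF this, of u] have "scong w (s # t # u)" using w pres_cong.trans by fastforce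
        then show False using less.prems unfolding sdiv_def by blast
      qed
      have "\<not> sdiv t u"
      proof
        assume "sdiv t u"
        then obtain z where z: "scong u (t # z)" unfolding sdiv_def by blast
        have 1: "scong w (t # s # t # z)"
          using scong_append_left[OF z, of "[t, s]"] w pres_cong.trans by fastforce
        have "([t, s, t], [s, t, s]) \<in> srels" using adj by (auto simp: srels_def)
        from scong_rel[OF this, of z] have "scong w (s # t # s # z)"
          using 1 pres_cong.trans by fastforce
        then show False using less.prems unfolding sdiv_def by blast
      qed
      then have ne: "fold act u {alpha t} \<noteq> {}" using less.hyps lu by blast
      note adj' = adj_sym[OF adj]
      have "reflect t (alpha s) \<in> act t {alpha s}"
        using reflect_Pos[of "alpha s" t] reflect_ne_simple[of "alpha s" t] st by (simp add: act_def)
      moreover have "alpha t \<in> act s {reflect t (alpha s)}"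
        using reflect_alpha_adj[OF adj'] st by (simp add: act_def)
      ultimately have "{alpha t} \<subseteq> act s (act t {alpha s})"
        using act_mono[of "{reflect t (alpha s)}" "act t {alpha s}" s] by blast
      then have "fold act u {alpha t} \<subseteq> fold act (t # s # u) {alpha s}"
        using acts_mono by simp
      then show ?thesis using ne acts_scong[OF w, of "{alpha s}"] by auto
    qed
  qed simp
qed

section \<open>Products of commuting generators\<close>

definition commuting :: "'v list \<Rightarrow> bool" where
  "commuting L \<longleftrightarrow> distinct L \<and> (\<forall>u\<in>set L. \<forall>v\<in>set L. \<not> adj u v)"

text \<open>For commuting \<open>L\<close>, the image of \<open>b\<close> under the reflections of \<open>L\<close> that lower it, and under those in \<open>C\<close> that raise it.  The set \<open>C\<close>
records the choices left open by the action on sets of roots.\<close>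

definition move :: "'v set \<Rightarrow> 'v list \<Rightarrow> ('v \<Rightarrow> int) \<Rightarrow> 'v \<Rightarrow> int" where
  "move C L b = (\<lambda>w. if w \<in> set L \<and> (pairing w b > 0 \<or> pairing w b < 0
      \<and> w \<in> C) then b w - pairing w b else b w)"

lemma acts_empty [simp]: "fold act w {} = {}"
  by (induction w) (simp_all add: act_def)

lemma acts_elem: "c \<in> fold act w E \<Longrightarrow> \<exists>b\<in>E. c \<in> fold act w {b}"
proof (induction w arbitrary: E)
  case (Cons s w)
  then obtain b where b: "b \<in> act s E" "c \<in> fold act w {b}" by auto
  then obtain a where a: "a \<in> E" "b \<in> act s {a}" by (auto simp: act_def)
  then have "c \<in> fold act (s # w) {a}" using acts_mono[of "{b}" "act s {a}" w] b by auto
  then show ?case using a by blast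
qed simp

lemma reflect_eq_iff: "reflect s b = c \<longleftrightarrow> b = reflect s c"
  by auto

lemma act_single:
  assumes "b \<in> Pos" "b \<noteq> alpha s"
  shows "act s {b} = (if pairing s b < 0 then {b, reflect s b} else {reflect s b})"
proof -
  have "c \<in> act s {b} \<longleftrightarrow> c = reflect s b \<or> pairing s b < 0 \<and> c = b" for c
  proof
    assume "c \<in> act s {b}"
    then show "c = reflect s b \<or> pairing s b < 0 \<and> c = b" using reflect_eq_iff[of s c b]
        by (auto simp: act_def)
  next
    assume "c = reflect s b \<or> pairing s b < 0 \<and> c = b"
    then show "c \<in> act s {b}"
      using assms reflect_Pos[OF assms] reflect_ne_simple[OF assms(1), of s] by (auto simp: act_def)
  qed
  then show ?thesis by auto
qed

lemma acts_class_kill: "commuting L \<Longrightarrow> v \<in> set L \<Longrightarrow> fold act L {alpha v} = {}"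
proof (induction L)
  case (Cons u L)
  show ?case
  proof (cases "u = v")
    case True
    then show ?thesis by (simp add: act_self)
  next
    case False
    have "\<not> adj u v" using Cons.prems by (auto simp: commuting_def)
    then have "pairing u (alpha v) = 0" "reflect u (alpha v) = alpha v" using False reflect_alpha_nadj
        by (auto simp: pairing_alpha)
    then have "act u {alpha v} = {alpha v}" using act_single[of "alpha v" u] False by simp
    moreover have "commuting L" "v \<in> set L" using Cons.prems False by (auto simp: commuting_def)
    ultimately show ?thesis using Cons.IH by simp
  qed
qed simp

lemma class_tail:
  assumes "commuting (v # L)" "w \<in> set L"
  shows "pairing w (reflect v b) = pairing w b" "w \<noteq> v" "reflect v b = alpha w \<Longrightarrow> b = alpha w"
proof -
  have 1: "\<not> adj v w" "v \<noteq> w" using assms by (auto simp: commuting_def)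
  then show "pairing w (reflect v b) = pairing w b" "w \<noteq> v" by (auto simp: pairing_reflect_nadj)
  show "reflect v b = alpha w \<Longrightarrow> b = alpha w" using reflect_alpha_nadj[OF 1] by (metis reflect_reflect)
qed

lemma move_Cons:
  assumes "commuting (v # L)"
  shows "move C (v # L) b = move C L (if pairing v b < 0 \<and> v \<notin> C then b else reflect v b)"
proof
  fix w
  have "v \<notin> set L" using assms by (simp add: commuting_def)
  then show "move C (v # L) b w = move C L (if pairing v b < 0 \<and> v \<notin> C then b else reflect v b) w"
    using class_tail(1)[OF assms, of w b] class_tail(2)[OF assms, of w]
        by (auto simp: move_def reflect_apply)
qed

lemma move_in_acts:
  assumes "commuting L" "b \<in> Pos" "\<forall>v\<in>set L. b \<noteq> alpha v"
  shows "move C L b \<in> fold act L {b}"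
  using assms
proof (induction L arbitrary: b)
  case Nil
  then show ?case by (simp add: move_def)
next
  case (Cons v L)
  define c where c: "c = (if pairing v b < 0 \<and> v \<notin> C then b else reflect v b)"
  have bv: "b \<noteq> alpha v" using Cons.prems by simp
  have cP: "c \<in> Pos" using Cons.prems(2) reflect_Pos[OF _ bv] by (simp add: c)
  have cn: "\<forall>w\<in>set L. c \<noteq> alpha w"
    using Cons.prems(3) class_tail(3)[OF Cons.prems(1)] by (auto simp: c)
  have L: "commuting L" using Cons.prems(1) by (auto simp: commuting_def)
  have "c \<in> act v {b}" using act_single[OF Cons.prems(2) bv] by (auto simp: c)
  then show ?case
    using Cons.IH[OF L cP cn] acts_mono[of "{c}"
        "act v {b}" L] move_Cons[OF Cons.prems(1), of C b, folded c]
    by auto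
qed

lemma acts_in_move:
  assumes "commuting L" "b \<in> Pos" "\<forall>v\<in>set L. b \<noteq> alpha v" "c \<in> fold act L {b}"
  shows "\<exists>C. c = move C L b"
  using assms
proof (induction L arbitrary: b)
  case Nil
  then show ?case by (simp add: move_def)
next
  case (Cons v L)
  have bv: "b \<noteq> alpha v" using Cons.prems by simp
  obtain d where d: "d \<in> act v {b}" "c \<in> fold act L {d}"
    using acts_elem[of c L "act v {b}"] Cons.prems by auto
  have L: "commuting L" and vL: "v \<notin> set L" using Cons.prems(1) by (auto simp: commuting_def)
  have d2: "d = b \<and> pairing v b < 0 \<or> d = reflect v b"
    using d act_single[OF Cons.prems(2) bv] by (auto split: if_splits)
  have dP: "d \<in> Pos" using d by (simp add: act_def)
  have dn: "\<forall>w\<in>set L. d \<noteq> alpha w"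
  proof
    fix w
    assume w: "w \<in> set L"
    then have "b \<noteq> alpha w" using Cons.prems(3) by simp
    moreover have "reflect v b \<noteq> alpha w" using class_tail(3)[OF Cons.prems(1) w, of b] calculation
        by blast
    ultimately show "d \<noteq> alpha w" using d2 by metis
  qed
  obtain C where C: "c = move C L d" using Cons.IH[OF L dP dn d(2)] by blast
  have move_agree: "move C' L d = move C L d" if "C' - {v} = C - {v}" for C'
  proof -
    have "w \<in> C' \<longleftrightarrow> w \<in> C" if "w \<in> set L" for w using that vL \<open>C' - {v} = C - {v}\<close> by blast
    then show ?thesis unfolding move_def by (intro HOL.ext) auto
  qed
  show ?case
  proof (cases "d = reflect v b")
    case True
    then have "move (insert v C) (v # L) b = c"
      using move_Cons[OF Cons.prems(1), of "insert v C" b] move_agree[of "insert v C"] C by simp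
    then show ?thesis by blast
  next
    case False
    then have "move (C - {v}) (v # L) b = c"
      using move_Cons[OF Cons.prems(1), of "C - {v}" b] move_agree[of "C - {v}"] C d2 by simp
    then show ?thesis by blast
  qed
qed

lemma sdiv_acts_empty: "sdiv s w \<Longrightarrow> fold act w {alpha s} = {}"
  using acts_scong[of w _ "{alpha s}"] by (auto simp: sdiv_def act_self)

text \<open>Several commuting divisors can be split off together: after removing the first one, the others still
divide the rest, by the divisibility criterion, because the first one keeps their simple roots.\<close>

lemma class_sdiv:
  assumes "commuting L" "\<forall>s\<in>set L. sdiv s w"
  shows "\<exists>v. scong w (L @ v)"
  using assms
proof (induction L arbitrary: w)
  case Nil
  have "scong w w" by (rule pres_cong.refl) simp
  then show ?case by auto
next
  case (Cons s L)
  then obtain v where v: "scong w (s # v)" by (auto simp: sdiv_def)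
  have L: "commuting L" using Cons.prems(1) by (auto simp: commuting_def)
  have "sdiv u v" if u: "u \<in> set L" for u
  proof (rule ccontr)
    assume "\<not> sdiv u v"
    then have "fold act v {alpha u} \<noteq> {}" by (rule acts_nonempty_if_not_sdiv)
    moreover have "u \<noteq> s" using class_tail(2)[OF Cons.prems(1) u] .
    ultimately have "fold act (s # v) {alpha u} \<noteq> {}"
      using acts_mono[of "{alpha u}" "act s {alpha u}" v] act_other by auto
    then have "fold act w {alpha u} \<noteq> {}" using acts_scong[OF v, of "{alpha u}"] by simp
    then show False using sdiv_acts_empty Cons.prems(2) u by simp
  qed
  then obtain z where "scong v (L @ z)" using Cons.IH[OF L] by blast
  then have "scong (s # v) (s # L @ z)" using scong_append_left[of v "L @ z" "[s]"] by simp
  then show ?case using pres_cong.trans[OF v] by auto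
qed

end

text \<open>A Coxeter matrix with finite labels on a finite set, and a common multiple \<open>N\<close> of all \<open>m\<^bsub>s,t\<^esub> - 1\<close>.\<close>

section \<open>Folding\<close>

locale folding =
  fixes T :: "'a set" and m :: "'a \<Rightarrow> 'a \<Rightarrow> nat" and N :: nat
  assumes finite_T: "finite T"
    and m_sym: "s \<in> T \<Longrightarrow> t \<in> T \<Longrightarrow> m s t = m t s"
    and m_ge2: "s \<in> T \<Longrightarrow> t \<in> T \<Longrightarrow> s \<noteq> t \<Longrightarrow> 2 \<le> m s t"
    and N_pos: "0 < N"
    and m_dvd: "s \<in> T \<Longrightarrow> t \<in> T \<Longrightarrow> s \<noteq> t \<Longrightarrow> int (m s t) - 1 dvd int N"
begin

text \<open>The vertices \<open>(s, i)\<close> with \<open>0 \<le> i < N\<close> are the copies of \<open>s\<close>.  Two generators \<open>s\<close> and \<open>t\<close> are joined along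
zigzags \<open>(s, i), (t, i + 1), (s, i + 2), \<dots>\<close>, which are cut in front of the multiples of \<open>m\<^bsub>s,t\<^esub> - 1\<close>.
So the components are paths with \<open>m\<^bsub>s,t\<^esub> - 1\<close> vertices, and each interval between two multiples
carries two of them, one for each choice of the first letter.  The number \<open>N\<close> being a multiple of
\<open>m\<^bsub>s,t\<^esub> - 1\<close>, no path is cut at the ends of the range.  The parity of \<open>i\<close> changes along every edge, so
there are no triangles.\<close>

definition fadj :: "'a \<times> int \<Rightarrow> 'a \<times> int \<Rightarrow> bool" where
  "fadj u v \<longleftrightarrow> fst u \<in> T \<and> fst v \<in> T \<and> fst u \<noteq> fst v \<and> \<bar>snd u - snd v\<bar> = 1
    \<and> \<not> (int (m (fst u) (fst v)) - 1) dvd max (snd u) (snd v)"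

sublocale small_graph fadj
proof
  fix u v w
  show "fadj u v \<Longrightarrow> fadj v u"
    using m_sym[of "fst u" "fst v"] by (auto simp: fadj_def max.commute abs_minus_commute)
  show "\<not> fadj u u" by (simp add: fadj_def)
  show "fadj u v \<Longrightarrow> fadj v w \<Longrightarrow> \<not> fadj u w" by (auto simp: fadj_def)
  have "{v. fadj u v} \<subseteq> T \<times> {snd u - 1..snd u + 1}" by (auto simp: fadj_def)
  moreover have "finite (T \<times> {snd u - 1..snd u + 1})" using finite_T by simp
  ultimately show "finite {v. fadj u v}" by (rule finite_subset)
qed

definition copies :: "'a \<Rightarrow> ('a \<times> int) list" where
  "copies s = map (\<lambda>i. (s, int i)) [0..<N]"

lemma set_copies: "(c, j) \<in> set (copies s) \<longleftrightarrow> c = s \<and> 0 \<le> j \<and> j < int N"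
proof
  assume "c = s \<and> 0 \<le> j \<and> j < int N"
  then have "(c, j) = (\<lambda>i. (s, int i)) (nat j)" "nat j \<in> set [0..<N]" by auto
  then show "(c, j) \<in> set (copies s)" unfolding copies_def set_map by (rule image_eqI)
qed (auto simp: copies_def)

lemma commuting_copies: "commuting (copies s)"
  by (auto simp: commuting_def copies_def distinct_map inj_on_def fadj_def)

lemma length_copies [simp]: "length (copies s) = N"
  by (simp add: copies_def)

definition folded :: "'a list \<Rightarrow> ('a \<times> int) list" where
  "folded w = concat (map copies w)"

lemma folded_simps [simp]: "folded [] = []" "folded (s # w) = copies s @ folded w"
    "folded (v @ w) = folded v @ folded w"
  by (simp_all add: folded_def)

lemma length_folded: "length (folded w) = length w * N"
  by (induction w) simp_all

end

text \<open>One of the paths: it occupies the positions \<open>lo, \<dots>, hi\<close>, and \<open>e\<close> tells at which parity the letter is \<open>s\<close>.\<close>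

locale folded_block = folding T m N for T :: "'a set" and m N +
  fixes s t :: 'a and e :: bool and lo hi :: int
  assumes st: "s \<in> T" "t \<in> T" "s \<noteq> t"
    and lo: "int (m s t) - 1 dvd lo" "0 \<le> lo" "lo < int N"
    and hi: "hi = lo + int (m s t) - 2"
begin

definition vtx :: "int \<Rightarrow> 'a \<times> int" where
  "vtx q = (if even q = e then s else t, q)"

text \<open>The root that is the sum of the simple roots of the path from position \<open>a\<close> to position \<open>b\<close>.\<close>

definition ivl :: "int \<Rightarrow> int \<Rightarrow> 'a \<times> int \<Rightarrow> int" where
  "ivl a b = (\<lambda>w. if a \<le> snd w \<and> snd w \<le> b \<and> w = vtx (snd w) then 1 else 0)"

definition M :: int where "M = int (m s t) - 1"

lemma M: "M \<ge> 1" "hi = lo + M - 1" "lo \<le> hi"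
  using m_ge2[OF st] hi by (auto simp: M_def)

lemma M_lo: "M dvd lo"
  using lo(1) by (simp add: M_def)

lemma hi_N: "hi < int N"
proof -
  obtain k where k: "lo = M * k" using M_lo by blast
  have "M dvd int N" using m_dvd[OF st] by (simp add: M_def)
  then obtain n where n: "int N = M * n" by blast
  have "M * k < M * n" using lo(3) k n by simp
  then have "k + 1 \<le> n" using M(1) by simp
  then have "M * (k + 1) \<le> M * n" using M(1) by (intro mult_left_mono) auto
  then show ?thesis using k n M(2) by (simp add: algebra_simps)
qed

lemma not_dvd_inside: "lo < q \<Longrightarrow> q \<le> hi \<Longrightarrow> \<not> M dvd q"
proof
  assume q: "lo < q" "q \<le> hi" "M dvd q"
  then have "M dvd q - lo" using M_lo by simp
  then show False using zdvd_not_zless[of "q - lo" M] q M(2) by simp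
qed

lemma m_ts: "m t s = m s t"
  using m_sym st by simp

lemma fadj_vtx:
  "fadj (vtx q) (vtx (q + 1)) \<longleftrightarrow> \<not> M dvd q + 1" "fadj (vtx (q + 1)) (vtx q) \<longleftrightarrow> \<not> M dvd q + 1"
  using st m_ts by (auto simp: fadj_def vtx_def M_def)

lemma fadj_vtx_iff:
  assumes "c \<in> {s, t}"
  shows "fadj (c, j) (vtx q) \<longleftrightarrow> (c, j) = vtx j \<and> (q = j + 1 \<and> \<not> M dvd j + 1 \<or> q = j - 1 \<and> \<not> M dvd j)"
proof
  assume a: "fadj (c, j) (vtx q)"
  then have "q = j + 1 \<or> q = j - 1" "c \<noteq> fst (vtx q)" by (auto simp: fadj_def vtx_def)
  then have "(c, j) = vtx j" using assms by (auto simp: vtx_def split: if_splits)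
  then show "(c, j) = vtx j \<and> (q = j + 1 \<and> \<not> M dvd j + 1 \<or> q = j - 1 \<and> \<not> M dvd j)"
    using a \<open>q = j + 1 \<or> q = j - 1\<close> fadj_vtx(1)[of j] fadj_vtx(2)[of q] by auto
next
  assume "(c, j) = vtx j \<and> (q = j + 1 \<and> \<not> M dvd j + 1 \<or> q = j - 1 \<and> \<not> M dvd j)"
  then show "fadj (c, j) (vtx q)" using fadj_vtx(1)[of j] fadj_vtx(2)[of "j - 1"] by auto
qed

lemma ivl_vtx [simp]: "ivl a b (vtx q) = (if a \<le> q \<and> q \<le> b then 1 else 0)"
proof -
  have "snd (vtx q) = q" by (simp add: vtx_def)
  then show ?thesis unfolding ivl_def by simp
qed

lemma ivl_single: "ivl a a = alpha (vtx a)"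
  by (auto simp: ivl_def alpha_def fun_eq_iff) (auto simp: vtx_def)

text \<open>Off the block the pairing vanishes: the only candidates for neighbours of the interval are the positions
\<open>lo - 1\<close> and \<open>hi + 1\<close>, and there the path is cut.\<close>

lemma pairing_ivl:
  assumes c: "c \<in> {s, t}" and ab: "lo \<le> a" "a \<le> b" "b \<le> hi"
  shows "pairing (c, j) (ivl a b) =
    (if (c, j) = vtx j \<and> lo \<le> j \<and> j \<le> hi
     then 2 * ivl a b (vtx j) - ivl a b (vtx (j - 1)) - ivl a b (vtx (j + 1)) else 0)"
proof -
  have nb: "{u. fadj (c, j) u \<and> ivl a b u \<noteq> 0} =
    {u. (c, j) = vtx j \<and> (u = vtx (j + 1) \<and> a \<le> j + 1 \<and> j + 1 \<le> b \<and> \<not> M dvd j + 1 \<or>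
        u = vtx (j - 1) \<and> a \<le> j - 1 \<and> j - 1 \<le> b \<and> \<not> M dvd j)}" (is "?A = ?B")
  proof (rule Set.set_eqI)
    fix u :: "'a \<times> int"
    show "u \<in> ?A \<longleftrightarrow> u \<in> ?B"
    proof
      assume u: "u \<in> ?A"
      then have "u = vtx (snd u)" "a \<le> snd u" "snd u \<le> b" by (auto simp: ivl_def split: if_splits)
      then show "u \<in> ?B" using u fadj_vtx_iff[OF c, of j "snd u"] by auto
    next
      assume "u \<in> ?B"
      then show "u \<in> ?A" using fadj_vtx_iff[OF c, of j "j + 1"] fadj_vtx_iff[OF c, of j "j - 1"] by auto
    qed
  qed
  have "(\<Sum>u | fadj (c, j) u. ivl a b u) = (\<Sum>u | fadj (c, j) u \<and> ivl a b u \<noteq> 0. ivl a b u)"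
    by (rule sum.mono_neutral_right) (auto simp: locally_finite)
  also have "\<dots> = (if (c, j) = vtx j \<and> lo \<le> j \<and> j \<le> hi
     then ivl a b (vtx (j - 1)) + ivl a b (vtx (j + 1)) else 0)"
  proof (cases "(c, j) = vtx j")
    case False
    then show ?thesis unfolding nb by simp
  next
    case True
    have ne: "vtx (j + 1) \<noteq> vtx (j - 1)" by (simp add: vtx_def)
    consider "j < lo" | "j > hi" | "lo \<le> j" "j \<le> hi" by linarith
    then show ?thesis
    proof cases
      case 1
      have "\<not> (a \<le> j + 1 \<and> j + 1 \<le> b \<and> \<not> M dvd j + 1)"
        
      proof
        assume a: "a \<le> j + 1 \<and> j + 1 \<le> b \<and> \<not> M dvd j + 1"
        then have "j + 1 = lo" using 1 ab by simp
        then show False using a M_lo by simp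
      qed
      then have B: "?B = {}" using 1 ab by auto
      show ?thesis unfolding nb B using 1 by simp
    next
      case 2
      have "\<not> (a \<le> j - 1 \<and> j - 1 \<le> b \<and> \<not> M dvd j)"
      proof
        assume a: "a \<le> j - 1 \<and> j - 1 \<le> b \<and> \<not> M dvd j"
        then have "j = lo + M" using 2 ab M(2) by simp
        then show False using a M_lo by simp
      qed
      then have B: "?B = {}" using 2 ab by auto
      show ?thesis unfolding nb B using 2 by simp
    next
      case 3
      have d1: "a \<le> j + 1 \<and> j + 1 \<le> b \<Longrightarrow> \<not> M dvd j + 1" using not_dvd_inside[of "j + 1"] 3 ab by auto
      have d2: "a \<le> j - 1 \<and> j - 1 \<le> b \<Longrightarrow> \<not> M dvd j" using not_dvd_inside[of j] 3 ab by auto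
      have "?B = (if a \<le> j + 1 \<and> j + 1 \<le> b then {vtx (j + 1)} else {})
          \<union> (if a \<le> j - 1 \<and> j - 1 \<le> b then {vtx (j - 1)} else {})"
        using True d1 d2 by auto
      then show ?thesis unfolding nb using True 3 ne by auto
    qed
  qed
  finally have S: "(\<Sum>u | fadj (c, j) u. ivl a b u) = (if (c, j) = vtx j \<and> lo \<le> j \<and> j \<le> hi
     then ivl a b (vtx (j - 1)) + ivl a b (vtx (j + 1)) else 0)" .
  have Z: "ivl a b (c, j) = 0" if "\<not> ((c, j) = vtx j \<and> lo \<le> j \<and> j \<le> hi)"
    using that ab by (auto simp: ivl_def)
  show ?thesis unfolding pairing_def S using Z by auto
qed

lemma ivl_Pos: "lo \<le> a \<Longrightarrow> a \<le> b \<Longrightarrow> b \<le> hi \<Longrightarrow> ivl a b \<in> Pos"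
proof (induction "nat (b - a)" arbitrary: b)
  case 0
  then have "a = b" by simp
  then show ?case by (simp add: ivl_single)
next
  case (Suc n)
  have 1: "ivl a (b - 1) \<in> Pos" using Suc by simp
  have ab: "a < b" using Suc.hyps(2) by simp
  have v: "fst (vtx b) \<in> {s, t}" "vtx b = (fst (vtx b), b)" by (auto simp: vtx_def)
  have "pairing (vtx b) (ivl a (b - 1)) = - 1"
    using pairing_ivl[OF v(1), of a "b - 1" b] v(2) Suc.prems ab by simp
  then have "reflect (vtx b) (ivl a (b - 1)) = ivl a b"
    using ab by (auto simp: reflect_apply fun_eq_iff) (auto simp: ivl_def vtx_def)
  moreover have "ivl a (b - 1) \<noteq> alpha (vtx b)"
  proof
    assume "ivl a (b - 1) = alpha (vtx b)"
    then have "ivl a (b - 1) (vtx b) = 1" by (simp add: alpha_def)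
    then show False by simp
  qed
  ultimately show ?case using reflect_Pos[OF 1, of "vtx b"] by simp
qed

end

lemma alt_word_Suc_snoc: "alt_word (Suc k) c d = alt_word k c d @ [if even k then c else d]"
  by (induction k arbitrary: c d) auto

context folded_block
begin

lemma on_iff: "c \<in> {s, t} \<Longrightarrow> fst (vtx q) = c \<longleftrightarrow> even q = (e = (c = s))"
  using st by (auto simp: vtx_def)

lemma vtx_eq_iff: "vtx q = w \<longleftrightarrow> q = snd w \<and> fst (vtx q) = fst w"
  by (auto simp: vtx_def prod_eq_iff)

text \<open>The product of all copies of \<open>c\<close> acts on the two ends of an interval independently: an end whose letter
is \<open>c\<close> retreats, and the other ends may stay or, inside the block, advance.\<close>

lemma move_ivl:
  fixes C
  assumes c: "c \<in> {s, t}" and ab: "lo \<le> a" "a \<le> b" "b \<le> hi" "\<not> (a = b \<and> fst (vtx a) = c)"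
  defines "a' \<equiv> if fst (vtx a) = c then a + 1 else if lo \<le> a - 1 \<and> vtx (a - 1) \<in> C then a - 1 else a"
    and "b' \<equiv> if fst (vtx b) = c then b - 1 else if b + 1 \<le> hi \<and> vtx (b + 1) \<in> C then b + 1 else b"
  shows "move C (copies c) (ivl a b) = ivl a' b'"
proof
  fix w :: "'a \<times> int"
  obtain d j where w: "w = (d, j)" by (cases w)
  show "move C (copies c) (ivl a b) w = ivl a' b' w"
  proof (cases "w = vtx j")
    case False
    then have "ivl a b w = 0" "ivl a' b' w = 0" by (auto simp: ivl_def w)
    moreover have "pairing w (ivl a b) = 0" if "w \<in> set (copies c)"
      using that pairing_ivl[OF c ab(1-3), of j] False by (simp add: w set_copies)
    ultimately show ?thesis by (auto simp: move_def)
  next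
    case True
    define on where "on q \<longleftrightarrow> fst (vtx q) = c" for q
    have on1: "on (q + 1) \<longleftrightarrow> \<not> on q" for q unfolding on_def using on_iff[OF c] by auto
    have on2: "on (q - 1) \<longleftrightarrow> \<not> on q" for q unfolding on_def using on_iff[OF c] by auto
    have mem: "vtx j \<in> set (copies c) \<longleftrightarrow> on j \<and> 0 \<le> j \<and> j < int N"
    proof -
      have "vtx j = (fst (vtx j), j)" by (simp add: vtx_def)
      from this[symmetric] show ?thesis using set_copies[of "fst (vtx j)" j c] by (simp add: on_def)
    qed
    have a': "a' = (if on a then a + 1 else if lo \<le> a - 1 \<and> vtx (a - 1) \<in> C then a - 1 else a)"
      and b': "b' = (if on b then b - 1 else if b + 1 \<le> hi \<and> vtx (b + 1) \<in> C then b + 1 else b)"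
      by (simp_all add: a'_def b'_def on_def)
    show ?thesis
    proof (cases "on j \<and> lo \<le> j \<and> j \<le> hi")
      case False
      have "move C (copies c) (ivl a b) (vtx j) = ivl a b (vtx j)"
      proof (cases "on j")
        case True
        then have "vtx j = (c, j)" unfolding on_def by (simp add: vtx_def)
        moreover have "pairing (c, j) (ivl a b) = 0"
        proof -
          have n: "\<not> ((c, j) = vtx j \<and> lo \<le> j \<and> j \<le> hi)" using False True by blast
          show ?thesis unfolding pairing_ivl[OF c ab(1-3)] if_not_P[OF n] ..
        qed
        ultimately have "pairing (vtx j) (ivl a b) = 0" by simp
        then show ?thesis by (simp add: move_def)
      next
        case False
        then show ?thesis using mem by (simp add: move_def)
      qed
      moreover have "a' \<le> j \<and> j \<le> b' \<longleftrightarrow> a \<le> j \<and> j \<le> b"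
      proof (cases "on j")
        case True
        then have "\<not> (lo \<le> j \<and> j \<le> hi)" using False by blast
        then consider "j < lo" | "hi < j" by linarith
        then show ?thesis
        proof cases
          case 1
          then have "j < a'" "j < a" using ab by (auto simp: a')
          then show ?thesis by simp
        next
          case 2
          then have "b' < j" "b < j" using ab by (auto simp: b')
          then show ?thesis by simp
        qed
      next
        case False
        have "a' \<le> j \<longleftrightarrow> a \<le> j"
        proof (cases "on a")
          case True
          then have "a' = a + 1" "j \<noteq> a" using False by (auto simp: a')
          then show ?thesis by linarith
        next
          case na: False
          then have "a' = a \<or> a' = a - 1" by (simp add: a')
          moreover have "j \<noteq> a - 1" using na False on2[of a] by blast
          ultimately show ?thesis by linarith
        qed
        moreover have "j \<le> b' \<longleftrightarrow> j \<le> b"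
        proof (cases "on b")
          case True
          then have "b' = b - 1" "j \<noteq> b" using False by (auto simp: b')
          then show ?thesis by linarith
        next
          case nb: False
          then have "b' = b \<or> b' = b + 1" by (simp add: b')
          moreover have "j \<noteq> b + 1" using nb False on1[of b] by blast
          ultimately show ?thesis by linarith
        qed
        ultimately show ?thesis by simp
      qed
      ultimately show ?thesis using \<open>w = vtx j\<close> by simp
    next
      case j: True
      have jN: "0 \<le> j" "j < int N" using j lo hi_N by auto
      have p: "pairing (vtx j) (ivl a b)
          = 2 * ivl a b (vtx j) - ivl a b (vtx (j - 1)) - ivl a b (vtx (j + 1))"
      proof -
        have "fst (vtx j) = c" using j unfolding on_def by simp
        then have "vtx j = (c, j)" by (simp add: vtx_def)
        moreover from this have n: "(c, j) = vtx j \<and> lo \<le> j \<and> j \<le> hi" using j by simp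
        ultimately show ?thesis using pairing_ivl[OF c ab(1-3), of j, unfolded if_P[OF n]] by metis
      qed
      have mvj: "move C (copies c) (ivl a b) (vtx j) = (if pairing (vtx j) (ivl a b) > 0
          \<or> pairing (vtx j) (ivl a b) < 0
              \<and> vtx j \<in> C then ivl a b (vtx j) - pairing (vtx j) (ivl a b) else ivl a b (vtx j))"
        using mem j jN by (simp add: move_def)
      have ne: "\<not> (a = b \<and> on a)" using ab(4) by (simp add: on_def)
      consider "j < a - 1" | "j = a - 1" | "j = a" | "a < j" "j < b" | "j = b" "a < j" | "j = b + 1" |
          "j > b + 1"
        using ab by linarith
      then have "move C (copies c) (ivl a b) (vtx j) = ivl a' b' (vtx j)"
      proof cases
        case 1
        then show ?thesis using ab unfolding mvj p by (auto simp: a' b')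
      next
        case 2
        then have "\<not> on a" using j on2[of a] by simp
        then show ?thesis using 2 j ab unfolding mvj p by (auto simp: a' b')
      next
        case 3
        then have "on a" "a < b" using j ne ab by auto
        then show ?thesis using 3 j ab unfolding mvj p by (auto simp: a' b')
      next
        case 4
        then show ?thesis using j ab unfolding mvj p by (auto simp: a' b')
      next
        case 5
        then have "on b" using j by simp
        then show ?thesis using 5 j ab unfolding mvj p by (auto simp: a' b')
      next
        case 6
        then have "\<not> on b" using j on1[of b] by simp
        then show ?thesis using 6 j ab unfolding mvj p by (auto simp: a' b')
      next
        case 7
        then show ?thesis using ab unfolding mvj p by (auto simp: a' b')
      qed
      then show ?thesis using True by simp
    qed
  qed
qed

lemma ivl_not_simple:
  assumes "c \<in> {s, t}" "a \<le> b" "\<not> (a = b \<and> fst (vtx a) = c)"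
  shows "\<forall>v\<in>set (copies c). ivl a b \<noteq> alpha v"
proof
  fix v
  assume v: "v \<in> set (copies c)"
  show "ivl a b \<noteq> alpha v"
  proof
    assume eq: "ivl a b = alpha v"
    have "ivl a b (vtx a) = 1" "ivl a b (vtx b) = 1" using assms by auto
    then have "vtx a = v" "vtx b = v" unfolding eq by (auto simp: alpha_def split: if_splits)
    then have "a = b" "fst (vtx a) = c"
      using v by (auto simp: vtx_eq_iff) (auto simp: set_copies copies_def)
    then show False using assms by simp
  qed
qed

lemma class_step_in:
  assumes c: "c \<in> {s, t}" and ab: "lo \<le> a" "a \<le> b" "b \<le> hi" "\<not> (a = b \<and> fst (vtx a) = c)"
    and a': "if fst (vtx a) = c then a' = a + 1 else a' = a \<or> a' = a - 1 \<and> lo \<le> a - 1"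
    and b': "if fst (vtx b) = c then b' = b - 1 else b' = b \<or> b' = b + 1 \<and> b + 1 \<le> hi"
  shows "ivl a' b' \<in> fold act (copies c) {ivl a b}"
proof -
  define C where "C = {w. w = vtx (b + 1) \<and> b' = b + 1 \<or> w = vtx (a - 1) \<and> a' = a - 1}"
  have v: "vtx p = vtx q \<longleftrightarrow> p = q" for p q by (auto simp: vtx_def)
  have C: "vtx (b + 1) \<in> C \<longleftrightarrow> b' = b + 1" "vtx (a - 1) \<in> C \<longleftrightarrow> a' = a - 1"
    using ab by (auto simp: C_def v)
  have "move C (copies c) (ivl a b) = ivl a' b'"
    unfolding move_ivl[OF c ab] C using a' b' by (auto split: if_splits)
  then show ?thesis
    using move_in_acts[OF commuting_copies ivl_Pos[OF ab(1-3)] ivl_not_simple[OF c ab(2,4)], of C]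
        by simp
qed

lemma class_step_out:
  assumes c: "c \<in> {s, t}" and ab: "lo \<le> a" "a \<le> b" "b \<le> hi"
    and z: "z \<in> fold act (copies c) {ivl a b}"
  shows "\<exists>a' b'. z = ivl a' b' \<and> lo \<le> a' \<and> a' \<le> b' \<and> b' \<le> hi \<and>
    (if fst (vtx a) = c then a' = a + 1 else a' = a \<or> a' = a - 1) \<and>
    (if fst (vtx b) = c then b' = b - 1 else b' = b \<or> b' = b + 1)"
proof -
  have ne: "\<not> (a = b \<and> fst (vtx a) = c)"
  proof
    assume h: "a = b \<and> fst (vtx a) = c"
    then have "0 \<le> a" "a < int N" using ab lo hi_N by auto
    then have "(c, a) \<in> set (copies c)" by (simp add: set_copies)
    moreover have "vtx a = (fst (vtx a), a)" by (simp add: vtx_def)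
    ultimately have "vtx a \<in> set (copies c)" using h by metis
    then show False using z h acts_class_kill[OF commuting_copies] by (simp add: ivl_single)
  qed
  obtain C where C: "z = move C (copies c) (ivl a b)"
    using acts_in_move[OF commuting_copies ivl_Pos[OF ab] ivl_not_simple[OF c ab(2) ne] z] by blast
  define a' where "a' = (if fst (vtx a) = c then a + 1 else if lo \<le> a - 1
      \<and> vtx (a - 1) \<in> C then a - 1 else a)"
  define b' where "b' = (if fst (vtx b) = c then b - 1 else if b + 1 \<le> hi
      \<and> vtx (b + 1) \<in> C then b + 1 else b)"
  have "z = ivl a' b'" unfolding C move_ivl[OF c ab ne] a'_def b'_def ..
  moreover have "a' \<le> b'"
  proof -
    have "fst (vtx (a + 1)) = c \<longleftrightarrow> fst (vtx a) \<noteq> c" using on_iff[OF c, of a] on_iff[OF c, of "a + 1"]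
        by auto
    then have nb: "fst (vtx a) = c \<Longrightarrow> fst (vtx b) = c \<Longrightarrow> b \<noteq> a + 1" by auto
    have "a' \<le> (if fst (vtx a) = c then a + 1 else a)" unfolding a'_def by auto
    moreover have "(if fst (vtx b) = c then b - 1 else b) \<le> b'" unfolding b'_def by auto
    moreover have "(if fst (vtx a) = c then a + 1 else a) \<le> (if fst (vtx b) = c then b - 1 else b)"
    proof (cases "a = b")
      case True
      then have "fst (vtx a) \<noteq> c" "fst (vtx b) \<noteq> c" using ne by auto
      then show ?thesis using True by simp
    next
      case False
      then have "a < b" using ab(2) by simp
      then show ?thesis using nb by (cases "fst (vtx a) = c"; cases "fst (vtx b) = c") simp_all
    qed
    ultimately show ?thesis by linarith
  qed
  moreover have "lo \<le> a'" "b' \<le> hi"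
    using ab unfolding a'_def b'_def by auto
  moreover have "if fst (vtx a) = c then a' = a + 1 else a' = a \<or> a' = a - 1"
    "if fst (vtx b) = c then b' = b - 1 else b' = b \<or> b' = b + 1"
    unfolding a'_def b'_def by simp_all
  ultimately show ?thesis by (intro HOL.exI[of _ a'] HOL.exI[of _ b'] conjI)
qed

text \<open>From the one-point interval at \<open>i\<close>, let the right end advance for \<open>n1\<close> factors, rest for one and then retreat,
and let the left end do the same with \<open>n2\<close>.  Once an end has rested, its letter is always that of the next
factor, so it has to retreat; before, it never is.  The ends meet again after \<open>n1 + n2 + 1\<close> factors.\<close>

lemma transit_path:
  assumes i: "fst (vtx i) = s" "lo \<le> i - int n2" "i + int n1 \<le> hi"
    and q: "q \<le> n1 + n2 + 1"
  shows "ivl (max (i - int q) (i - 2 * int n2 - 1 + int q)) (min (i + int q) (i + 2 * int n1 + 1 - int q))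
    \<in> fold act (folded (alt_word q t s)) {ivl i i}"
  using q
proof (induction q)
  case 0
  then show ?case by simp
next
  case (Suc q)
  define a where "a = max (i - int q) (i - 2 * int n2 - 1 + int q)"
  define b where "b = min (i + int q) (i + 2 * int n1 + 1 - int q)"
  define a' where "a' = max (i - int (Suc q)) (i - 2 * int n2 - 1 + int (Suc q))"
  define b' where "b' = min (i + int (Suc q)) (i + 2 * int n1 + 1 - int (Suc q))"
  define c where "c = (if even q then t else s)"
  have c: "c \<in> {s, t}" by (simp add: c_def)
  have IH: "ivl a b \<in> fold act (folded (alt_word q t s)) {ivl i i}" using Suc unfolding a_def b_def
      by simp
  have ie: "even i = e" using on_iff[of s i] i(1) by simp
  have on: "fst (vtx p) = c \<longleftrightarrow> odd (p - i + int q)" for p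
    using on_iff[OF c, of p] ie st by (cases "even q") (auto simp: c_def)
  have ab: "lo \<le> a" "a \<le> b" "b \<le> hi" using i Suc.prems unfolding a_def b_def by linarith+
  have ne: "\<not> (a = b \<and> fst (vtx a) = c)"
  proof (cases "q = 0")
    case True
    then show ?thesis unfolding on by (simp add: a_def)
  next
    case False
    then have "a < b" using Suc.prems unfolding a_def b_def by linarith
    then show ?thesis by simp
  qed
  have B: "if fst (vtx b) = c then b' = b - 1 else b' = b \<or> b' = b + 1 \<and> b + 1 \<le> hi"
  proof (cases "q \<le> n1")
    case True
    then have "b = i + int q" unfolding b_def by linarith
    moreover from this have "fst (vtx b) \<noteq> c" unfolding on by simp
    moreover have "b' = i + int q + 1 \<and> q < n1 \<or> b' = i + int q"
      using True unfolding b'_def by linarith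
    ultimately show ?thesis using i by auto
  next
    case False
    then have b: "b = i + 2 * int n1 + 1 - int q" unfolding b_def by linarith
    then have "fst (vtx b) = c" unfolding on by simp
    moreover have "b' = b - 1" using False b unfolding b'_def by linarith
    ultimately show ?thesis by simp
  qed
  have A: "if fst (vtx a) = c then a' = a + 1 else a' = a \<or> a' = a - 1 \<and> lo \<le> a - 1"
  proof (cases "q \<le> n2")
    case True
    then have "a = i - int q" unfolding a_def by linarith
    moreover from this have "fst (vtx a) \<noteq> c" unfolding on by simp
    moreover have "a' = i - int q - 1 \<and> q < n2 \<or> a' = i - int q"
      using True unfolding a'_def by linarith
    ultimately show ?thesis using i by auto
  next
    case False
    then have a: "a = i - 2 * int n2 - 1 + int q" unfolding a_def by linarith
    then have "fst (vtx a) = c" unfolding on by simp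
    moreover have "a' = a + 1" using False a unfolding a'_def by linarith
    ultimately show ?thesis by simp
  qed
  have "ivl a' b' \<in> fold act (copies c) {ivl a b}"
    by (rule class_step_in[OF c ab ne A B])
  then have "ivl a' b' \<in> fold act (folded (alt_word (Suc q) t s)) {ivl i i}"
    using acts_mono[of "{ivl a b}" "fold act (folded (alt_word q t s)) {ivl i i}" "copies c"] IH
    unfolding alt_word_Suc_snoc c_def by auto
  then show ?case unfolding a'_def b'_def .
qed

text \<open>Each end is either still advancing, which is visible from its parity, or it has rested at some point inside
the block and is retreating since then, which bounds its position.\<close>

lemma death_path:
  assumes i: "fst (vtx i) = s" "lo \<le> i" "i \<le> hi"
    and z: "z \<in> fold act (folded (alt_word q t s)) {ivl i i}"
  shows "\<exists>a b. z = ivl a b \<and> lo \<le> a \<and> a \<le> b \<and> b \<le> hi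
    \<and> (if even (b - i + int q) then b = i + int q else b \<le> 2 * hi + 1 - i - int q)
    \<and> (if even (a - i + int q) then a = i - int q else a \<ge> 2 * lo - 1 - i + int q)"
  using z
proof (induction q arbitrary: z)
  case 0
  then have "z = ivl i i" by simp
  then show ?case using i by (intro HOL.exI[of _ i]) auto
next
  case (Suc q)
  define c where "c = (if even q then t else s)"
  have c: "c \<in> {s, t}" by (simp add: c_def)
  have "z \<in> fold act (copies c) (fold act (folded (alt_word q t s)) {ivl i i})"
    using Suc.prems unfolding alt_word_Suc_snoc c_def by simp
  then obtain y where y: "y \<in> fold act (folded (alt_word q t s)) {ivl i i}" "z \<in> fold act (copies c) {y}"
    using acts_elem by blast
  obtain a b where ab: "y = ivl a b" "lo \<le> a" "a \<le> b" "b \<le> hi"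
    "if even (b - i + int q) then b = i + int q else b \<le> 2 * hi + 1 - i - int q"
    "if even (a - i + int q) then a = i - int q else a \<ge> 2 * lo - 1 - i + int q"
    using Suc.IH[OF y(1)] by blast
  obtain a' b' where ab': "z = ivl a' b'" "lo \<le> a'" "a' \<le> b'" "b' \<le> hi"
    "if fst (vtx a) = c then a' = a + 1 else a' = a \<or> a' = a - 1"
    "if fst (vtx b) = c then b' = b - 1 else b' = b \<or> b' = b + 1"
    using class_step_out[OF c ab(2-4)] y(2) ab(1) by blast
  have ie: "even i = e" using on_iff[of s i] i(1) by simp
  have on: "fst (vtx p) = c \<longleftrightarrow> odd (p - i + int q)" for p
    using on_iff[OF c, of p] ie st by (cases "even q") (auto simp: c_def)
  have B: "if even (b' - i + int (Suc q)) then b'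
      = i + int (Suc q) else b' \<le> 2 * hi + 1 - i - int (Suc q)"
  proof (cases "even (b - i + int q)")
    case True
    then have b: "b = i + int q" using ab(5) by simp
    then consider "b' = b" | "b' = b + 1" using ab'(6) on[of b] True by auto
    then show ?thesis using b ab(4) by cases auto
  next
    case False
    then have "b' = b - 1" "b \<le> 2 * hi + 1 - i - int q" using ab'(6) on[of b] ab(5) by auto
    then show ?thesis using False by auto
  qed
  have A: "if even (a' - i + int (Suc q)) then a'
      = i - int (Suc q) else a' \<ge> 2 * lo - 1 - i + int (Suc q)"
  proof (cases "even (a - i + int q)")
    case True
    then have a: "a = i - int q" using ab(6) by simp
    then consider "a' = a" | "a' = a - 1" using ab'(5) on[of a] True by auto
    then show ?thesis using a ab(2) by cases auto
  next
    case False
    then have "a' = a + 1" "a \<ge> 2 * lo - 1 - i + int q" using ab'(5) on[of a] ab(6) by auto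
    then show ?thesis using False by auto
  qed
  show ?case using ab' A B by blast
qed

text \<open>After \<open>m\<^bsub>s,t\<^esub>\<close> factors the bounds of \<open>death_path\<close> force the right end to lie strictly to the left of the
left end.\<close>

lemma death:
  assumes i: "fst (vtx i) = s" "lo \<le> i" "i \<le> hi"
  shows "fold act (folded (alt_word (m s t) t s)) {alpha (vtx i)} = {}"
proof (rule ccontr)
  assume "fold act (folded (alt_word (m s t) t s)) {alpha (vtx i)} \<noteq> {}"
  then obtain z where z: "z \<in> fold act (folded (alt_word (m s t) t s)) {ivl i i}"
    by (auto simp: ivl_single)
  obtain a b where ab: "lo \<le> a" "a \<le> b" "b \<le> hi"
    "if even (b - i + int (m s t)) then b = i + int (m s t) else b \<le> 2 * hi + 1 - i - int (m s t)"
    "if even (a - i + int (m s t)) then a = i - int (m s t) else a \<ge> 2 * lo - 1 - i + int (m s t)"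
    using death_path[OF i z] by blast
  have m2: "int (m s t) \<ge> 2" using m_ge2[OF st] by simp
  have "b \<le> 2 * hi + 1 - i - int (m s t)" using ab(3,4) i hi by (auto split: if_splits)
  moreover have "a \<ge> 2 * lo - 1 - i + int (m s t)" using ab(1,5) i hi by (auto split: if_splits)
  ultimately show False using ab(2) hi m2 by linarith
qed

text \<open>The one-point interval has to meet again at \<open>j\<close>; by \<open>transit_path\<close> this happens for \<open>i = j + n2 - n1\<close>, and the
turning points are then \<open>j + n2\<close> and \<open>j - n1\<close>.  Both lie in the block for a suitable splitting of \<open>k - 1\<close>,
as \<open>k - 1 \<le> hi - lo\<close>.\<close>

lemma transit:
  assumes k: "1 \<le> k" "k < m s t"
    and j: "fst (vtx j) = (if even k then t else s)" "lo \<le> j" "j \<le> hi"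
  shows "\<exists>i. fst (vtx i) = s \<and> lo \<le> i \<and> i \<le> hi
    \<and> alpha (vtx j) \<in> fold act (folded (alt_word k t s)) {alpha (vtx i)}"
proof -
  define n1 where "n1 = min (k - 1) (nat (j - lo))"
  define n2 where "n2 = k - 1 - n1"
  have n: "n1 + n2 + 1 = k" using k unfolding n1_def n2_def by simp
  have n1: "int n1 \<le> j - lo" using j unfolding n1_def by simp
  have n2: "int n2 \<le> hi - j"
  proof (cases "n1 = k - 1")
    case True
    then show ?thesis using j unfolding n2_def by simp
  next
    case False
    then have "int n1 = j - lo" using j unfolding n1_def by (simp split: if_splits)
    then show ?thesis using n k hi by linarith
  qed
  define i where "i = j + int n2 - int n1"
  have "int k = int n1 + int n2 + 1" using n by simp
  then have par: "even (j - i) = odd k" unfolding i_def using n by (auto simp: n[symmetric])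
  have on: "fst (vtx q) = s \<longleftrightarrow> even q = e" for q using on_iff[of s] by simp
  have is': "fst (vtx i) = s"
  proof (cases "even k")
    case True
    then have "even j \<noteq> e" using j(1) on[of j] st by simp
    then show ?thesis using par True unfolding on by (cases "even i"; cases "even j") auto
  next
    case False
    then have "even j = e" using j(1) on[of j] st by simp
    then show ?thesis using par False unfolding on by (cases "even i"; cases "even j") auto
  qed
  have b: "lo \<le> i - int n2" "i + int n1 \<le> hi" using n1 n2 unfolding i_def by auto
  have E: "max (i - int k) (i - 2 * int n2 - 1 + int k) = j"
    "min (i + int k) (i + 2 * int n1 + 1 - int k) = j"
    unfolding i_def n[symmetric] by auto
  have "alpha (vtx j) \<in> fold act (folded (alt_word k t s)) {alpha (vtx i)}"
    using transit_path[OF is' b, of k, unfolded E] n by (simp add: ivl_single)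
  then show ?thesis using is' b by (intro HOL.exI[of _ i]) auto
qed

end

text \<open>The braid relations of a Coxeter matrix all of whose labels are finite.\<close>

section \<open>Divisibility in the folded monoid\<close>

definition alt_rels :: "'a set \<Rightarrow> ('a \<Rightarrow> 'a \<Rightarrow> nat) \<Rightarrow> ('a list \<times> 'a list) set" where
  "alt_rels T m = {(alt_word (m s t) s t, alt_word (m s t) t s) |s t. s \<in> T \<and> t \<in> T \<and> s \<noteq> t}"

lemma length_alt_word [simp]: "length (alt_word n s t) = n"
  by (induction n arbitrary: s t) simp_all

lemma set_alt_word: "set (alt_word n s t) \<subseteq> {s, t}"
  by (induction n arbitrary: s t) auto

lemma block_bounds:
  fixes M j :: int
  assumes "1 \<le> M" "0 \<le> j"
  shows "M * (j div M) \<le> j" "j < M * (j div M) + M" "0 \<le> M * (j div M)"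
proof -
  have "M * (j div M) + j mod M = j" by simp
  moreover have "0 \<le> j mod M" "j mod M < M" using assms by auto
  ultimately show "M * (j div M) \<le> j" "j < M * (j div M) + M" by linarith+
  show "0 \<le> M * (j div M)" using assms by (simp add: pos_imp_zdiv_nonneg_iff)
qed

context folding
begin

lemma transit_copies:
  assumes st: "s \<in> T" "t \<in> T" "s \<noteq> t" and k: "1 \<le> k" "k < m s t"
    and u: "u \<in> set (copies (if even k then t else s))"
  shows "\<exists>v\<in>set (copies s). alpha u \<in> fold act (folded (alt_word k t s)) {alpha v}"
proof -
  define c where "c = (if even k then t else s)"
  obtain j where j: "u = (c, j)" "0 \<le> j" "j < int N"
    using u unfolding c_def[symmetric] by (auto simp: copies_def)
  define M where "M = int (m s t) - 1"
  have M: "M \<ge> 1" using m_ge2[OF st] by (simp add: M_def)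
  define lo where "lo = M * (j div M)"
  define e where "e \<longleftrightarrow> (even j \<longleftrightarrow> c = s)"
  have lo: "lo \<le> j" "j < lo + M" "0 \<le> lo"
    using block_bounds[of M j] M j by (auto simp: lo_def)
  interpret B: folded_block T m N s t e lo "lo + int (m s t) - 2"
    by unfold_locales (use st lo j in \<open>auto simp: lo_def M_def\<close>)
  have v: "B.vtx j = u" using st unfolding B.vtx_def unfolding j e_def c_def by auto
  have "fst (B.vtx j) = (if even k then t else s)" unfolding v j c_def by simp
  then obtain i where i: "fst (B.vtx i) = s" "lo \<le> i" "i \<le> lo + int (m s t) - 2"
      "alpha (B.vtx j) \<in> fold act (folded (alt_word k t s)) {alpha (B.vtx i)}"
    using B.transit[OF k _ lo(1)] lo(2) unfolding M_def by fastforce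
  have "B.vtx i = (s, i)" using i(1) by (auto simp: B.vtx_def split: if_splits)
  moreover have "(s, i) \<in> set (copies s)" using i(2,3) lo B.hi_N by (simp add: set_copies)
  ultimately show ?thesis using i(4) v by auto
qed

lemma death_copies:
  assumes st: "s \<in> T" "t \<in> T" "s \<noteq> t" and u: "u \<in> set (copies s)"
  shows "fold act (folded (alt_word (m s t) t s)) {alpha u} = {}"
proof -
  obtain j where j: "u = (s, j)" "0 \<le> j" "j < int N"
    using u by (auto simp: copies_def)
  define M where "M = int (m s t) - 1"
  have M: "M \<ge> 1" using m_ge2[OF st] by (simp add: M_def)
  define lo where "lo = M * (j div M)"
  define e where "e \<longleftrightarrow> even j"
  have lo: "lo \<le> j" "j < lo + M" "0 \<le> lo"
    using block_bounds[of M j] M j by (auto simp: lo_def)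
  interpret B: folded_block T m N s t e lo "lo + int (m s t) - 2"
    by unfold_locales (use st lo j in \<open>auto simp: lo_def M_def\<close>)
  have v: "B.vtx j = u" unfolding B.vtx_def unfolding j e_def by simp
  show ?thesis using B.death[of j] lo unfolding v by (simp add: j M_def)
qed

lemma kill_copies:
  assumes "u \<in> set (copies t)"
  shows "fold act (folded (t # w)) {alpha u} = {}"
  using acts_class_kill[OF commuting_copies assms] by simp

text \<open>A word that annihilates all simple roots of \<open>s\<close> and \<open>t\<close> is divisible by alternating products of up to
\<open>m\<^bsub>s,t\<^esub>\<close> factors.  If a copy of the next factor did not divide the rest \<open>v\<close>, then \<open>v\<close> would not annihilate its
simple root; but \<open>transit_copies\<close> reaches this root from a simple root of \<open>s\<close> or \<open>t\<close>.\<close>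

lemma sdiv_alternate:
  assumes st: "s \<in> T" "t \<in> T" "s \<noteq> t"
    and dead: "\<And>u. u \<in> set (copies s) \<union> set (copies t) \<Longrightarrow> fold act w {alpha u} = {}"
    and k: "k \<le> m s t"
  shows "\<exists>v. scong w (folded (alt_word k t s) @ v)"
  using k
proof (induction k)
  case 0
  have "scong w w" by (rule pres_cong.refl) simp
  then show ?case by auto
next
  case (Suc k)
  then obtain v where v: "scong w (folded (alt_word k t s) @ v)" by auto
  define c where "c = (if even k then t else s)"
  have "sdiv u v" if u: "u \<in> set (copies c)" for u
  proof (rule ccontr)
    assume "\<not> sdiv u v"
    then have ne: "fold act v {alpha u} \<noteq> {}" by (rule acts_nonempty_if_not_sdiv)
    obtain r where r: "r \<in> set (copies s) \<union> set (copies t)"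
        "alpha u \<in> fold act (folded (alt_word k t s)) {alpha r}"
    proof (cases "k = 0")
      case True
      then show ?thesis using that[of u] u by (simp add: c_def)
    next
      case False
      then show ?thesis using that transit_copies[OF st, of k u] Suc.prems u by (auto simp: c_def)
    qed
    have "fold act v {alpha u} \<subseteq> fold act v (fold act (folded (alt_word k t s)) {alpha r})"
      using r(2) by (intro acts_mono) simp
    also have "\<dots> = fold act w {alpha r}" using acts_scong[OF v, of "{alpha r}"] by simp
    finally show False using ne dead[OF r(1)] by simp
  qed
  then obtain z where z: "scong v (copies c @ z)" using class_sdiv[OF commuting_copies] by blast
  have "scong w (folded (alt_word k t s) @ copies c @ z)"
    using pres_cong.trans[OF v scong_append_left[OF z]] .
  moreover have "folded (alt_word (Suc k) t s) = folded (alt_word k t s) @ copies c"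
    unfolding alt_word_Suc_snoc c_def by simp
  ultimately show ?case by auto
qed

text \<open>The left word annihilates all simple roots of \<open>s\<close> and \<open>t\<close>, so the right word divides it, and the lengths agree.\<close>

lemma folded_braid:
  assumes st: "s \<in> T" "t \<in> T" "s \<noteq> t"
  shows "scong (folded (alt_word (m s t) s t)) (folded (alt_word (m s t) t s))"
proof -
  let ?w = "folded (alt_word (m s t) s t)"
  have "m s t \<noteq> 0" using m_ge2[OF st] by simp
  then obtain n where n: "m s t = Suc n" using not0_implies_Suc by blast
  have "fold act ?w {alpha u} = {}" if "u \<in> set (copies s) \<union> set (copies t)" for u
  proof (cases "u \<in> set (copies s)")
    case True
    then show ?thesis using kill_copies[OF True, of "alt_word n t s"] n by simp
  next
    case False
    then show ?thesis using death_copies[OF st(2,1) st(3)[symmetric]] that m_sym[OF st(1,2)] by simp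
  qed
  then obtain v where v: "scong ?w (folded (alt_word (m s t) t s) @ v)"
    using sdiv_alternate[OF st, of ?w "m s t"] by blast
  then have "v = []" using scong_length[OF v] by (simp add: length_folded)
  then show ?thesis using v by simp
qed

abbreviation mcong :: "'a list \<Rightarrow> 'a list \<Rightarrow> bool" where
  "mcong \<equiv> pres_cong T (alt_rels T m)"

lemma folded_mcong: "mcong v w \<Longrightarrow> scong (folded v) (folded w)"
proof (induction rule: pres_cong.induct)
  case (refl w)
  show ?case by (rule pres_cong.refl) simp
next
  case (step u v x y)
  then obtain s t where "s \<in> T" "t \<in> T" "s \<noteq> t" "u = alt_word (m s t) s t" "v = alt_word (m s t) t s"
    unfolding alt_rels_def by blast
  then have "scong (folded u) (folded v)" using folded_braid by simp
  then have "scong (folded x @ folded u @ folded y) (folded x @ folded v @ folded y)"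
    by (intro scong_append_left scong_append_right)
  then show ?case by simp
next
  case (sym v w)
  from sym.IH show ?case by (rule pres_cong.sym)
next
  case (trans u v w)
  from trans.IH show ?case by (rule pres_cong.trans)
qed

definition mdiv :: "'a \<Rightarrow> 'a list \<Rightarrow> bool" where
  "mdiv s w \<longleftrightarrow> (\<exists>v. mcong w (s # v))"

lemma mcong_length: "mcong v w \<Longrightarrow> length v = length w"
  by (induction rule: pres_cong.induct) (auto simp: alt_rels_def)

lemma mcong_append_left:
  assumes "mcong v w" "u \<in> lists T"
  shows "mcong (u @ v) (u @ w)"
  using pres_cong_append2[OF pres_cong.refl[OF assms(2)] assms(1)] .

text \<open>The divisibility criterion for the folded monoid.  Starting from \<open>w = t w'\<close>, the alternating word in \<open>t\<close> and \<open>s\<close>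
in front of \<open>w\<close> is prolonged as long as the next letter divides the rest.  If this stops before \<open>m\<^bsub>s,t\<^esub>\<close> letters,
the induction hypothesis for the rest and \<open>transit_copies\<close> give the claim; otherwise the braid relation
shows that \<open>s\<close> divides \<open>w\<close>.\<close>

lemma acts_nonempty_if_not_mdiv:
  assumes "s \<in> T" "w \<in> lists T" "\<not> mdiv s w"
  shows "\<exists>u\<in>set (copies s). fold act (folded w) {alpha u} \<noteq> {}"
  using assms
proof (induction "length w" arbitrary: s w rule: less_induct)
  case less
  show ?case
  proof (cases w)
    case Nil
    have "(s, 0) \<in> set (copies s)" using N_pos by (simp add: set_copies)
    then show ?thesis using Nil by auto
  next
    case (Cons t w')
    have w': "t \<in> T" "w' \<in> lists T" using less.prems(2) Cons by auto
    have ww: "mcong w (t # w')" using pres_cong.refl[OF less.prems(2)] Cons by simp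
    then have st: "s \<in> T" "t \<in> T" "s \<noteq> t" using less.prems w' unfolding mdiv_def by auto
    show ?thesis
    proof (rule ccontr)
      assume neg: "\<not> ?thesis"
      have "\<exists>v\<in>lists T. mcong w (alt_word k t s @ v)" if "1 \<le> k" "k \<le> m s t" for k
        using that
      proof (induction k)
        case 0
        then show ?case by simp
      next
        case (Suc k)
        show ?case
        proof (cases "k = 0")
          case True
          then show ?thesis using ww w' by auto
        next
          case False
          then obtain v where v: "v \<in> lists T" "mcong w (alt_word k t s @ v)" using Suc by auto
          define c where "c = (if even k then t else s)"
          have cT: "c \<in> T" using st by (simp add: c_def)
          have lv: "length v < length w" using mcong_length[OF v(2)] False by simp
          have alt: "alt_word k t s \<in> lists T" using set_alt_word[of k t s] st by auto
          have "mdiv c v"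
          proof (rule ccontr)
            assume "\<not> mdiv c v"
            then obtain u where u: "u \<in> set (copies c)" "fold act (folded v) {alpha u} \<noteq> {}"
              using less.hyps[OF lv cT v(1)] by blast
            obtain r where r: "r \<in> set (copies s)"
                "alpha u \<in> fold act (folded (alt_word k t s)) {alpha r}"
              using transit_copies[OF st, of k u] False Suc.prems u(1) unfolding c_def by auto
            have "fold act (folded v) {alpha u} \<subseteq> fold act (folded v) (fold act (folded (alt_word k t s)) {alpha r})"
              using r(2) by (intro acts_mono) simp
            also have "\<dots> = fold act (folded w) {alpha r}"
              using acts_scong[OF folded_mcong[OF v(2)], of "{alpha r}"] by simp
            finally show False using u(2) neg r(1) by auto
          qed
          then obtain z where z: "mcong v (c # z)" unfolding mdiv_def by blast
          have zT: "z \<in> lists T" using pres_cong_lists[OF z] by simp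
          have "mcong w (alt_word k t s @ c # z)"
            using pres_cong.trans[OF v(2) mcong_append_left[OF z alt]] .
          moreover have "alt_word (Suc k) t s = alt_word k t s @ [c]"
            unfolding alt_word_Suc_snoc c_def by simp
          ultimately show ?thesis using zT by auto
        qed
      qed
      moreover have "1 \<le> m s t" using m_ge2[OF st] by simp
      ultimately obtain v where v: "v \<in> lists T" "mcong w (alt_word (m s t) t s @ v)"
        by blast
      have "(alt_word (m s t) t s, alt_word (m s t) s t) \<in> alt_rels T m"
        unfolding alt_rels_def using st m_sym[OF st(1,2)] by auto
      moreover have "alt_word (m s t) t s \<in> lists T" "alt_word (m s t) s t \<in> lists T"
        using set_alt_word[of "m s t"] st by fastforce+
      ultimately have "mcong (alt_word (m s t) t s @ v) (alt_word (m s t) s t @ v)"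
        using pres_cong.step[of _ _ _ T "[]" v] v(1) by fastforce
      then have "mcong w (alt_word (m s t) s t @ v)" using pres_cong.trans[OF v(2)] by blast
      moreover have "m s t \<noteq> 0" using m_ge2[OF st] by simp
      then obtain n where "m s t = Suc n" using not0_implies_Suc by blast
      ultimately show False using less.prems(3) unfolding mdiv_def by auto
    qed
  qed
qed

text \<open>Operators with \<open>x \<noteq> 0\<close> are surjective, so a common prefix, which is applied first, can be cancelled.\<close>

lemma lk_cancel:
  assumes "\<And>x. x \<noteq> 0 \<Longrightarrow> fold (lk x) (p @ v) = fold (lk x) (p @ w)" and x: "x \<noteq> 0"
  shows "fold (lk x) v = fold (lk x) w"
proof
  fix F
  have surj: "\<exists>G. fold (lk x) p G = F"
  proof (induction p arbitrary: F)
    case (Cons s p)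
    then obtain G where "fold (lk x) p G = F" by blast
    then have "fold (lk x) (s # p) (lk_inv x s G) = F" using lk_lk_inv[OF x] by simp
    then show ?case by blast
  qed simp
  then obtain G where "fold (lk x) p G = F" by blast
  then show "fold (lk x) v F = fold (lk x) w F" using fun_cong[OF assms(1)[OF x], of G] by simp
qed

text \<open>Faithfulness on positive words, by induction on the length.  The first letter of \<open>v\<close> divides \<open>w\<close> because the
actions in the limit \<open>x = 0\<close> coincide, and it is cancelled in the actions with \<open>x \<noteq> 0\<close>.\<close>

theorem mcong_if_lk_eq:
  assumes "v \<in> lists T" "w \<in> lists T"
    and "\<And>x. x \<noteq> 0 \<Longrightarrow> fold (lk x) (folded v) = fold (lk x) (folded w)"
  shows "mcong v w"
  using assms
proof (induction v arbitrary: w rule: list.induct)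
  case Nil
  have eq: "fold act (folded w) E = fold act (folded []) E" if "E \<subseteq> Pos" for E
    by (rule acts_eq_if_lk_eq[OF lk_fold_limit that]) (rule Nil.prems(3)[symmetric])
  have "w = []"
  proof (cases w)
    case (Cons s w')
    have u: "(s, 0) \<in> set (copies s)" using N_pos by (simp add: set_copies)
    have "fold act (folded w) {alpha (s, 0)} = {}" using kill_copies[OF u] Cons by simp
    then show ?thesis using eq[of "{alpha (s, 0)}"] by simp
  qed
  then show ?case by (simp add: pres_cong.refl)
next
  case (Cons s v)
  have s: "s \<in> T" "v \<in> lists T" using Cons.prems(1) by auto
  have eq: "fold act (folded w) E = fold act (folded (s # v)) E" if "E \<subseteq> Pos" for E
    by (rule acts_eq_if_lk_eq[OF lk_fold_limit that]) (rule Cons.prems(3)[symmetric])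
  have "mdiv s w"
  proof (rule ccontr)
    assume "\<not> mdiv s w"
    then obtain u where u: "u \<in> set (copies s)" "fold act (folded w) {alpha u} \<noteq> {}"
      using acts_nonempty_if_not_mdiv[OF s(1) Cons.prems(2)] by blast
    then show False using eq[of "{alpha u}"] kill_copies[OF u(1), of v] by simp
  qed
  then obtain z where z: "mcong w (s # z)" unfolding mdiv_def by blast
  have zT: "z \<in> lists T" using pres_cong_lists[OF z] by simp
  have "fold (lk x) (copies s @ folded v) = fold (lk x) (copies s @ folded z)" if "x \<noteq> 0" for x
    using Cons.prems(3)[OF that] lk_scong[OF folded_mcong[OF z], of x] by (simp only: folded_simps)
  then have "fold (lk x) (folded v) = fold (lk x) (folded z)" if "x \<noteq> 0" for x
    by (rule lk_cancel[OF _ that])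
  then have "mcong v z" using Cons.IH[OF s(2) zT] by blast
  then have "mcong (s # v) (s # z)" using mcong_append_left[of v z "[s]"] s by simp
  then show ?case using pres_cong.trans[OF _ pres_cong.sym[OF z]] by blast
qed

definition lk_letter :: "real \<Rightarrow> 'a \<times> bool \<Rightarrow> (('a \<times> int \<Rightarrow> int) \<Rightarrow> real) \<Rightarrow> ('a \<times> int \<Rightarrow> int) \<Rightarrow> real" where
  "lk_letter x l
      = (if snd l then fold (lk x) (copies (fst l)) else fold (lk_inv x) (rev (copies (fst l))))"

lemma lk_fold_inverse:
  assumes "x \<noteq> 0"
  shows "fold (lk_inv x) (rev p) (fold (lk x) p F) = F" "fold (lk x) p (fold (lk_inv x) (rev p) F) = F"
  using lk_inv_lk[OF assms] lk_lk_inv[OF assms] by (induction p arbitrary: F) simp_all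

lemma lk_letter_pos_word: "fold (lk_letter x) (pos_word w) = fold (lk x) (folded w)"
  by (induction w) (simp_all add: pos_word_def lk_letter_def)

lemma lk_letter_invariant:
  assumes "pres_cong (T \<times> UNIV) (cancel_rels S \<union> {(pos_word a, pos_word b) |a b. (a, b) \<in> R}) v w"
    and R: "\<And>a b. (a, b) \<in> R \<Longrightarrow> a \<in> lists T \<Longrightarrow> b \<in> lists T \<Longrightarrow> mcong a b"
    and x: "x \<noteq> 0"
  shows "fold (lk_letter x) v = fold (lk_letter x) w"
  using assms(1)
proof (induction rule: pres_cong.induct)
  case (refl w)
  show ?case ..
next
  case (sym v w)
  from sym.IH show ?case by (rule HOL.sym)
next
  case (trans u v w)
  from trans.IH show ?case by (rule HOL.trans)
next
  case (step u v y z)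
  from step.hyps(1) have "fold (lk_letter x) u = fold (lk_letter x) v"
  proof
    assume "(u, v) \<in> cancel_rels S"
    then obtain s e where uv: "u = [(s, e), (s, \<not> e)]" "v = []" by (auto simp: cancel_rels_def)
    show ?thesis
    proof
      fix F
      show "fold (lk_letter x) u F = fold (lk_letter x) v F"
        using lk_fold_inverse[OF x, of "copies s" F] by (cases e) (simp_all add: uv lk_letter_def)
    qed
  next
    assume "(u, v) \<in> {(pos_word a, pos_word b) |a b. (a, b) \<in> R}"
    then obtain a b where ab: "u = pos_word a" "v = pos_word b" "(a, b) \<in> R" by blast
    have "a \<in> lists T" "b \<in> lists T" using step.hyps(2,3) ab by (auto simp: pos_word_def)
    then have "mcong a b" using R ab by blast
    then show ?thesis using lk_scong[OF folded_mcong] by (simp add: ab lk_letter_pos_word)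
  qed
  then show ?case by simp
qed

end

section \<open>Injectivity for finite Coxeter matrices\<close>

lemma pres_cong_mono: "pres_cong Y R v w \<Longrightarrow> Y \<subseteq> Z \<Longrightarrow> pres_cong Z R v w"
proof (induction rule: pres_cong.induct)
  case (refl w)
  then show ?case using lists_mono by (intro pres_cong.refl) blast
next
  case (sym v w)
  then show ?case by (simp add: pres_cong.sym)
next
  case (trans u v w)
  from trans.IH trans.prems show ?case using pres_cong.trans[of Z R u v w] by simp
next
  case (step u v x y)
  then show ?case using lists_mono[OF step.prems] by (intro pres_cong.step) blast+
qed

lemma pres_cong_finite_generators:
  "pres_cong Z R v w \<Longrightarrow> \<exists>Y. finite Y \<and> Y \<subseteq> Z \<and> pres_cong Y R v w"
proof (induction rule: pres_cong.induct)
  case (refl w)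
  then show ?case by (intro HOL.exI[of _ "set w"] conjI pres_cong.refl) auto
next
  case (sym v w)
  then show ?case using pres_cong.sym by blast
next
  case (trans u v w)
  then obtain Y1 Y2 where Y: "finite Y1" "Y1 \<subseteq> Z" "pres_cong Y1 R u v" "finite Y2" "Y2 \<subseteq> Z"
      "pres_cong Y2 R v w"
    by blast
  then have "pres_cong (Y1 \<union> Y2) R u v" "pres_cong (Y1 \<union> Y2) R v w"
    by (auto intro: pres_cong_mono)
  then have "pres_cong (Y1 \<union> Y2) R u w" by (rule pres_cong.trans)
  then show ?case using Y by (intro HOL.exI[of _ "Y1 \<union> Y2"]) simp
next
  case (step u v x y)
  then have "pres_cong (set u \<union> set v \<union> set x \<union> set y) R (x @ u @ y) (x @ v @ y)"
    by (intro pres_cong.step) auto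
  then show ?case using step.hyps
    by (intro HOL.exI[of _ "set u \<union> set v \<union> set x \<union> set y"]) auto
qed

text \<open>The relations \<open>R\<close> and the generators \<open>S\<close> of the group are kept general, so that the statement applies to a
group with more generators once an equality has been confined to the letters in \<open>T\<close>.\<close>

theorem alt_monoid_injects:
  fixes m :: "'a \<Rightarrow> 'a \<Rightarrow> nat"
  assumes T: "finite T" and m_sym: "\<And>s t. s \<in> T \<Longrightarrow> t \<in> T \<Longrightarrow> m s t = m t s"
    and m_ge2: "\<And>s t. s \<in> T \<Longrightarrow> t \<in> T \<Longrightarrow> s \<noteq> t \<Longrightarrow> 2 \<le> m s t"
    and R: "\<And>a b. (a, b) \<in> R \<Longrightarrow> a \<in> lists T \<Longrightarrow> b \<in> lists T \<Longrightarrow> pres_cong T (alt_rels T m) a b"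
    and uv: "u \<in> lists T" "v \<in> lists T"
      "pres_cong (T \<times> UNIV) (cancel_rels S \<union> {(pos_word a, pos_word b) |a b. (a, b) \<in> R}) (pos_word u) (pos_word v)"
  shows "pres_cong T (alt_rels T m) u v"
proof -
  define N where "N = (\<Prod>(s, t)\<in>T \<times> T. if s = t then 1 else m s t - 1)"
  have N0: "0 < N"
    unfolding N_def
  proof (rule prod_pos)
    fix p assume "p \<in> T \<times> T"
    then show "0 < (case p of (s, t) \<Rightarrow> if s = t then 1 else m s t - 1)"
      using m_ge2[of "fst p" "snd p"] by (auto split: prod.splits)
  qed
  have dvd: "int (m s t) - 1 dvd int N" if st: "s \<in> T" "t \<in> T" "s \<noteq> t" for s t
  proof -
    have "(case (s, t) of (s, t) \<Rightarrow> if s = t then 1 else m s t - 1) dvd N"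
      unfolding N_def using T st by (intro dvd_prodI) auto
    then have "m s t - 1 dvd N" using st by simp
    then have "int (m s t - 1) dvd int N" by (simp only: int_dvd_int_iff)
    then show ?thesis using m_ge2[OF st] by (simp add: of_nat_diff)
  qed
  interpret folding T m N
    using T m_sym m_ge2 N0 dvd by unfold_locales auto
  show ?thesis
  proof (rule mcong_if_lk_eq[OF uv(1,2)])
    fix x :: real assume "x \<noteq> 0"
    then show "fold (lk x) (folded u) = fold (lk x) (folded v)"
      using lk_letter_invariant[OF uv(3) R] by (simp add: lk_letter_pos_word)
  qed
qed

text \<open>As \<open>s\<close> and \<open>t\<close> are involutions, \<open>ts\<close> is the inverse of \<open>st\<close>, and \<open>st = 1\<close> would mean \<open>s = t\<close>.\<close>

section \<open>Coxeter systems\<close>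

lemma coxeter_m_facts:
  assumes "coxeter_system W S" "s \<in> S" "t \<in> S"
  shows "cox_m W s t = cox_m W t s" "s \<noteq> t \<Longrightarrow> cox_m W s t \<noteq> 1"
proof -
  interpret group W using assms by (simp add: coxeter_system_def)
  have c: "s \<in> carrier W" "t \<in> carrier W" and o: "ord s = 2" "ord t = 2"
    using assms by (auto simp: coxeter_system_def)
  have sq: "s \<otimes>\<^bsub>W\<^esub> s = \<one>\<^bsub>W\<^esub>" "t \<otimes>\<^bsub>W\<^esub> t = \<one>\<^bsub>W\<^esub>"
    using pow_ord_eq_1[OF c(1)] pow_ord_eq_1[OF c(2)] c o by (simp_all add: numeral_2_eq_2)
  have i: "inv\<^bsub>W\<^esub> s = s" "inv\<^bsub>W\<^esub> t = t" using sq c by (simp_all add: inv_equality)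
  have "inv\<^bsub>W\<^esub> (s \<otimes>\<^bsub>W\<^esub> t) = t \<otimes>\<^bsub>W\<^esub> s" using c i by (simp add: inv_mult_group)
  then show "cox_m W s t = cox_m W t s"
    using ord_inv[of "s \<otimes>\<^bsub>W\<^esub> t"] c by (simp add: cox_m_def)
  show "cox_m W s t \<noteq> 1" if "s \<noteq> t"
  proof
    assume "cox_m W s t = 1"
    then have "s \<otimes>\<^bsub>W\<^esub> t = \<one>\<^bsub>W\<^esub>" using pow_ord_eq_1[of "s \<otimes>\<^bsub>W\<^esub> t"] c by (simp add: cox_m_def)
    then have "inv\<^bsub>W\<^esub> t = s" using c by (simp add: inv_equality)
    then show False using i that by simp
  qed
qed

lemma set_alt_word_eq: "2 \<le> n \<Longrightarrow> set (alt_word n s t) = {s, t}"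
proof -
  assume "2 \<le> n"
  then obtain k where "n = Suc (Suc k)" by (metis add_2_eq_Suc le_Suc_ex)
  then show ?thesis using set_alt_word[of k s t] by auto
qed

text \<open>An equality in the group uses finitely many letters.  Infinite labels are replaced by \<open>L + 2\<close>, where \<open>L\<close> is the
common length of the positive words; this adds relations, but they are too long to be applied to such words.\<close>

lemma braid_monoid_injects:
  assumes cox: "coxeter_system W S" and u: "u \<in> lists S" and v: "v \<in> lists S"
    and eq: "pres_cong (S \<times> UNIV) (cancel_rels S \<union> braid_group_rels W S) (pos_word u) (pos_word v)"
  shows "pres_cong S (braid_rels W S) u v"
proof -
  define L where "L = length u"
  define m where "m s t = (if cox_m W s t = 0 then L + 2 else cox_m W s t)" for s t
  obtain Y where Y: "finite Y" "Y \<subseteq> S \<times> UNIV"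
      "pres_cong Y (cancel_rels S \<union> braid_group_rels W S) (pos_word u) (pos_word v)"
    using pres_cong_finite_generators[OF eq] by blast
  define T where "T = fst ` Y \<union> set u \<union> set v"
  have T: "finite T" "T \<subseteq> S" using Y u v by (auto simp: T_def)
  have "Y \<subseteq> T \<times> UNIV" by (force simp: T_def)
  from pres_cong_mono[OF Y(3) this]
  have eqT: "pres_cong (T \<times> UNIV) (cancel_rels S \<union> {(pos_word a, pos_word b) |a b. (a, b) \<in> braid_rels W S})
      (pos_word u) (pos_word v)"
    by (simp add: braid_group_rels_def)
  have m2: "2 \<le> m s t" if "s \<in> S" "t \<in> S" "s \<noteq> t" for s t
    using coxeter_m_facts(2)[OF cox that] by (auto simp: m_def)
  have rels: "pres_cong T (alt_rels T m) a b" if ab: "(a, b) \<in> braid_rels W S" "a \<in> lists T"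
      "b \<in> lists T" for a b
  proof -
    obtain s t where st: "a = alt_word (cox_m W s t) s t" "b = alt_word (cox_m W s t) t s"
        "s \<in> S" "t \<in> S" "s \<noteq> t" "cox_m W s t \<noteq> 0"
      using ab(1) unfolding braid_rels_def by blast
    have m: "m s t = cox_m W s t" using st by (simp add: m_def)
    then have "set a = {s, t}" using set_alt_word_eq[OF m2[OF st(3-5)], of s t] st by simp
    then have "s \<in> T" "t \<in> T" using ab(2) by auto
    moreover have "a = alt_word (m s t) s t" "b = alt_word (m s t) t s" using st m by simp_all
    ultimately have "(a, b) \<in> alt_rels T m" unfolding alt_rels_def using st(5) by blast
    from pres_cong.step[OF this ab(2,3), of "[]" "[]"] show ?thesis by simp
  qed
  have uvl: "u \<in> lists T" "v \<in> lists T" by (auto simp: T_def)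
  have sym: "m s t = m t s" if "s \<in> T" "t \<in> T" for s t
  proof -
    have "s \<in> S" "t \<in> S" using that T by auto
    then show ?thesis using coxeter_m_facts(1)[OF cox, of s t] by (simp add: m_def)
  qed
  have m2T: "2 \<le> m s t" if "s \<in> T" "t \<in> T" "s \<noteq> t" for s t
    using m2 that T(2) by blast
  have uvT: "pres_cong T (alt_rels T m) u v"
    by (rule alt_monoid_injects[OF T(1) sym m2T rels uvl eqT])
  have "length a = length b \<and> (length a \<le> L \<longrightarrow> pres_cong S (braid_rels W S) a b)"
    if "pres_cong T (alt_rels T m) a b" for a b
    using that
  proof (induction rule: pres_cong.induct)
    case (refl w)
    then show ?case using T lists_mono by (auto intro!: pres_cong.refl)
  next
    case (sym v w)
    then show ?case using pres_cong.sym by auto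
  next
    case (trans u v w)
    then show ?case using pres_cong.trans[of S "braid_rels W S" u v w] by auto
  next
    case (step a b x y)
    then obtain s t where st: "a = alt_word (m s t) s t" "b = alt_word (m s t) t s"
        "s \<in> T" "t \<in> T" "s \<noteq> t"
      unfolding alt_rels_def by blast
    have "pres_cong S (braid_rels W S) (x @ a @ y) (x @ b @ y)" if len: "length (x @ a @ y) \<le> L"
    proof -
      have nz: "cox_m W s t \<noteq> 0"
      proof
        assume "cox_m W s t = 0"
        then have "length a = L + 2" using st(1) by (simp add: m_def)
        then show False using len by simp
      qed
      then have "a = alt_word (cox_m W s t) s t" "b = alt_word (cox_m W s t) t s"
        using st by (simp_all add: m_def)
      moreover have "s \<in> S" "t \<in> S" using st T(2) by auto
      ultimately have "(a, b) \<in> braid_rels W S" unfolding braid_rels_def using nz st(5) by blast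
      then show ?thesis using step.hyps lists_mono[OF T(2)] by (intro pres_cong.step) blast+
    qed
    then show ?case using st by simp
  qed
  from this[OF uvT] show ?thesis by (simp add: L_def)
qed

lemma pos_word_append: "pos_word (v @ w) = pos_word v @ pos_word w"
  by (simp add: pos_word_def)

lemma pos_word_lists: "w \<in> lists S \<Longrightarrow> pos_word w \<in> lists (S \<times> UNIV)"
  by (auto simp: pos_word_def)

lemma pos_word_cong:
  "pres_cong S (braid_rels W S) v w \<Longrightarrow>
    pres_cong (S \<times> UNIV) (cancel_rels S \<union> braid_group_rels W S) (pos_word v) (pos_word w)"
proof (induction rule: pres_cong.induct)
  case (refl w)
  then show ?case by (intro pres_cong.refl pos_word_lists)
next
  case (sym v w)
  from sym.IH show ?case by (rule pres_cong.sym)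
next
  case (trans u v w)
  from trans.IH show ?case by (rule pres_cong.trans)
next
  case (step u v x y)
  have "(pos_word u, pos_word v) \<in> cancel_rels S \<union> braid_group_rels W S"
    using step.hyps(1) unfolding braid_group_rels_def by blast
  from pres_cong.step[OF this pos_word_lists pos_word_lists pos_word_lists pos_word_lists, OF step.hyps(2-5)]
  show ?case by (simp add: pos_word_append)
qed

lemma canonical_map_class:
  assumes "w \<in> lists S"
  shows "braid_canonical_map W S (pres_rel S (braid_rels W S) `` {w})
    = group_rel S (braid_group_rels W S) `` {pos_word w}"
proof -
  let ?G = "pres_rel (S \<times> UNIV) (cancel_rels S \<union> braid_group_rels W S)"
  have "?G `` {pos_word v} = ?G `` {pos_word w}" if "(w, v) \<in> pres_rel S (braid_rels W S)" for v
    using equiv_class_eq[OF equiv_pres_rel, of "pos_word w" "pos_word v"] pos_word_cong that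
    by (force simp: pres_rel_def)
  moreover have "(w, w) \<in> pres_rel S (braid_rels W S)"
    using assms by (simp add: pres_rel_def pres_cong.refl del: in_lists_conv_set)
  ultimately show ?thesis
    unfolding braid_canonical_map_def group_rel_def by blast
qed

theorem corollary5p20:
  fixes W :: "('a, 'b) monoid_scheme" and S :: "'a set"
  assumes "irreducible_coxeter_system W S"
  shows "braid_canonical_map W S \<in> hom (braid_monoid W S) (braid_group W S)
    \<and> braid_canonical_map W S \<one>\<^bsub>braid_monoid W S\<^esub> = \<one>\<^bsub>braid_group W S\<^esub>
    \<and> (\<forall>s\<in>S. braid_canonical_map W S (braid_monoid_gen W S s) = braid_group_gen W S s)
    \<and> inj_on (braid_canonical_map W S) (carrier (braid_monoid W S))"
proof (intro conjI ballI)
  have cox: "coxeter_system W S" using assms unfolding irreducible_coxeter_system_def by (rule conjunct1)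
  let ?M = "pres_rel S (braid_rels W S)"
  let ?R = "cancel_rels S \<union> braid_group_rels W S"
  let ?G = "pres_rel (S \<times> UNIV) ?R"
  have M: thesis
    if "A \<in> carrier (braid_monoid W S)" "\<And>w. w \<in> lists S \<Longrightarrow> A = ?M `` {w} \<Longrightarrow> thesis" for A thesis
  proof -
    have "carrier (braid_monoid W S) = lists S // ?M"
      by (simp add: braid_monoid_def presented_monoid_def)
    with that(1) have "A \<in> lists S // ?M" by (simp only:)
    then show thesis by (rule quotientE) (rule that(2))
  qed
  have canon: "braid_canonical_map W S (?M `` {w}) = ?G `` {pos_word w}" if "w \<in> lists S" for w
    by (rule canonical_map_class[OF that, unfolded group_rel_def])
  show "braid_canonical_map W S \<in> hom (braid_monoid W S) (braid_group W S)"
  proof (rule homI)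
    fix A assume "A \<in> carrier (braid_monoid W S)"
    then obtain w where w: "w \<in> lists S" "A = ?M `` {w}" by (rule M)
    have "carrier (braid_group W S) = lists (S \<times> UNIV) // ?G"
      by (simp add: braid_group_def presented_group_def presented_monoid_def)
    then show "braid_canonical_map W S A \<in> carrier (braid_group W S)"
      unfolding w(2) canon[OF w(1)] using quotientI[OF pos_word_lists[OF w(1)], of ?G] by (simp only:)
  next
    fix A B assume A: "A \<in> carrier (braid_monoid W S)" and B: "B \<in> carrier (braid_monoid W S)"
    obtain v where v: "v \<in> lists S" "A = ?M `` {v}" using A by (rule M)
    obtain w where w: "w \<in> lists S" "B = ?M `` {w}" using B by (rule M)
    have "A \<otimes>\<^bsub>braid_monoid W S\<^esub> B = ?M `` {v @ w}"
      unfolding braid_monoid_def v w by (rule presented_monoid_mult_class[OF v(1) w(1)])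
    moreover have vw: "v @ w \<in> lists S" using v(1) w(1) by simp
    moreover have
        "?G `` {pos_word v} \<otimes>\<^bsub>braid_group W S\<^esub> ?G `` {pos_word w} = ?G `` {pos_word v @ pos_word w}"
      unfolding braid_group_def presented_group_def
      by (rule presented_monoid_mult_class[OF pos_word_lists[OF v(1)] pos_word_lists[OF w(1)]])
    ultimately show "braid_canonical_map W S (A \<otimes>\<^bsub>braid_monoid W S\<^esub> B)
        = braid_canonical_map W S A \<otimes>\<^bsub>braid_group W S\<^esub> braid_canonical_map W S B"
      using canon[OF v(1)] canon[OF w(1)] canon[OF vw] unfolding v(2) w(2)
      by (simp only: pos_word_append)
  qed
  show "braid_canonical_map W S \<one>\<^bsub>braid_monoid W S\<^esub> = \<one>\<^bsub>braid_group W S\<^esub>"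
    using canon[of "[]"]
    by (simp add: braid_monoid_def braid_group_def presented_group_def presented_monoid_def pos_word_def)
  show "braid_canonical_map W S (braid_monoid_gen W S s) = braid_group_gen W S s" if "s \<in> S" for s
    using canonical_map_class[of "[s]" S W] that by (simp add: braid_monoid_gen_def braid_group_gen_def)
  show "inj_on (braid_canonical_map W S) (carrier (braid_monoid W S))"
  proof (rule inj_onI)
    fix A B assume A: "A \<in> carrier (braid_monoid W S)" and B: "B \<in> carrier (braid_monoid W S)"
      and eq: "braid_canonical_map W S A = braid_canonical_map W S B"
    obtain v where v: "v \<in> lists S" "A = ?M `` {v}" using A by (rule M)
    obtain w where w: "w \<in> lists S" "B = ?M `` {w}" using B by (rule M)
    have "?G `` {pos_word v} = ?G `` {pos_word w}"
      using eq canon[OF v(1)] canon[OF w(1)] unfolding v(2) w(2) by simp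
    then have "(pos_word v, pos_word w) \<in> ?G"
      by (rule eq_equiv_class[OF _ equiv_pres_rel pos_word_lists[OF w(1)]])
    then have "(v, w) \<in> ?M"
      using braid_monoid_injects[OF cox v(1) w(1)] by (simp add: pres_rel_def)
    from equiv_class_eq[OF equiv_pres_rel this] show "A = B" using v(2) w(2) by simp
  qed
qed

end
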